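(* Let $G_n=(V_n,E_n)$ be a sequence of non-bipartite, finite, connected, $d_n$-regular graphs, with $d_n\ge 3$ for all $n$, which is asymptotically one-sided Ramanujan. (i) Suppose that $d_n=d$ for all $n$, and that there exists a sequence $r_n\to\infty$ such that the maximal number of simple cycles contained in a ball of radius $r_n$ in $G_n$ is bounded uniformly in $n$. Then the corresponding sequence of simple random walks exhibits cutoff around time $\frac{d}{d-2}\log_{d-1}|V_n|$. (ii) Suppose that $d_n\to\infty$ and $\log d_n=o(\log_{d_n}|V_n|)$ as $n\to\infty$. Then the corresponding sequence of simple random walks exhibits cutoff around time $\log_{d_n}|V_n|$.
   Context: Simple random walk (SRW) on a $d$-regular graph $G=(V,E)$ is the discrete-time Markov chain with transition matrix $P(x,y)=1/d$ if $\{x,y\}\in E$ and $P(x,y)=0$ otherwise; its stationary distribution $\pi$ is uniform on $V$. Asymptotically one-sided Ramanujan: let $\rho_d:=\frac{2\sqrt{d-1}}{d}$, and let $1=\lambda_1(n)>\lambda_2(n)\ge\cdots\ge\lambda_{|V_n|}(n)\ge -1$ be the eigenvalues of the transition matrix $P_n$ of SRW on $G_n$. The sequence $(G_n)$ is asymptotically one-sided Ramanujan if $|V_n|\to\infty$, $\lambda_2(n)\le\rho_{d_n}^{1-o(1)}$ (i.e. there is a sequence $\delta_n\to 0$ with $\lambda_2(n)\le\rho_{d_n}^{1-\delta_n}$ for all $n$), and $\liminf_{n\to\infty}\min\{\lambda_i(n):\lambda_i(n)\ne -1\}>-1$. Mixing time: for distributions $\mu,\nu$ on a finite set $\Omega$,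 $\|\mu-\nu\|_{\mathrm{TV}}=\frac12\sum_{y\in\Omega}|\mu(y)-\nu(y)|$. With $\mathrm P_x^t$ the law at time $t$ of the chain started from $x$, $t_{\mathrm{mix}}(\varepsilon):=\inf\{t:\max_x\|\mathrm P_x^t-\pi\|_{\mathrm{TV}}\le\varepsilon\}$; $t^{(n)}_{\mathrm{mix}}$ denotes this quantity for the $n$-th chain. Cutoff: a sequence of chains exhibits cutoff if $\lim_{n\to\infty}t^{(n)}_{\mathrm{mix}}(\varepsilon)/t^{(n)}_{\mathrm{mix}}(1-\varepsilon)=1$ for every $\varepsilon\in(0,1/2]$. It exhibits cutoff around time $t_n$ if $\lim_{n\to\infty}t^{(n)}_{\mathrm{mix}}(\varepsilon)/t_n=1$ for every $\varepsilon\in(0,1)$. The ball of radius $r$ around a vertex $v$ is the subgraph induced on the set of vertices at graph distance at most $r$ from $v$. *)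

theory Defs
  imports
    "Graph_Theory.Graph_Theory"
    "Jordan_Normal_Form.Char_Poly"
    "HOL-Library.Extended_Real"
    "HOL-Library.Landau_Symbols"
begin

text \<open>
  A finite simple graph is a \<^locale>\<open>pair_graph\<close>: a finite symmetric loop-free digraph
  whose arcs are pairs of vertices, so that the edge \<open>{x, y}\<close> is present iff both arcs
  \<open>(x, y)\<close> and \<open>(y, x)\<close> are.
\<close>

definition regular_graph :: "nat \<Rightarrow> 'a pair_pre_digraph \<Rightarrow> bool" where
  "regular_graph d G \<longleftrightarrow> pair_graph G \<and> (\<forall>v\<in>pverts G. out_degree (with_proj G) v = d)"

definition bipartite :: "'a pair_pre_digraph \<Rightarrow> bool" where
  "bipartite G \<longleftrightarrow> (\<exists>A B. A \<union> B = pverts G \<and> A \<inter> B = {} \<and>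
     (\<forall>(x, y)\<in>parcs G. (x \<in> A \<and> y \<in> B) \<or> (x \<in> B \<and> y \<in> A)))"

subsection \<open>Simple cycles in balls\<close>

text \<open>With unit weights, \<^const>\<open>wf_digraph.\<mu>\<close> is the graph distance
  (infinite if there is no path).\<close>

definition ball_vertices :: "'a pair_pre_digraph \<Rightarrow> 'a \<Rightarrow> real \<Rightarrow> 'a set" where
  "ball_vertices G v r = {w \<in> pverts G. wf_digraph.\<mu> (with_proj G) (\<lambda>_. 1) v w \<le> ereal r}"

definition graph_ball :: "'a pair_pre_digraph \<Rightarrow> 'a \<Rightarrow> real \<Rightarrow> ('a, 'a \<times> 'a) pre_digraph" where
  "graph_ball G v r = induce_subgraph (with_proj G) (ball_vertices G v r)"

text \<open>
  A simple cycle is counted as a subgraph, represented by its set of undirected edges, so the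
  \<open>2 * k\<close> rooted oriented traversals of a cycle of length \<open>k\<close> count only once. The bound
  \<open>3 \<le> length p\<close> discards the closed walks that traverse one edge back and forth, which
  \<^const>\<open>pre_digraph.cycle\<close> admits.
\<close>

definition simple_cycles :: "('a, 'b) pre_digraph \<Rightarrow> 'a set set set" where
  "simple_cycles H =
     {(\<lambda>e. {tail H e, head H e}) ` set p | p. pre_digraph.cycle H p \<and> 3 \<le> length p}"

subsection \<open>Finite Markov chains\<close>

text \<open>\<open>law V P x t\<close> is the row of \<open>x\<close> in the \<open>t\<close>-th power of the transition matrix \<open>P\<close>
  on the finite state space \<open>V\<close>.\<close>

primrec law :: "'a set \<Rightarrow> ('a \<Rightarrow> 'a \<Rightarrow> real) \<Rightarrow> 'a \<Rightarrow> nat \<Rightarrow> 'a \<Rightarrow> real" where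
  "law V P x 0 = (\<lambda>y. if y = x then 1 else 0)"
| "law V P x (Suc t) = (\<lambda>y. \<Sum>z\<in>V. law V P x t z * P z y)"

definition tv_dist :: "'a set \<Rightarrow> ('a \<Rightarrow> real) \<Rightarrow> ('a \<Rightarrow> real) \<Rightarrow> real" where
  "tv_dist V \<mu> \<nu> = 1 / 2 * (\<Sum>y\<in>V. \<bar>\<mu> y - \<nu> y\<bar>)"

text \<open>The infimum is taken in \<^typ>\<open>nat\<close>, where \<open>Inf {} = 0\<close>. For an irreducible aperiodic
  chain with stationary distribution \<open>\<pi>\<close> and \<open>\<epsilon> > 0\<close> the set is nonempty.\<close>

definition t_mix :: "'a set \<Rightarrow> ('a \<Rightarrow> 'a \<Rightarrow> real) \<Rightarrow> ('a \<Rightarrow> real) \<Rightarrow> real \<Rightarrow> nat" where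
  "t_mix V P \<pi> \<epsilon> = Inf {t. Max ((\<lambda>x. tv_dist V (law V P x t) \<pi>) ` V) \<le> \<epsilon>}"

text \<open>The first argument maps \<open>n\<close> to the function \<open>\<epsilon> \<mapsto> t_mix(\<epsilon>)\<close> of the \<open>n\<close>-th chain.\<close>

definition cutoff_around :: "(nat \<Rightarrow> real \<Rightarrow> nat) \<Rightarrow> (nat \<Rightarrow> real) \<Rightarrow> bool" where
  "cutoff_around tm t \<longleftrightarrow>
     (\<forall>\<epsilon>\<in>{0<..<1}. (\<lambda>n. real (tm n \<epsilon>) / t n) \<longlonglongrightarrow> 1)"

text \<open>
  The eigenvalues of a transition matrix, with multiplicity and in non-increasing order. The
  characteristic polynomial does not depend on the chosen enumeration of the state space. Only
  real roots are collected, which are all of them when \<open>P\<close> is symmetric.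
\<close>

definition transition_mat :: "'a set \<Rightarrow> ('a \<Rightarrow> 'a \<Rightarrow> real) \<Rightarrow> real mat" where
  "transition_mat V P =
     (let xs = (SOME xs. distinct xs \<and> set xs = V)
      in mat (length xs) (length xs) (\<lambda>(i, j). P (xs ! i) (xs ! j)))"

definition eigenvalues :: "'a set \<Rightarrow> ('a \<Rightarrow> 'a \<Rightarrow> real) \<Rightarrow> real list" where
  "eigenvalues V P = rev (sorted_list_of_multiset (proots (char_poly (transition_mat V P))))"

subsection \<open>Simple random walk\<close>

definition srw :: "'a pair_pre_digraph \<Rightarrow> 'a \<Rightarrow> 'a \<Rightarrow> real" where
  "srw G x y = (if (x, y) \<in> parcs G then 1 / real (out_degree (with_proj G) x) else 0)"

definition srw_t_mix :: "'a pair_pre_digraph \<Rightarrow> real \<Rightarrow> nat" where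
  "srw_t_mix G = t_mix (pverts G) (srw G) (\<lambda>_. 1 / real (card (pverts G)))"

definition srw_eigenvalues :: "'a pair_pre_digraph \<Rightarrow> real list" where
  "srw_eigenvalues G = eigenvalues (pverts G) (srw G)"

definition ramanujan_rho :: "nat \<Rightarrow> real" where
  "ramanujan_rho d = 2 * sqrt (real d - 1) / real d"

text \<open>Lists are indexed from 0, so \<open>srw_eigenvalues G ! 1\<close> is the second largest eigenvalue.\<close>

definition asymp_one_sided_ramanujan ::
  "(nat \<Rightarrow> nat) \<Rightarrow> (nat \<Rightarrow> 'a pair_pre_digraph) \<Rightarrow> bool" where
  "asymp_one_sided_ramanujan d G \<longleftrightarrow>
     filterlim (\<lambda>n. card (pverts (G n))) at_top sequentially \<and>
     (\<exists>\<delta>. \<delta> \<longlonglongrightarrow> 0 \<and>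
        (\<forall>n. srw_eigenvalues (G n) ! 1 \<le> ramanujan_rho (d n) powr (1 - \<delta> n))) \<and>
     liminf (\<lambda>n. ereal (Min {l \<in> set (srw_eigenvalues (G n)). l \<noteq> -1})) > -1"

end

theory Submission
  imports Defs
begin

text \<open>
  Fix a set \<open>A\<close> of vertices and call \<open>y\<close> bad if \<open>P\<^sup>u(y, A)\<close> is far from \<open>\<pi>(A)\<close> for some time \<open>u\<close> of
  the window \<open>[s, s + t]\<close>. By the spectral gap the set \<open>B\<close> of bad vertices has small density once
  \<open>s\<close> is a large constant (a large multiple of \<open>log d\<close> if the degree grows), and by time
  \<open>s + t\<close> the walk has mixed up to the probability that it never leaves \<open>B\<close> during \<open>t\<close> steps. That
  probability is small because the walk killed outside a rare set \<open>B\<close> is contracted: the operator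
  \<open>1\<^sub>B A\<^sub>k 1\<^sub>B\<close>, with \<open>A\<^sub>k\<close> the kernel of the non-backtracking walk of odd length \<open>k\<close>, is
  non-negative, so its norm is the supremum of its quadratic form, which is at most the density of
  \<open>B\<close> plus the largest value on the nontrivial spectrum of the polynomial \<open>q\<^sub>k\<close> with
  \<open>A\<^sub>k = q\<^sub>k(P)\<close>. As \<open>k\<close> is odd, \<open>q\<^sub>k\<close> is negative to the left of \<open>-\<rho>\<close>; this is why the one-sided
  bound \<open>\<lambda>\<^sub>2 \<le> \<rho>\<^sup>1\<^sup>-\<^sup>o\<^sup>(\<^sup>1\<^sup>)\<close> suffices. The walk passes from non-backtracking
  steps to time by the linear speed \<open>(d - 2) / d\<close> of its lift to the tree, for which exponential
  moments are enough. In the growing degree case \<open>k = 1\<close> already works. The lower bounds count the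
  vertices that can be reached.
\<close>

section \<open>Spectral decomposition of symmetric kernels\<close>

text \<open>Passing from an l2 norm to a value at one point costs a factor \<open>sqrt N\<close>. If
  the killed walk were contracted step by step, its rate would be about \<rho>, and at fixed degree
  the time ln N / (2 ln (1/\<rho>)) needed to beat \<open>sqrt N\<close> is larger than the claimed
  one. Segments of length k repair this: on the relevant spectrum q_k is at most about (k + 1)
  (d-1)^(-k/2), so a total length k m slightly above log N to base d-1 suffices, the factor k + 1
  being negligible for large k; dividing by the speed gives the time. For growing degree ln
  (1/\<rho>) is asymptotic to (ln d)/2, and single steps lose nothing. The density of B is added to
  the norm of A_k and must therefore be of the same order. This fixes s: a constant at fixed degree,
  of order ln d otherwise, and the second hypothesis of (ii) makes the latter negligible. The window
  is as long as the killed walk runs, but the density bound does not depend on its length, because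
  the squared l2 norms over the window form a convergent geometric series.\<close>

definition kapply :: "'a set \<Rightarrow> ('a \<Rightarrow> 'a \<Rightarrow> real) \<Rightarrow> ('a \<Rightarrow> real) \<Rightarrow> 'a \<Rightarrow> real" where
  "kapply V K f = (\<lambda>x. if x \<in> V then \<Sum>y\<in>V. K x y * f y else 0)"

definition kinner :: "'a set \<Rightarrow> ('a \<Rightarrow> real) \<Rightarrow> ('a \<Rightarrow> real) \<Rightarrow> real" where
  "kinner V f g = (\<Sum>x\<in>V. f x * g x)"

text \<open>\<open>kapply\<close> is cut off to 0 outside \<open>V\<close>, so that eigenvalue
  equations can be equalities of functions on the whole type. Functions are kept supported in
  \<open>V\<close> to match.\<close>

definition supp_in :: "'a set \<Rightarrow> ('a \<Rightarrow> real) \<Rightarrow> bool" where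
  "supp_in V f \<longleftrightarrow> (\<forall>x. x \<notin> V \<longrightarrow> f x = 0)"

lemma kapply_outside [simp]: "x \<notin> V \<Longrightarrow> kapply V K f x = 0"
  by (simp add: kapply_def)

lemma kapply_add: "kapply V K (\<lambda>x. f x + g x) = (\<lambda>x. kapply V K f x + kapply V K g x)"
  by (auto simp: kapply_def algebra_simps sum.distrib)

lemma kapply_diff: "kapply V K (\<lambda>x. f x - g x) = (\<lambda>x. kapply V K f x - kapply V K g x)"
  by (auto simp: kapply_def algebra_simps sum_subtractf)

lemma kapply_scale: "kapply V K (\<lambda>x. c * f x) = (\<lambda>x. c * kapply V K f x)"
  by (auto simp: kapply_def algebra_simps sum_distrib_left)

lemma kapply_sum:
  "kapply V K (\<lambda>x. \<Sum>i\<in>I. F i x) = (\<lambda>x. \<Sum>i\<in>I. kapply V K (F i) x)"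
proof
  fix x
  have "(\<Sum>y\<in>V. \<Sum>i\<in>I. K x y * F i y) = (\<Sum>i\<in>I. \<Sum>y\<in>V. K x y * F i y)"
    by (rule sum.swap)
  then show "kapply V K (\<lambda>x. \<Sum>i\<in>I. F i x) x = (\<Sum>i\<in>I. kapply V K (F i) x)"
    by (simp add: kapply_def sum_distrib_left)
qed

lemma funpow_kapply_sum:
  "(kapply V K ^^ t) (\<lambda>x. \<Sum>i\<in>I. F i x) = (\<lambda>x. \<Sum>i\<in>I. (kapply V K ^^ t) (F i) x)"
  by (induction t) (simp_all add: kapply_sum)

lemma funpow_kapply_eigen:
  assumes "kapply V K f = (\<lambda>x. z * f x)"
  shows "(kapply V K ^^ t) f = (\<lambda>x. z ^ t * f x)"
  by (induction t) (simp_all add: assms kapply_scale mult.assoc mult.left_commute[of z])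

lemma supp_in_funpow_kapply: "supp_in V f \<Longrightarrow> supp_in V ((kapply V K ^^ t) f)"
  by (cases t) (auto simp: supp_in_def)

lemma kinner_nonneg: "0 \<le> kinner V f f"
  by (simp add: kinner_def sum_nonneg)

lemma kinner_commute: "kinner V f g = kinner V g f"
  by (simp add: kinner_def mult.commute)

lemma kinner_scale_left: "kinner V (\<lambda>x. c * f x) g = c * kinner V f g"
  by (simp add: kinner_def sum_distrib_left mult_ac)

lemma kinner_scale_right: "kinner V f (\<lambda>x. c * g x) = c * kinner V f g"
  by (simp add: kinner_def sum_distrib_left mult_ac)

lemma kinner_diff_left: "kinner V (\<lambda>x. f x - h x) g = kinner V f g - kinner V h g"
  by (simp add: kinner_def sum_subtractf algebra_simps)

lemma kinner_add_left: "kinner V (\<lambda>x. f x + h x) g = kinner V f g + kinner V h g"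
  by (simp add: kinner_def sum.distrib algebra_simps)

lemma kinner_sum_left: "kinner V (\<lambda>x. \<Sum>i\<in>I. F i x) g = (\<Sum>i\<in>I. kinner V (F i) g)"
proof -
  have "(\<Sum>x\<in>V. \<Sum>i\<in>I. F i x * g x) = (\<Sum>i\<in>I. \<Sum>x\<in>V. F i x * g x)"
    by (rule sum.swap)
  then show ?thesis by (simp add: kinner_def sum_distrib_right)
qed

section \<open>Polynomials in a kernel operator\<close>

definition poly_kapply :: "'a set \<Rightarrow> ('a \<Rightarrow> 'a \<Rightarrow> real) \<Rightarrow> real poly \<Rightarrow> ('a \<Rightarrow> real) \<Rightarrow> 'a \<Rightarrow> real" where
  "poly_kapply V K p f = (\<lambda>x. \<Sum>i\<le>degree p. coeff p i * (kapply V K ^^ i) f x)"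

lemma poly_kapply_altdef:
  assumes "degree p \<le> N"
  shows "poly_kapply V K p f = (\<lambda>x. \<Sum>i\<le>N. coeff p i * (kapply V K ^^ i) f x)"
  unfolding poly_kapply_def
proof
  fix x
  show "(\<Sum>i\<le>degree p. coeff p i * (kapply V K ^^ i) f x) = (\<Sum>i\<le>N. coeff p i * (kapply V K ^^ i) f x)"
    by (rule sum.mono_neutral_left) (use assms in \<open>auto simp: coeff_eq_0\<close>)
qed

lemma poly_kapply_0: "poly_kapply V K 0 f = (\<lambda>x. 0)"
  by (simp add: poly_kapply_def)

lemma poly_kapply_pCons:
  "poly_kapply V K (pCons a p) f = (\<lambda>x. a * f x + poly_kapply V K p (kapply V K f) x)"
proof
  fix x
  have "poly_kapply V K (pCons a p) f x =
    (\<Sum>i\<le>Suc (degree p). coeff (pCons a p) i * (kapply V K ^^ i) f x)"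
    by (simp add: poly_kapply_altdef[OF degree_pCons_le])
  also have "\<dots> = a * f x + (\<Sum>i\<le>degree p. coeff p i * (kapply V K ^^ i) (kapply V K f) x)"
    by (subst sum.atMost_Suc_shift) (simp add: funpow_swap1)
  finally show "poly_kapply V K (pCons a p) f x = a * f x + poly_kapply V K p (kapply V K f) x"
    by (simp add: poly_kapply_def)
qed

lemma poly_kapply_add:
  "poly_kapply V K (p + q) f = (\<lambda>x. poly_kapply V K p f x + poly_kapply V K q f x)"
proof -
  define N where "N = max (degree p) (degree q)"
  have "degree p \<le> N" "degree q \<le> N" "degree (p + q) \<le> N"
    by (auto simp: N_def degree_add_le_max)
  then show ?thesis
    by (simp add: poly_kapply_altdef[of _ N] sum.distrib algebra_simps)
qed

lemma poly_kapply_smult: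
  "poly_kapply V K (Polynomial.smult c p) f = (\<lambda>x. c * poly_kapply V K p f x)"
  by (simp add: poly_kapply_altdef[of _ "degree p"] degree_smult_le sum_distrib_left mult_ac)

lemma kapply_poly_kapply:
  "kapply V K (poly_kapply V K p f) = poly_kapply V K p (kapply V K f)"
  unfolding poly_kapply_def
  by (subst kapply_sum) (simp add: kapply_scale funpow_swap1)

lemma poly_kapply_mult:
  "poly_kapply V K (p * q) f = poly_kapply V K p (poly_kapply V K q f)"
proof (induction p arbitrary: f)
  case 0
  then show ?case by (simp add: poly_kapply_0)
next
  case (pCons a p)
  then show ?case
    by (simp add: poly_kapply_add poly_kapply_smult poly_kapply_pCons kapply_poly_kapply)
qed

text \<open>Krylov argument: on n points the n + 1 functions obtained from \<open>f\<close> by 0,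
  ..., n applications of the kernel are linearly dependent, and a dependence is a
  polynomial.\<close>

lemma annihilating_poly_exists:
  assumes "finite V"
  shows "\<exists>p. p \<noteq> 0 \<and> (\<forall>x\<in>V. poly_kapply V K p f x = 0)"
proof -
  define n where "n = card V"
  from assms obtain xs where xs: "distinct xs" "set xs = V"
    using finite_distinct_list by blast
  have len: "length xs = n" using xs distinct_card[of xs] by (simp add: n_def)
  \<comment> \<open>Row n is padding: it makes the n by n + 1 system square with determinant 0, so
    that a nonzero kernel vector exists.\<close>
  define A where "A = mat (Suc n) (Suc n) (\<lambda>(i,j). if i < n then (kapply V K ^^ j) f (xs ! i) else 0)"
  have A: "A \<in> carrier_mat (Suc n) (Suc n)" by (simp add: A_def)
  have "A = mat\<^sub>r (Suc n) (Suc n) (\<lambda>i. if i = n then 0\<^sub>v (Suc n) else row A i)" (is "_ = ?A0")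
    by (rule eq_matI) (auto simp: A_def)
  then have "det A = det ?A0" by (rule arg_cong)
  also have "\<dots> = 0" by (rule det_row_0) (use A in auto)
  finally have "det A = 0" .
  then obtain v where v: "v \<in> carrier_vec (Suc n)" "v \<noteq> 0\<^sub>v (Suc n)" "A *\<^sub>v v = 0\<^sub>v (Suc n)"
    using det_0_iff_vec_prod_zero_field[OF A] by auto
  define p where "p = Poly (list_of_vec v)"
  have cf: "coeff p i = (if i < Suc n then v $ i else 0)" for i
    using v(1) by (auto simp: p_def nth_default_def list_of_vec_index)
  have "p \<noteq> 0"
  proof
    assume "p = 0"
    then have "v $ i = 0" if "i < Suc n" for i
      using cf[of i] that by simp
    then have "v = 0\<^sub>v (Suc n)" using v(1) by (intro eq_vecI) auto
    then show False using v(2) by simp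
  qed
  moreover have "poly_kapply V K p f x = 0" if x: "x \<in> V" for x
  proof -
    have "\<forall>i>n. coeff p i = 0" by (simp add: cf)
    then have dp: "degree p \<le> n" by (rule Polynomial.degree_le)
    obtain i where i: "i < n" "xs ! i = x" using x xs len by (metis in_set_conv_nth)
    have "(A *\<^sub>v v) $ i = 0" using v(3) i by simp
    then have "(\<Sum>j=0..<Suc n. (kapply V K ^^ j) f x * v $ j) = 0"
      using v(1) i by (simp add: A_def scalar_prod_def row_def)
    moreover have "poly_kapply V K p f x = (\<Sum>j=0..<Suc n. (kapply V K ^^ j) f x * v $ j)"
      unfolding poly_kapply_altdef[OF dp] by (rule sum.cong) (auto simp: cf)
    ultimately show ?thesis by (rule trans[rotated])
  qed
  ultimately show ?thesis by blast
qed

text \<open>The quadratic factor belongs to the conjugate roots \<open>a \<plusminus> \<i> b\<close>.\<close>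

lemma real_poly_linear_or_quadratic_factor:
  fixes p :: "real poly"
  assumes "degree p > 0"
  shows "(\<exists>a. [:-a, 1:] dvd p) \<or> (\<exists>a b. b \<noteq> 0 \<and> [:a\<^sup>2 + b\<^sup>2, -2 * a, 1:] dvd p)"
proof -
  have "degree (map_poly complex_of_real p) > 0" using assms by simp
  then obtain z where z: "poly (map_poly complex_of_real p) z = 0"
    using fundamental_theorem_of_algebra[of "map_poly complex_of_real p"]
    by (auto simp: constant_degree)
  show ?thesis
  proof (cases "Im z = 0")
    case True
    then have "z = of_real (Re z)" by (simp add: complex_eq_iff)
    then have "of_real (poly p (Re z)) = (0::complex)"
      using z by (metis of_real_hom.poly_map_poly)
    then have "poly p (Re z) = 0" by simp
    then show ?thesis by (auto simp: poly_eq_0_iff_dvd)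
  next
    case False
    define q where "q = [:(Re z)\<^sup>2 + (Im z)\<^sup>2, -2 * Re z, 1:]"
    define r where "r = p mod q"
    have q0: "q \<noteq> 0" "degree q = 2" by (auto simp: q_def)
    have rd: "r = 0 \<or> degree r < 2"
      using degree_mod_less[of q p] q0 by (simp add: r_def)
    have qz: "poly (map_poly complex_of_real q) z = 0"
      by (simp add: q_def map_poly_pCons complex_eq_iff power2_eq_square algebra_simps)
    have lin: "poly (map_poly complex_of_real [:c, d:]) z = of_real c + z * of_real d" for c d
      by (simp add: of_real_hom.map_poly_pCons_hom)
    interpret hom: map_poly_comm_ring_hom complex_of_real ..
    have "map_poly complex_of_real p = map_poly of_real (p div q * q + r)" by (simp add: r_def)
    then have hom: "map_poly complex_of_real p = map_poly of_real (p div q) * map_poly of_real q + map_poly of_real r"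
      by (simp only: hom.hom_add hom.hom_mult)
    have rz: "poly (map_poly complex_of_real r) z = 0"
      using z qz by (simp add: hom)
    \<comment> \<open>The remainder is real of degree at most one and vanishes at the non-real
      \<open>z\<close>: the imaginary part kills its slope, the real part its constant.\<close>
    have "r = 0"
    proof -
      have dr: "degree r < 2" using rd by auto
      then have reqn: "r = [:coeff r 0, coeff r 1:]"
        by (intro poly_eqI) (auto simp: coeff_pCons coeff_eq_0 numeral_2_eq_2 split: nat.splits)
      have "of_real (coeff r 0) + z * of_real (coeff r 1) = 0"
        using rz by (subst (asm) reqn) (simp only: lin)
      then have "Im z * coeff r 1 = 0" "coeff r 0 + Re z * coeff r 1 = 0"
        by (auto simp: complex_eq_iff)
      then have "coeff r 1 = 0" "coeff r 0 = 0" using False by auto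
      then show "r = 0" using reqn by simp
    qed
    then have "q dvd p" by (simp add: r_def dvd_eq_mod_eq_0)
    then show ?thesis using False unfolding q_def by blast
  qed
qed

section \<open>Self-adjointness and eigenfunctions\<close>

locale sym_kernel =
  fixes V :: "'a set" and K :: "'a \<Rightarrow> 'a \<Rightarrow> real"
  assumes finite_V [simp, intro]: "finite V"
    and K_sym: "\<And>x y. x \<in> V \<Longrightarrow> y \<in> V \<Longrightarrow> K x y = K y x"
begin

lemma kinner_kapply: "kinner V (kapply V K f) g = kinner V f (kapply V K g)"
proof -
  have "kinner V (kapply V K f) g = (\<Sum>x\<in>V. \<Sum>y\<in>V. K x y * f y * g x)"
    by (simp add: kinner_def kapply_def sum_distrib_right)
  also have "\<dots> = (\<Sum>y\<in>V. \<Sum>x\<in>V. K x y * f y * g x)"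
    by (rule sum.swap)
  also have "\<dots> = kinner V f (kapply V K g)"
    by (auto simp: kinner_def kapply_def sum_distrib_left K_sym intro!: sum.cong)
  finally show ?thesis .
qed

lemma kinner_funpow_kapply:
  "kinner V ((kapply V K ^^ t) f) g = kinner V f ((kapply V K ^^ t) g)"
proof (induction t arbitrary: g)
  case (Suc t)
  have "kinner V ((kapply V K ^^ Suc t) f) g = kinner V f ((kapply V K ^^ t) (kapply V K g))"
    by (simp add: kinner_kapply Suc)
  then show ?case by (simp add: funpow_swap1)
qed simp

lemma kinner_eq_0D:
  assumes "kinner V f f = 0" "supp_in V f"
  shows "f = (\<lambda>x. 0)"
proof
  fix x
  have "\<forall>x\<in>V. f x * f x = 0"
    using assms(1) by (simp add: kinner_def sum_nonneg_eq_0_iff)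
  then show "f x = 0" using assms(2) by (cases "x \<in> V") (auto simp: supp_in_def)
qed

lemma eigen_orthogonal:
  assumes "kapply V K f = (\<lambda>x. z * f x)" "kapply V K g = (\<lambda>x. w * g x)" "z \<noteq> w"
  shows "kinner V f g = 0"
proof -
  have "z * kinner V f g = w * kinner V f g"
    using kinner_kapply[of f g] by (simp add: assms(1,2) kinner_scale_left kinner_scale_right)
  with assms(3) show ?thesis by simp
qed

text \<open>A symmetric kernel has no nilpotent part.\<close>

lemma generalized_eigen_imp_eigen:
  assumes "supp_in V f"
    and "kapply V K (\<lambda>x. kapply V K f x - z * f x) = (\<lambda>x. z * (kapply V K f x - z * f x))"
  shows "kapply V K f = (\<lambda>x. z * f x)"
proof -
  define g where "g = (\<lambda>x. kapply V K f x - z * f x)"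
  have "kinner V g g = kinner V (kapply V K f) g - z * kinner V f g"
    by (subst (1) g_def) (simp add: kinner_diff_left kinner_scale_left)
  also have "\<dots> = 0"
  proof -
    have "kapply V K g = (\<lambda>x. z * g x)" using assms(2) unfolding g_def .
    then show ?thesis by (simp add: kinner_kapply kinner_scale_right)
  qed
  finally have "g = (\<lambda>x. 0)"
    by (rule kinner_eq_0D) (use assms(1) in \<open>auto simp: supp_in_def g_def\<close>)
  then show ?thesis by (auto simp: g_def fun_eq_iff)
qed

text \<open>Write K for the operator and g = K f - a f. The hypothesis says that K - a maps g to
  -b^2 f, so symmetry gives <g, g> = -b^2 <f, f>, and both sides vanish. This replaces the reality
  of the spectrum without leaving the real numbers.\<close>

lemma no_complex_eigenvalue:
  assumes "supp_in V f" "b \<noteq> 0" "\<And>x. poly_kapply V K [:a\<^sup>2 + b\<^sup>2, -2 * a, 1:] f x = 0"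
  shows "f = (\<lambda>x. 0)"
proof -
  define g where "g = (\<lambda>x. kapply V K f x - a * f x)"
  have KKf: "kapply V K (kapply V K f) x = 2 * a * kapply V K f x - (a\<^sup>2 + b\<^sup>2) * f x" for x
    using assms(3)[of x] by (simp add: poly_kapply_pCons poly_kapply_0 algebra_simps)
  have Kg: "kapply V K g x = a * g x - b\<^sup>2 * f x" for x
    unfolding g_def kapply_diff kapply_scale KKf by (simp add: algebra_simps power2_eq_square)
  have "kinner V g g = kinner V (kapply V K f) g - a * kinner V f g"
    by (subst (1) g_def) (simp add: kinner_diff_left kinner_scale_left)
  also have "kinner V (kapply V K f) g = kinner V f (kapply V K g)" by (rule kinner_kapply)
  also have "\<dots> = a * kinner V f g - b\<^sup>2 * kinner V f f"
    by (simp add: kinner_def Kg sum_distrib_left sum_subtractf algebra_simps)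
  finally have "kinner V g g + b\<^sup>2 * kinner V f f = 0" by simp
  moreover have "0 \<le> b\<^sup>2 * kinner V f f" by (simp add: kinner_nonneg)
  ultimately have "b\<^sup>2 * kinner V f f = 0" using kinner_nonneg[of V g] by linarith
  then have "kinner V f f = 0" using assms(2) by simp
  then show ?thesis using assms(1) by (rule kinner_eq_0D)
qed

definition eigenfun :: "real \<Rightarrow> ('a \<Rightarrow> real) \<Rightarrow> bool" where
  "eigenfun z f \<longleftrightarrow> supp_in V f \<and> kapply V K f = (\<lambda>x. z * f x)"

text \<open>Components are indexed by their eigenvalue, hence there is at most one for each, and
  distinct components are orthogonal.\<close>

definition decomposable :: "('a \<Rightarrow> real) \<Rightarrow> bool" where
  "decomposable f \<longleftrightarrow> (\<exists>Z F. finite Z \<and> (\<forall>z\<in>Z. eigenfun z (F z)) \<and> f = (\<lambda>x. \<Sum>z\<in>Z. F z x))"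

lemma eigenfun_scale: "eigenfun z f \<Longrightarrow> eigenfun z (\<lambda>x. c * f x)"
  by (auto simp: eigenfun_def supp_in_def kapply_scale)

lemma eigenfun_add: "eigenfun z f \<Longrightarrow> eigenfun z g \<Longrightarrow> eigenfun z (\<lambda>x. f x + g x)"
  by (auto simp: eigenfun_def supp_in_def kapply_add algebra_simps)

lemma decomposable_add_eigenfun:
  assumes "finite Z" "\<And>z. z \<in> Z \<Longrightarrow> eigenfun z (F z)" "eigenfun w g"
  shows "decomposable (\<lambda>x. (\<Sum>z\<in>Z. F z x) + g x)"
proof (cases "w \<in> Z")
  case True
  define F' where "F' = F(w := (\<lambda>x. F w x + g x))"
  have "(\<Sum>z\<in>Z. F z x) + g x = (\<Sum>z\<in>Z. F' z x)" for x
    using assms(1) True by (simp add: F'_def sum.remove[of Z w])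
  moreover have "\<forall>z\<in>Z. eigenfun z (F' z)"
    using assms True by (auto simp: F'_def eigenfun_add)
  ultimately show ?thesis using assms(1) unfolding decomposable_def by (intro exI[of _ Z] exI[of _ F']) auto
next
  case False
  define F' where "F' = F(w := g)"
  have "(\<Sum>z\<in>Z. F z x) + g x = (\<Sum>z\<in>insert w Z. F' z x)" for x
    using assms(1) False by (auto simp: F'_def intro!: sum.cong)
  moreover have "\<forall>z\<in>insert w Z. eigenfun z (F' z)"
    using assms False by (auto simp: F'_def)
  ultimately show ?thesis using assms(1) unfolding decomposable_def by (intro exI[of _ "insert w Z"] exI[of _ F']) auto
qed

text \<open>Induction on the degree. For a linear factor X - a, the image g of f under K - a is
  annihilated by the cofactor and decomposes; preimages of its components with eigenvalue other than
  a are subtracted from f, and the rest is killed by (K - a)^2, hence is an eigenfunction. A factor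
  with non-real roots acts injectively and can be cancelled.\<close>

lemma decomposable_if_annihilated:
  assumes "p \<noteq> 0" "supp_in V f" "poly_kapply V K p f = (\<lambda>x. 0)"
  shows "decomposable f"
  using assms
proof (induction "degree p" arbitrary: p f rule: less_induct)
  case less
  show ?case
  proof (cases "degree p = 0")
    case True
    then obtain c where "p = [:c:]" by (metis degree_eq_zeroE)
    with less.prems have "f = (\<lambda>x. 0)"
      by (auto simp: poly_kapply_pCons poly_kapply_0 fun_eq_iff)
    then show ?thesis unfolding decomposable_def by (intro exI[of _ "{}"]) auto
  next
    case False
    then consider a where "[:-a, 1:] dvd p" | a b where "b \<noteq> 0" "[:a\<^sup>2 + b\<^sup>2, -2 * a, 1:] dvd p"
      using real_poly_linear_or_quadratic_factor[of p] by auto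
    then show ?thesis
    proof cases
      case 1
      then obtain r where r: "p = r * [:-a, 1:]" by (metis dvdE mult.commute)
      have rn0: "r \<noteq> 0" using less.prems(1) by (auto simp: r)
      have "degree p = degree r + degree [:-a, 1:]"
        unfolding r using rn0 by (intro degree_mult_eq) auto
      with rn0 have r0: "r \<noteq> 0" "degree r < degree p" by auto
      define g where "g = (\<lambda>x. kapply V K f x - a * f x)"
      have g: "poly_kapply V K [:-a, 1:] f = g"
        unfolding g_def poly_kapply_pCons poly_kapply_0 by simp
      have "poly_kapply V K r g = (\<lambda>x. 0)"
        using less.prems(3) by (simp only: r poly_kapply_mult g)
      moreover have "supp_in V g" using less.prems(2) by (auto simp: g_def supp_in_def)
      ultimately have "decomposable g" using less.hyps[OF r0(2)] r0 by auto
      then obtain Z F where ZF: "finite Z" "\<And>z. z \<in> Z \<Longrightarrow> eigenfun z (F z)" "g = (\<lambda>x. \<Sum>z\<in>Z. F z x)"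
        unfolding decomposable_def by auto
      \<comment> \<open>On eigenvalue \<open>z\<close> the operator K - a is multiplication by z -
        a, so \<open>H z\<close> is a preimage of \<open>F z\<close>.\<close>
      define H where "H = (\<lambda>z x. inverse (z - a) * F z x)"
      define f' where "f' = (\<lambda>x. f x - (\<Sum>z\<in>Z - {a}. H z x))"
      have H: "eigenfun z (H z)" if "z \<in> Z" for z
        unfolding H_def by (intro eigenfun_scale ZF that)
      have sf': "supp_in V f'"
        using less.prems(2) H by (auto simp: f'_def supp_in_def eigenfun_def)
      have Kf': "kapply V K f' x - a * f' x = (if a \<in> Z then F a x else 0)" for x
      proof -
        have "kapply V K f' x - a * f' x = g x - (\<Sum>z\<in>Z-{a}. kapply V K (H z) x - a * H z x)"
          unfolding f'_def g_def kapply_diff kapply_sum sum_subtractf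
          by (simp add: sum_distrib_left right_diff_distrib)
        also have "(\<Sum>z\<in>Z-{a}. kapply V K (H z) x - a * H z x) = (\<Sum>z\<in>Z-{a}. F z x)"
        proof (rule sum.cong[OF refl])
          fix z assume "z \<in> Z - {a}"
          then have "kapply V K (H z) x = z * H z x" "z \<noteq> a"
            using H[of z] by (auto simp: eigenfun_def)
          then show "kapply V K (H z) x - a * H z x = F z x"
            by (simp add: H_def field_simps)
        qed
        also have "g x - \<dots> = (if a \<in> Z then F a x else 0)"
        proof (cases "a \<in> Z")
          case True
          with ZF(1) have "(\<Sum>z\<in>Z. F z x) = F a x + (\<Sum>z\<in>Z-{a}. F z x)" by (rule sum.remove)
          with True show ?thesis by (simp only: ZF(3)) simp
        next
          case False
          then show ?thesis by (simp add: ZF(3))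
        qed
        finally show ?thesis .
      qed
      have "kapply V K f' = (\<lambda>x. a * f' x)"
      proof (rule generalized_eigen_imp_eigen[OF sf'])
        show "kapply V K (\<lambda>x. kapply V K f' x - a * f' x) = (\<lambda>x. a * (kapply V K f' x - a * f' x))"
          unfolding Kf' using ZF(2)[of a] kapply_scale[of V K 0 f]
          by (cases "a \<in> Z") (auto simp: eigenfun_def)
      qed
      then have "eigenfun a f'" using sf' by (simp add: eigenfun_def)
      then have "decomposable (\<lambda>x. (\<Sum>z\<in>Z-{a}. H z x) + f' x)"
        using ZF(1) H by (intro decomposable_add_eigenfun) auto
      then show ?thesis by (simp add: f'_def)
    next
      case 2
      define q where "q = [:a\<^sup>2 + b\<^sup>2, -2 * a, 1:]"
      from 2 obtain r where r: "p = q * r" by (auto simp: q_def)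
      have rn0: "r \<noteq> 0" using less.prems(1) by (auto simp: r)
      have "degree p = degree q + degree r"
        unfolding r using rn0 by (intro degree_mult_eq) (auto simp: q_def)
      with rn0 have r0: "r \<noteq> 0" "degree r < degree p" by (auto simp: q_def)
      have "poly_kapply V K r f = (\<lambda>x. 0)"
      proof (rule no_complex_eigenvalue[OF _ 2(1)])
        show "supp_in V (poly_kapply V K r f)"
          using supp_in_funpow_kapply[OF less.prems(2), where K = K]
          by (auto simp: supp_in_def poly_kapply_def)
        show "poly_kapply V K [:a\<^sup>2 + b\<^sup>2, -2 * a, 1:] (poly_kapply V K r f) x = 0" for x
          using less.prems(3) unfolding r poly_kapply_mult q_def by simp
      qed
      then show ?thesis using less.hyps[OF r0(2)] r0 less.prems(2) by auto
    qed
  qed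
qed

theorem spectral_decomposition:
  assumes "supp_in V f"
  shows "decomposable f"
proof -
  obtain p where p: "p \<noteq> 0" "\<forall>x\<in>V. poly_kapply V K p f x = 0"
    using annihilating_poly_exists[OF finite_V] by blast
  have "poly_kapply V K p f x = 0" if "x \<notin> V" for x
    using supp_in_funpow_kapply[OF assms, where K = K] that by (auto simp: supp_in_def poly_kapply_def)
  with p show ?thesis
    by (intro decomposable_if_annihilated[of p]) (use assms in auto)
qed

text \<open>\<open>R\<close> stands for any function of the kernel, known through its action on
  eigenfunctions. The premise <g, f> = <g, g> in \<open>bound\<close> records that g is a component
  of f; it later excludes the eigenvalue 1 when f has mean zero.\<close>

theorem quadratic_form_le:
  fixes R :: "('a \<Rightarrow> real) \<Rightarrow> 'a \<Rightarrow> real"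
  assumes f: "supp_in V f"
    and R_sum: "\<And>(Z :: real set) F. R (\<lambda>x. \<Sum>z\<in>Z. F z x) = (\<lambda>x. \<Sum>z\<in>Z. R (F z) x)"
    and R_eigen: "\<And>z g. eigenfun z g \<Longrightarrow> R g = (\<lambda>x. q z * g x)"
    and bound: "\<And>z g. eigenfun z g \<Longrightarrow> kinner V g g > 0 \<Longrightarrow> kinner V g f = kinner V g g \<Longrightarrow> q z \<le> M"
  shows "kinner V (R f) f \<le> M * kinner V f f"
proof -
  obtain Z F where ZF: "finite Z" "\<And>z. z \<in> Z \<Longrightarrow> eigenfun z (F z)" "f = (\<lambda>x. \<Sum>z\<in>Z. F z x)"
    using spectral_decomposition[OF f] unfolding decomposable_def by auto
  have Ff: "kinner V (F z) f = kinner V (F z) (F z)" if "z \<in> Z" for z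
  proof -
    have "kinner V (F z) f = (\<Sum>w\<in>Z. kinner V (F w) (F z))"
      by (subst kinner_commute) (subst ZF(3), simp add: kinner_sum_left)
    also have "\<dots> = kinner V (F z) (F z) + (\<Sum>w\<in>Z-{z}. kinner V (F w) (F z))"
      using ZF(1) that by (rule sum.remove)
    also have "(\<Sum>w\<in>Z-{z}. kinner V (F w) (F z)) = 0"
    proof (intro sum.neutral ballI)
      fix w assume "w \<in> Z - {z}"
      then show "kinner V (F w) (F z) = 0"
        using ZF(2)[of w] ZF(2)[of z] that by (intro eigen_orthogonal[of _ w _ z]) (auto simp: eigenfun_def)
    qed
    finally show ?thesis by simp
  qed
  have "kinner V (R f) f = (\<Sum>z\<in>Z. kinner V (R (F z)) f)"
    by (subst (1) ZF(3)) (simp add: R_sum kinner_sum_left)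
  also have "\<dots> = (\<Sum>z\<in>Z. q z * kinner V (F z) (F z))"
    by (rule sum.cong) (auto simp: R_eigen[OF ZF(2)] kinner_scale_left Ff)
  also have "\<dots> \<le> (\<Sum>z\<in>Z. M * kinner V (F z) (F z))"
  proof (rule sum_mono)
    fix z assume z: "z \<in> Z"
    show "q z * kinner V (F z) (F z) \<le> M * kinner V (F z) (F z)"
    proof (cases "kinner V (F z) (F z) = 0")
      case False
      then have "kinner V (F z) (F z) > 0" using kinner_nonneg[of V "F z"] by linarith
      then show ?thesis using bound[OF ZF(2)[OF z]] Ff[OF z] by (intro mult_right_mono) auto
    qed simp
  qed
  also have "\<dots> = M * (\<Sum>z\<in>Z. kinner V (F z) f)" by (simp add: sum_distrib_left Ff)
  also have "(\<Sum>z\<in>Z. kinner V (F z) f) = kinner V (\<lambda>x. \<Sum>z\<in>Z. F z x) f"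
    by (simp add: kinner_sum_left)
  also have "\<dots> = kinner V f f" by (simp add: ZF(3)[symmetric])
  finally show ?thesis .
qed

end

section \<open>Kernels with non-negative entries\<close>

lemma abs_kapply_le:
  assumes "\<And>x y. x \<in> V \<Longrightarrow> y \<in> V \<Longrightarrow> 0 \<le> K x y"
  shows "\<bar>kapply V K f x\<bar> \<le> kapply V K (\<lambda>y. \<bar>f y\<bar>) x"
proof (cases "x \<in> V")
  case True
  have "\<bar>\<Sum>y\<in>V. K x y * f y\<bar> \<le> (\<Sum>y\<in>V. \<bar>K x y * f y\<bar>)" by (rule sum_abs)
  also have "\<dots> = (\<Sum>y\<in>V. K x y * \<bar>f y\<bar>)"
    using assms True by (intro sum.cong) (auto simp: abs_mult)
  finally show ?thesis using True by (simp add: kapply_def)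
qed simp

lemma kapply_mono:
  assumes "\<And>x y. x \<in> V \<Longrightarrow> y \<in> V \<Longrightarrow> 0 \<le> K x y" "\<And>x. x \<in> V \<Longrightarrow> f x \<le> g x"
  shows "kapply V K f x \<le> kapply V K g x"
  using assms by (auto simp: kapply_def intro!: sum_mono mult_left_mono)

lemma kapply_cong:
  assumes "\<And>x. x \<in> V \<Longrightarrow> f x = g x"
  shows "kapply V K f = kapply V K g"
  using assms by (auto simp: kapply_def intro!: sum.cong)

lemma abs_le_sqrt_kinner:
  assumes "finite V" "x \<in> V"
  shows "\<bar>f x\<bar> \<le> sqrt (kinner V f f)"
proof (rule real_le_rsqrt)
  have "f x * f x \<le> (\<Sum>y\<in>V. f y * f y)"
    by (rule member_le_sum) (use assms in auto)
  then show "\<bar>f x\<bar>\<^sup>2 \<le> kinner V f f" by (simp add: kinner_def power2_eq_square)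
qed

context sym_kernel
begin

text \<open>For a non-negative kernel the operator norm is attained by the quadratic form on
  non-negative functions.\<close>

lemma kinner_funpow_le:
  assumes nonneg: "\<And>x y. x \<in> V \<Longrightarrow> y \<in> V \<Longrightarrow> 0 \<le> K x y"
    and form: "\<And>g. supp_in V g \<Longrightarrow> (\<And>x. 0 \<le> g x) \<Longrightarrow> kinner V (kapply V K g) g \<le> \<kappa> * kinner V g g"
    and f: "supp_in V f" and \<kappa>: "0 \<le> \<kappa>"
  shows "kinner V ((kapply V K ^^ t) f) ((kapply V K ^^ t) f) \<le> (\<kappa> ^ t)\<^sup>2 * kinner V f f"
proof -
  \<comment> \<open>The squared norm of the t-th iterate is a quadratic form of the iterate 2 t;
    with an even exponent a bound on the modulus of the eigenvalues is enough.\<close>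
  have "kinner V ((kapply V K ^^ (2 * t)) f) f \<le> \<kappa> ^ (2 * t) * kinner V f f"
  proof (rule quadratic_form_le[OF f, where q = "\<lambda>z. z ^ (2 * t)"])
    fix z g assume g: "eigenfun z g" and pos: "kinner V g g > 0"
    have "\<bar>z\<bar> * kinner V g g = \<bar>kinner V (kapply V K g) g\<bar>"
      using g kinner_nonneg[of V g] by (simp add: eigenfun_def kinner_scale_left abs_mult)
    also have "\<dots> \<le> (\<Sum>x\<in>V. \<bar>kapply V K g x * g x\<bar>)"
      unfolding kinner_def by (rule sum_abs)
    also have "\<dots> \<le> kinner V (kapply V K (\<lambda>x. \<bar>g x\<bar>)) (\<lambda>x. \<bar>g x\<bar>)"
      unfolding kinner_def using abs_kapply_le[OF nonneg]
      by (intro sum_mono) (auto simp: abs_mult intro!: mult_right_mono)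
    also have "\<dots> \<le> \<kappa> * kinner V (\<lambda>x. \<bar>g x\<bar>) (\<lambda>x. \<bar>g x\<bar>)"
      by (rule form) (use g in \<open>auto simp: eigenfun_def supp_in_def\<close>)
    also have "kinner V (\<lambda>x. \<bar>g x\<bar>) (\<lambda>x. \<bar>g x\<bar>) = kinner V g g"
      by (simp add: kinner_def)
    finally have "\<bar>z\<bar> \<le> \<kappa>" using pos by (simp add: mult_le_cancel_right)
    then have "\<bar>z\<bar> ^ (2 * t) \<le> \<kappa> ^ (2 * t)" by (intro power_mono) auto
    then show "z ^ (2 * t) \<le> \<kappa> ^ (2 * t)" by (simp add: power_even_abs)
  qed (auto simp: funpow_kapply_sum eigenfun_def funpow_kapply_eigen)
  moreover have "kinner V ((kapply V K ^^ (2 * t)) f) f =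
      kinner V ((kapply V K ^^ t) f) ((kapply V K ^^ t) f)"
    by (simp add: mult_2 funpow_add kinner_funpow_kapply[of t "(kapply V K ^^ t) f"])
  ultimately show ?thesis by (simp add: power_mult[symmetric] mult.commute)
qed

text \<open>A point value is at most the l2 norm for counting measure. Applied to an indicator, this
  is the origin of the factor \<open>sqrt N\<close> in the upper bounds.\<close>

lemma abs_funpow_le:
  assumes nonneg: "\<And>x y. x \<in> V \<Longrightarrow> y \<in> V \<Longrightarrow> 0 \<le> K x y"
    and form: "\<And>g. supp_in V g \<Longrightarrow> (\<And>x. 0 \<le> g x) \<Longrightarrow> kinner V (kapply V K g) g \<le> \<kappa> * kinner V g g"
    and f: "supp_in V f" and \<kappa>: "0 \<le> \<kappa>" and x: "x \<in> V"
  shows "\<bar>(kapply V K ^^ t) f x\<bar> \<le> \<kappa> ^ t * sqrt (kinner V f f)"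
proof -
  have "\<bar>(kapply V K ^^ t) f x\<bar> \<le> sqrt ((\<kappa> ^ t)\<^sup>2 * kinner V f f)"
    using abs_le_sqrt_kinner[OF finite_V x, of "(kapply V K ^^ t) f"]
      kinner_funpow_le[OF nonneg form f \<kappa>, of t] by (meson order_trans real_sqrt_le_mono)
  then show ?thesis using \<kappa> by (simp add: real_sqrt_mult)
qed

end

section \<open>Random walk on a regular graph\<close>

definition ind :: "'a set \<Rightarrow> 'a \<Rightarrow> real" where
  "ind B x = (if x \<in> B then 1 else 0)"

text \<open>\<open>geronimus d k\<close> is the polynomial that turns the walk into the non-backtracking walk of
  length \<open>k\<close>.\<close>

fun geronimus :: "nat \<Rightarrow> nat \<Rightarrow> real \<Rightarrow> real" where
  "geronimus d 0 z = 1"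
| "geronimus d (Suc 0) z = z"
| "geronimus d (Suc (Suc k)) z = (d * z * geronimus d (Suc k) z - geronimus d k z) / (real d - 1)"

text \<open>Used for path probabilities: a reachable vertex has at least the probability of one
  path, which bounds the number of reachable vertices.\<close>

lemma sum_eq_0_or_ge:
  fixes f :: "'b \<Rightarrow> real"
  assumes "finite A" "\<And>a. a \<in> A \<Longrightarrow> f a = 0 \<or> c \<le> f a" "0 \<le> c"
  shows "sum f A = 0 \<or> c \<le> sum f A"
proof (cases "\<forall>a\<in>A. f a = 0")
  case False
  then obtain a where a: "a \<in> A" "f a \<noteq> 0" by auto
  then have "c \<le> f a" using assms(2) by blast
  also have "f a \<le> sum f A"
  proof (rule member_le_sum)
    show "0 \<le> f b" if "b \<in> A - {a}" for b
      using assms(2)[of b] assms(3) that by auto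
  qed (use a assms(1) in auto)
  finally show ?thesis by simp
qed simp

locale regular_walk =
  fixes V :: "'a set" and E :: "'a \<Rightarrow> 'a \<Rightarrow> bool" and d :: nat
  assumes finV: "finite V" and V_ne: "V \<noteq> {}"
    and E_sym: "E x y \<Longrightarrow> E y x"
    and E_V: "E x y \<Longrightarrow> x \<in> V \<and> y \<in> V"
    and deg: "x \<in> V \<Longrightarrow> card {y. E x y} = d"
    and d2: "d \<ge> 2"
begin

definition P :: "'a \<Rightarrow> 'a \<Rightarrow> real" where
  "P x y = (if E x y then 1 / real d else 0)"

sublocale P: sym_kernel V P
  by unfold_locales (auto simp: finV P_def dest: E_sym)

abbreviation T :: "('a \<Rightarrow> real) \<Rightarrow> 'a \<Rightarrow> real" where
  "T \<equiv> kapply V P"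

lemma P_nonneg: "0 \<le> P x y"
  by (simp add: P_def)

lemma sum_V_E: "(\<Sum>y\<in>V. if E x y then f y else 0) = (\<Sum>y\<in>{y. E x y}. f y)"
proof -
  have "(\<Sum>y\<in>V. if E x y then f y else 0) = (\<Sum>y\<in>{y \<in> V. E x y}. f y)"
    by (rule sum.inter_filter[symmetric]) (rule finV)
  also have "{y \<in> V. E x y} = {y. E x y}" using E_V by auto
  finally show ?thesis .
qed

lemma P_row: "x \<in> V \<Longrightarrow> (\<Sum>y\<in>V. P x y) = 1"
  using deg[of x] d2 by (simp add: P_def sum_V_E)

lemma T_const: "x \<in> V \<Longrightarrow> T (\<lambda>_. c) x = c"
  using P_row[of x] by (simp add: kapply_def sum_distrib_right[symmetric])

lemma eigenfun_ind: "P.eigenfun 1 (ind V)"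
proof -
  have "T (ind V) = T (\<lambda>_. 1)" by (rule kapply_cong) (simp add: ind_def)
  then show ?thesis
    by (auto simp: P.eigenfun_def supp_in_def ind_def fun_eq_iff T_const)
qed

subsection \<open>Non-backtracking walk\<close>

text \<open>\<open>arcdist k x y z\<close> is the probability that \<open>(y, z)\<close> is the last arc of a
  uniform non-backtracking walk of length \<open>k + 1\<close> from \<open>x\<close>.\<close>

primrec arcdist :: "nat \<Rightarrow> 'a \<Rightarrow> 'a \<Rightarrow> 'a \<Rightarrow> real" where
  "arcdist 0 x y z = (if x = y \<and> E y z then 1 / real d else 0)"
| "arcdist (Suc k) x y z = (if E y z then (\<Sum>w\<in>V - {z}. arcdist k x w y) / (real d - 1) else 0)"

text \<open>The end point of a non-backtracking walk, its last arc forgotten. Length 0 has no last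
  arc and is set by hand.\<close>

definition nb :: "nat \<Rightarrow> 'a \<Rightarrow> 'a \<Rightarrow> real" where
  "nb k x z = (case k of 0 \<Rightarrow> (if x = z then 1 else 0) | Suc j \<Rightarrow> \<Sum>y\<in>V. arcdist j x y z)"

lemma nb_0: "nb 0 x z = (if x = z then 1 else 0)"
  and nb_Suc: "nb (Suc k) x z = (\<Sum>y\<in>V. arcdist k x y z)"
  by (simp_all add: nb_def)

lemma arcdist_nonneg: "0 \<le> arcdist k x y z"
  using d2 by (induction k arbitrary: y z) (auto intro!: divide_nonneg_nonneg sum_nonneg)

lemma nb_nonneg: "0 \<le> nb k x z"
  by (cases k) (auto simp: nb_0 nb_Suc intro!: sum_nonneg arcdist_nonneg)

lemma arcdist_nonadj: "\<not> E y z \<Longrightarrow> arcdist k x y z = 0"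
  by (cases k) auto

text \<open>Conservation of mass at \<open>z\<close>: each incoming arc hands 1/(d-1) of its mass to
  each of the d - 1 arcs leaving \<open>z\<close> that do not reverse it.\<close>

lemma arcdist_outflow:
  assumes "z \<in> V"
  shows "(\<Sum>y\<in>V. arcdist k x z y) = nb k x z"
proof (cases k)
  case 0
  then show ?thesis using deg[OF assms] d2 by (auto simp: nb_0 sum_V_E)
next
  case (Suc j)
  define S where "S = (\<Sum>w\<in>V. arcdist j x w z)"
  have d1: "real d - 1 \<noteq> 0" using d2 by auto
  have "(\<Sum>y\<in>V. arcdist k x z y) = (\<Sum>y\<in>{y. E z y}. (S - arcdist j x y z) / (real d - 1))"
    unfolding sum_V_E[symmetric] using finV
    by (intro sum.cong) (auto simp: Suc S_def sum_diff1)
  also have "\<dots> = (real d * S - (\<Sum>y\<in>{y. E z y}. arcdist j x y z)) / (real d - 1)"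
    using deg[OF assms] by (simp add: sum_divide_distrib[symmetric] sum_subtractf)
  also have "(\<Sum>y\<in>{y. E z y}. arcdist j x y z) = S"
    unfolding sum_V_E[symmetric] S_def by (intro sum.cong) (auto intro!: arcdist_nonadj dest: E_sym)
  also have "(real d * S - S) / (real d - 1) = S" using d1 by (simp add: field_simps)
  finally show ?thesis by (simp add: Suc S_def nb_Suc)
qed

text \<open>A simple step after a non-backtracking walk reverses the last arc with probability 1/d,
  which shortens the walk, and otherwise prolongs it.\<close>

lemma nb_step:
  assumes "x \<in> V" "z \<in> V"
  shows "(\<Sum>y\<in>V. nb (Suc k) x y * P y z) = nb k x z / d + (real d - 1) / d * nb (Suc (Suc k)) x z"
proof -
  have d1: "real d - 1 \<noteq> 0" "real d \<noteq> 0" using d2 by auto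
  have "(real d - 1) * nb (Suc (Suc k)) x z = (\<Sum>y\<in>V. if E y z then nb (Suc k) x y - arcdist k x z y else 0)"
    unfolding nb_Suc sum_distrib_left using d1 finV assms
    by (intro sum.cong) (auto simp: sum_diff1)
  also have "\<dots> = (\<Sum>y\<in>V. if E y z then nb (Suc k) x y else 0) - (\<Sum>y\<in>V. if E y z then arcdist k x z y else 0)"
    unfolding sum_subtractf[symmetric] by (intro sum.cong) auto
  also have "(\<Sum>y\<in>V. if E y z then arcdist k x z y else 0) = (\<Sum>y\<in>V. arcdist k x z y)"
    by (intro sum.cong) (auto intro!: arcdist_nonadj dest: E_sym)
  also have "\<dots> = nb k x z" using arcdist_outflow[OF assms(2)] .
  also have "(\<Sum>y\<in>V. if E y z then nb (Suc k) x y else 0) = d * (\<Sum>y\<in>V. nb (Suc k) x y * P y z)"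
    unfolding sum_distrib_left using d1 by (intro sum.cong) (auto simp: P_def)
  finally show ?thesis using d1 by (simp add: field_simps)
qed

lemma nb_1: "x \<in> V \<Longrightarrow> nb (Suc 0) x z = P x z"
proof -
  assume x: "x \<in> V"
  have "nb (Suc 0) x z = (\<Sum>y\<in>V. if y = x then (if E x z then 1 / real d else 0) else 0)"
    unfolding nb_Suc by (intro sum.cong) auto
  then show "nb (Suc 0) x z = P x z" using x finV by (simp add: P_def)
qed

lemma nb_SucSuc:
  assumes "x \<in> V" "z \<in> V"
  shows "nb (Suc (Suc k)) x z = (d * (\<Sum>y\<in>V. nb (Suc k) x y * P y z) - nb k x z) / (real d - 1)"
  using nb_step[OF assms, of k] d2 by (simp add: field_simps)

lemma kapply_nb_0: "x \<in> V \<Longrightarrow> kapply V (nb 0) f x = f x"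
  using finV by (simp add: kapply_def nb_0 if_distrib[of "\<lambda>c. c * _"] cong: if_cong)

lemma kapply_nb_1: "kapply V (nb (Suc 0)) f = T f"
  by (auto simp: kapply_def nb_1)

text \<open>Read in \<open>k\<close>, this is a birth-and-death chain: one step of the walk lowers
  the tree distance with probability 1/d and raises it with probability (d-1)/d. Both exponential
  moment arguments are inductions along it.\<close>

lemma kapply_nb_T:
  "kapply V (nb (Suc k)) (T f) x =
    kapply V (nb k) f x / d + (real d - 1) / d * kapply V (nb (Suc (Suc k))) f x"
proof (cases "x \<in> V")
  case True
  have "kapply V (nb (Suc k)) (T f) x = (\<Sum>y\<in>V. \<Sum>z\<in>V. nb (Suc k) x y * P y z * f z)"
    using True by (simp add: kapply_def sum_distrib_left mult.assoc)
  also have "\<dots> = (\<Sum>z\<in>V. (\<Sum>y\<in>V. nb (Suc k) x y * P y z) * f z)"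
    unfolding sum_distrib_right by (rule sum.swap)
  also have "\<dots> = (\<Sum>z\<in>V. (nb k x z / d + (real d - 1) / d * nb (Suc (Suc k)) x z) * f z)"
    using True by (intro sum.cong) (auto simp: nb_step)
  also have "\<dots> = kapply V (nb k) f x / d + (real d - 1) / d * kapply V (nb (Suc (Suc k))) f x"
    using True unfolding sum_distrib_left sum_divide_distrib
    by (simp add: kapply_def sum_distrib_left sum_divide_distrib sum.distrib[symmetric] algebra_simps)
  finally show ?thesis .
qed simp

lemma kapply_nb_eigen:
  assumes "P.eigenfun z f"
  shows "kapply V (nb k) f = (\<lambda>x. geronimus d k z * f x)"
proof (induction k rule: induct_nat_012)
  case 0
  show ?case
  proof
    fix x show "kapply V (nb 0) f x = geronimus d 0 z * f x"
      using assms by (cases "x \<in> V") (auto simp: kapply_nb_0 P.eigenfun_def supp_in_def)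
  qed
next
  case 1
  then show ?case using assms by (simp add: kapply_nb_1 P.eigenfun_def)
next
  case (ge2 k)
  have d1: "real d - 1 \<noteq> 0" "real d \<noteq> 0" using d2 by auto
  have "T f = (\<lambda>x. z * f x)" using assms by (simp add: P.eigenfun_def)
  then have "z * (geronimus d (Suc k) z * f x) =
      geronimus d k z * f x / d + (real d - 1) / d * kapply V (nb (Suc (Suc k))) f x" for x
    using kapply_nb_T[of k f x] ge2 by (simp add: kapply_scale)
  then show ?case using d1 by (auto simp: field_simps)
qed

lemma geronimus_1: "geronimus d k 1 = 1"
  using d2 by (induction k rule: induct_nat_012) auto

text \<open>The indicator of \<open>V\<close> is an eigenfunction for 1, and the Geronimus
  polynomials are 1 there.\<close>

lemma nb_row:
  assumes "x \<in> V"
  shows "(\<Sum>z\<in>V. nb k x z) = 1"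
proof -
  have "kapply V (nb k) (ind V) x = 1"
    using kapply_nb_eigen[OF eigenfun_ind, of k] assms by (simp add: geronimus_1 ind_def)
  moreover have "kapply V (nb k) (ind V) x = (\<Sum>z\<in>V. nb k x z)"
    using assms by (auto simp: kapply_def ind_def intro!: sum.cong)
  ultimately show ?thesis by simp
qed

text \<open>The arc recursion is not visibly symmetric. The two claims are proved together because
  the product of \<open>nb (Suc k)\<close> and \<open>P\<close> is symmetric only if the factors are
  symmetric and commute.\<close>

lemma nb_sym_commute:
  "(\<forall>x\<in>V. \<forall>z\<in>V. nb k x z = nb k z x) \<and>
   (\<forall>x\<in>V. \<forall>z\<in>V. (\<Sum>y\<in>V. nb k x y * P y z) = (\<Sum>y\<in>V. P x y * nb k y z))"
proof (induction k rule: induct_nat_012)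
  case 0
  then show ?case using finV
    by (auto simp: nb_0 if_distrib[of "\<lambda>c. c * _"] if_distrib[of "\<lambda>c. _ * c"] cong: if_cong)
next
  case 1
  then show ?case by (auto simp: nb_1 P.K_sym)
next
  case (ge2 k)
  define M where "M = (\<lambda>x z. \<Sum>y\<in>V. nb (Suc k) x y * P y z)"
  have nb2: "nb (Suc (Suc k)) x z = (d * M x z - nb k x z) / (real d - 1)" if "x \<in> V" "z \<in> V" for x z
    using nb_SucSuc[OF that] by (simp add: M_def)
  have M_sym: "M x z = M z x" if "x \<in> V" "z \<in> V" for x z
  proof -
    have "M x z = (\<Sum>y\<in>V. P x y * nb (Suc k) y z)" using ge2(2) that unfolding M_def by blast
    also have "\<dots> = M z x" unfolding M_def
      by (intro sum.cong refl) (metis P.K_sym ge2(2) that mult.commute)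
    finally show ?thesis .
  qed
  have M_com: "(\<Sum>y\<in>V. M x y * P y z) = (\<Sum>y\<in>V. P x y * M y z)" if "x \<in> V" "z \<in> V" for x z
  proof -
    have "(\<Sum>y\<in>V. P x y * M y z) = (\<Sum>y\<in>V. \<Sum>w\<in>V. P x y * nb (Suc k) y w * P w z)"
      by (simp add: M_def sum_distrib_left mult.assoc)
    also have "\<dots> = (\<Sum>w\<in>V. (\<Sum>y\<in>V. P x y * nb (Suc k) y w) * P w z)"
      unfolding sum_distrib_right by (rule sum.swap)
    also have "\<dots> = (\<Sum>w\<in>V. M x w * P w z)"
      using ge2(2) that unfolding M_def by (intro sum.cong refl) auto
    finally show ?thesis by simp
  qed
  show ?case
  proof (intro conjI ballI)
    fix x z assume xz: "x \<in> V" "z \<in> V"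
    show "nb (Suc (Suc k)) x z = nb (Suc (Suc k)) z x"
      using xz ge2(1) M_sym[OF xz] by (simp only: nb2)
    have "(\<Sum>y\<in>V. nb (Suc (Suc k)) x y * P y z) =
        (\<Sum>y\<in>V. (d * (M x y * P y z) - nb k x y * P y z) / (real d - 1))"
      using xz by (intro sum.cong) (auto simp: nb2 algebra_simps)
    also have "\<dots> = (d * (\<Sum>y\<in>V. M x y * P y z) - (\<Sum>y\<in>V. nb k x y * P y z)) / (real d - 1)"
      by (simp add: sum_divide_distrib[symmetric] sum_subtractf sum_distrib_left)
    also have "\<dots> = (d * (\<Sum>y\<in>V. P x y * M y z) - (\<Sum>y\<in>V. P x y * nb k y z)) / (real d - 1)"
    proof -
      have "(\<Sum>y\<in>V. nb k x y * P y z) = (\<Sum>y\<in>V. P x y * nb k y z)" using ge2(1) xz by blast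
      then show ?thesis using M_com[OF xz] by (simp only:)
    qed
    also have "\<dots> = (\<Sum>y\<in>V. (d * (P x y * M y z) - P x y * nb k y z) / (real d - 1))"
      by (simp add: sum_divide_distrib[symmetric] sum_subtractf sum_distrib_left)
    also have "\<dots> = (\<Sum>y\<in>V. P x y * nb (Suc (Suc k)) y z)"
      using xz by (intro sum.cong) (auto simp: nb2 algebra_simps)
    finally show "(\<Sum>y\<in>V. nb (Suc (Suc k)) x y * P y z) = (\<Sum>y\<in>V. P x y * nb (Suc (Suc k)) y z)" .
  qed
qed

lemma nb_sym: "x \<in> V \<Longrightarrow> z \<in> V \<Longrightarrow> nb k x z = nb k z x"
  using nb_sym_commute by blast

lemma arcdist_0_or_ge: "arcdist k x y z = 0 \<or> arcdist k x y z \<ge> 1 / (d * (real d - 1) ^ k)"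
proof (induction k arbitrary: y z)
  case (Suc k)
  have "(\<Sum>w\<in>V - {z}. arcdist k x w y) = 0 \<or> 1 / (d * (real d - 1) ^ k) \<le> (\<Sum>w\<in>V - {z}. arcdist k x w y)"
    by (rule sum_eq_0_or_ge) (use Suc d2 finV in auto)
  then show ?case
  proof
    assume "1 / (d * (real d - 1) ^ k) \<le> (\<Sum>w\<in>V - {z}. arcdist k x w y)"
    then have "1 / (d * (real d - 1) ^ k) / (real d - 1) \<le> (\<Sum>w\<in>V - {z}. arcdist k x w y) / (real d - 1)"
      by (rule divide_right_mono) (use d2 in auto)
    then show ?case by (simp add: mult_ac)
  qed auto
qed auto

text \<open>Every vertex in the support has mass at least 1/(d (d-1)^(k-1)) for positive
  \<open>k\<close>, and the total mass is 1. The factor 2 absorbs d <= 2 (d-1) and covers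
  \<open>k = 0\<close> as well.\<close>

lemma card_nb_support:
  assumes "x \<in> V"
  shows "card {z\<in>V. nb k x z \<noteq> 0} \<le> 2 * (real d - 1) ^ k"
proof -
  have d1: "0 < real d - 1" using d2 by auto
  have "nb k x z = 0 \<or> nb k x z \<ge> 1 / (2 * (real d - 1) ^ k)" for z
  proof (cases k)
    case (Suc j)
    have "nb k x z = 0 \<or> nb k x z \<ge> 1 / (d * (real d - 1) ^ j)"
      unfolding Suc nb_Suc by (rule sum_eq_0_or_ge) (use arcdist_0_or_ge finV d2 in auto)
    moreover have "1 / (2 * (real d - 1) ^ k) \<le> 1 / (d * (real d - 1) ^ j)"
    proof (rule divide_left_mono)
      have "real d \<le> 2 * (real d - 1)" using d2 by simp
      then show "real d * (real d - 1) ^ j \<le> 2 * (real d - 1) ^ k"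
        using d1 by (simp add: Suc mult.assoc[symmetric] mult_right_mono)
    qed (use d1 d2 in auto)
    ultimately show ?thesis by linarith
  qed (simp add: nb_0)
  then have ge: "1 / (2 * (real d - 1) ^ k) \<le> nb k x z" if "nb k x z \<noteq> 0" for z using that by blast
  have "card {z\<in>V. nb k x z \<noteq> 0} * (1 / (2 * (real d - 1) ^ k)) \<le> (\<Sum>z\<in>{z\<in>V. nb k x z \<noteq> 0}. nb k x z)"
    by (rule sum_bounded_below) (use ge in auto)
  also have "\<dots> \<le> (\<Sum>z\<in>V. nb k x z)"
    by (rule sum_mono2) (use finV nb_nonneg in auto)
  also have "\<dots> = 1" using assms by (rule nb_row)
  finally show ?thesis using d1 by (simp add: field_simps)
qed

end

text \<open>Cauchy-Schwarz against the constant 1, read off from a non-negative variance.\<close>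

lemma sum_squared_le_card_mult:
  fixes f :: "'b \<Rightarrow> real"
  assumes "finite A"
  shows "(sum f A)\<^sup>2 \<le> card A * (\<Sum>x\<in>A. f x * f x)"
proof (cases "A = {}")
  case False
  define N where "N = real (card A)"
  define c where "c = sum f A / N"
  have N: "N > 0" using assms False by (simp add: N_def card_gt_0_iff)
  have "0 \<le> (\<Sum>x\<in>A. (f x - c) * (f x - c))" by (intro sum_nonneg) simp
  also have "\<dots> = (\<Sum>x\<in>A. f x * f x - 2 * c * f x + c * c)"
    by (intro sum.cong) (auto simp: algebra_simps)
  also have "\<dots> = (\<Sum>x\<in>A. f x * f x) - 2 * c * sum f A + N * c * c"
    unfolding sum.distrib sum_subtractf sum_distrib_left[symmetric] by (simp add: N_def)
  also have "\<dots> = (\<Sum>x\<in>A. f x * f x) - (sum f A)\<^sup>2 / N"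
    using N by (simp add: c_def power2_eq_square field_simps)
  finally show ?thesis using N by (simp add: N_def field_simps)
qed simp

context regular_walk
begin

lemma abs_T_le:
  assumes "\<And>x. x \<in> V \<Longrightarrow> \<bar>f x\<bar> \<le> c" "x \<in> V"
  shows "\<bar>T f x\<bar> \<le> c"
proof -
  have "\<bar>T f x\<bar> \<le> T (\<lambda>y. \<bar>f y\<bar>) x" by (rule abs_kapply_le) (rule P_nonneg)
  also have "\<dots> \<le> T (\<lambda>_. c) x" by (rule kapply_mono) (use P_nonneg assms in auto)
  finally show ?thesis using assms(2) by (simp add: T_const)
qed

lemma abs_funpow_T_le:
  assumes "\<And>x. x \<in> V \<Longrightarrow> \<bar>f x\<bar> \<le> c"
  shows "x \<in> V \<Longrightarrow> \<bar>(T ^^ t) f x\<bar> \<le> c"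
  by (induction t arbitrary: x) (auto intro!: assms abs_T_le)

lemma kapply_nb_const: "x \<in> V \<Longrightarrow> kapply V (nb k) (\<lambda>_. c) x = c"
  by (simp add: kapply_def sum_distrib_right[symmetric] nb_row)

lemma kapply_nb_le:
  assumes "\<And>x. x \<in> V \<Longrightarrow> f x \<le> c" "x \<in> V"
  shows "kapply V (nb k) f x \<le> c"
proof -
  have "kapply V (nb k) f x \<le> kapply V (nb k) (\<lambda>_. c) x"
    by (rule kapply_mono) (use nb_nonneg assms in auto)
  then show ?thesis using assms(2) by (simp add: kapply_nb_const)
qed

subsection \<open>Killing the walk outside a set\<close>

text \<open>The probability that the walk from \<open>x\<close> lies in \<open>B\<close> at each of
  the times 0, ..., \<open>t\<close>; a start outside \<open>B\<close> already counts as an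
  exit.\<close>

primrec killed :: "'a set \<Rightarrow> nat \<Rightarrow> 'a \<Rightarrow> real" where
  "killed B 0 = ind B"
| "killed B (Suc t) = (\<lambda>x. if x \<in> B then T (killed B t) x else 0)"

lemma killed_nonneg: "0 \<le> killed B t x"
proof (induction t arbitrary: x)
  case (Suc t)
  have "0 \<le> T (killed B t) x"
    using Suc by (auto simp: kapply_def intro!: sum_nonneg mult_nonneg_nonneg P_nonneg)
  then show ?case by simp
qed (simp add: ind_def)

lemma killed_outside: "x \<notin> B \<Longrightarrow> killed B t x = 0"
  by (cases t) (auto simp: ind_def)

lemma killed_le_1: "B \<subseteq> V \<Longrightarrow> killed B t x \<le> 1"
proof (induction t arbitrary: x)
  case (Suc t)
  then show ?case
    using abs_T_le[of "killed B t" 1 x] killed_nonneg[of B t] by fastforce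
qed (simp add: ind_def)

text \<open>Condition on the first exit from \<open>B\<close>. The number of steps left at that
  moment is arbitrary, which is why good vertices have to be good throughout the window.\<close>

lemma abs_funpow_le_killed:
  assumes f: "\<And>x. x \<in> V \<Longrightarrow> \<bar>f x\<bar> \<le> 1" and B: "B \<subseteq> V" and \<eta>: "0 \<le> \<eta>"
    and small: "\<And>j x. x \<in> V - B \<Longrightarrow> j \<le> t \<Longrightarrow> \<bar>(T ^^ (s + j)) f x\<bar> \<le> \<eta>"
  shows "j \<le> t \<Longrightarrow> x \<in> V \<Longrightarrow> \<bar>(T ^^ (s + j)) f x\<bar> \<le> \<eta> + killed B j x"
proof (induction j arbitrary: x)
  case 0
  show ?case
  proof (cases "x \<in> B")
    case True
    have "\<bar>(T ^^ s) f x\<bar> \<le> 1" by (rule abs_funpow_T_le) (use f 0 in auto)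
    then show ?thesis using True \<eta> by (simp add: ind_def)
  next
    case False
    then show ?thesis using small[of x 0] 0 by (simp add: ind_def)
  qed
next
  case (Suc j)
  show ?case
  proof (cases "x \<in> B")
    case True
    have "\<bar>(T ^^ (s + Suc j)) f x\<bar> \<le> T (\<lambda>y. \<bar>(T ^^ (s + j)) f y\<bar>) x"
      using abs_kapply_le[of V P "(T ^^ (s + j)) f" x] P_nonneg by simp
    also have "\<dots> \<le> T (\<lambda>y. \<eta> + killed B j y) x"
      by (rule kapply_mono) (use P_nonneg Suc in auto)
    also have "\<dots> = \<eta> + killed B (Suc j) x"
      using True Suc by (simp add: kapply_add[of V P "\<lambda>_. \<eta>"] T_const)
    finally show ?thesis .
  next
    case False
    then show ?thesis using small[of x "Suc j"] Suc by (simp add: killed_outside)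
  qed
qed

definition nb_restrict :: "'a set \<Rightarrow> nat \<Rightarrow> 'a \<Rightarrow> 'a \<Rightarrow> real" where
  "nb_restrict B k x y = ind B x * nb k x y * ind B y"

lemma nb_restrict_nonneg: "0 \<le> nb_restrict B k x y"
  by (simp add: nb_restrict_def ind_def nb_nonneg)

lemma sym_kernel_nb: "sym_kernel V (nb k)"
  by unfold_locales (auto simp: finV nb_sym)

lemma sym_kernel_nb_restrict: "sym_kernel V (nb_restrict B k)"
  by unfold_locales (auto simp: finV nb_sym nb_restrict_def)

lemma kapply_nb_restrict:
  "kapply V (nb_restrict B k) f = (\<lambda>x. ind B x * kapply V (nb k) (\<lambda>y. ind B y * f y) x)"
  by (auto simp: kapply_def nb_restrict_def sum_distrib_left mult_ac)

lemma funpow_nb_restrict_nonneg: "0 \<le> (kapply V (nb_restrict B k) ^^ m) (ind B) x"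
proof (induction m arbitrary: x)
  case (Suc m)
  then show ?case
    by (auto simp: kapply_def intro!: sum_nonneg mult_nonneg_nonneg nb_restrict_nonneg)
qed (simp add: ind_def)

lemma ind_mult_funpow_nb_restrict:
  "ind B y * (kapply V (nb_restrict B k) ^^ m) (ind B) y = (kapply V (nb_restrict B k) ^^ m) (ind B) y"
  by (cases m) (auto simp: ind_def kapply_nb_restrict)

text \<open>In \<open>k (m + 1)\<close> units of tree distance the killed walk is observed in \<open>B\<close> at the end of
  \<open>m\<close> consecutive non-backtracking segments of length \<open>k\<close>, unless its lift to the covering tree
  is slower than expected, which the exponential moment \<open>w\<close> controls.\<close>

context
  fixes B :: "'a set" and k :: nat and w \<phi> :: real
  assumes B: "B \<subseteq> V" and k: "0 < k" and w: "1 \<le> w" and \<phi>_def: "\<phi> = (w + (real d - 1) / w) / real d"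
begin

lemma \<phi>_pos: "0 < \<phi>"
  using w d2 by (auto simp: \<phi>_def intro!: divide_pos_pos add_pos_nonneg)

text \<open>A segment that reaches level \<open>k\<close> ends at some y, and
  \<open>killed B t y\<close> vanishes unless y lies in \<open>B\<close>. So one restricted operator
  is split off and the level restarts at 0 with one segment fewer; when no segment is left,
  \<open>killed\<close> is bounded by the indicator of \<open>B\<close>.\<close>

lemma killed_segment_end:
  assumes IH: "\<And>m x. x \<in> V \<Longrightarrow> killed B t x \<le>
      w ^ (k * Suc m) * \<phi> ^ t + kapply V (nb k) ((kapply V (nb_restrict B k) ^^ m) (ind B)) x"
    and x: "x \<in> V"
  shows "kapply V (nb k) (killed B t) x \<le>
      w ^ (k * m) * \<phi> ^ t + kapply V (nb k) ((kapply V (nb_restrict B k) ^^ m) (ind B)) x"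
proof -
  let ?K = "kapply V (nb_restrict B k)"
  have le: "killed B t y \<le> w ^ (k * m) * \<phi> ^ t + (?K ^^ m) (ind B) y" if y: "y \<in> V" for y
  proof (cases "y \<in> B")
    case False
    then show ?thesis
      using \<phi>_pos w funpow_nb_restrict_nonneg[where B = B and k = k and m = m and x = y] by (simp add: killed_outside)
  next
    case yB: True
    show ?thesis
    proof (cases m)
      case 0
      then show ?thesis using killed_le_1[OF B, of t y] yB \<phi>_pos by (simp add: ind_def)
          (metis add.commute add_increasing2 less_imp_le zero_le_power)
    next
      case (Suc m')
      have "kapply V (nb k) ((?K ^^ m') (ind B)) y = (?K ^^ m) (ind B) y"
        using yB by (simp add: Suc kapply_nb_restrict[of B k "(?K ^^ m') (ind B)"]
            ind_mult_funpow_nb_restrict) (simp add: ind_def)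
      then show ?thesis using IH[OF y, of m'] Suc by simp
    qed
  qed
  have "kapply V (nb k) (killed B t) x \<le>
      kapply V (nb k) (\<lambda>y. w ^ (k * m) * \<phi> ^ t + (?K ^^ m) (ind B) y) x"
    by (rule kapply_mono) (use nb_nonneg le in auto)
  then show ?thesis
    by (simp add: kapply_add[of V "nb k" "\<lambda>_. w ^ (k * m) * \<phi> ^ t"] kapply_nb_const[OF x])
qed

text \<open>Here \<open>j\<close> is the level inside the current segment and k (m+1) - j the tree
  distance still to be covered. The first term is the Chernoff bound for not covering it in
  \<open>t\<close> steps: a step multiplies 1/\<open>w\<close> to the level by \<phi> on average.
  Between segment ends the killing is simply dropped.\<close>

lemma killed_segment:
  assumes "j < k" "x \<in> V"
  shows "kapply V (nb j) (killed B t) x \<le>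
      w ^ (k * Suc m - j) * \<phi> ^ t + kapply V (nb k) ((kapply V (nb_restrict B k) ^^ m) (ind B)) x"
  using assms
proof (induction t arbitrary: j m x)
  case 0
  let ?R = "kapply V (nb k) ((kapply V (nb_restrict B k) ^^ m) (ind B)) x"
  have "kapply V (nb j) (killed B 0) x \<le> 1"
    by (rule kapply_nb_le) (use 0 in \<open>auto simp: ind_def\<close>)
  moreover have "1 \<le> w ^ (k * Suc m - j)" using w by simp
  moreover have "0 \<le> ?R"
    by (auto simp: kapply_def[of V "nb k"] intro!: sum_nonneg mult_nonneg_nonneg nb_nonneg funpow_nb_restrict_nonneg)
  ultimately show ?case by simp
next
  case (Suc t)
  let ?R = "kapply V (nb k) ((kapply V (nb_restrict B k) ^^ m) (ind B)) x"
  define e where "e = k * Suc m - j"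
  have e: "e > 0" using Suc.prems k by (simp add: e_def) 
  \<comment> \<open>The induction hypothesis handles levels below \<open>k\<close>; level
    \<open>k\<close> means that the segment is complete.\<close>
  have IH: "kapply V (nb j) (killed B t) x \<le> w ^ (k * Suc m - j) * \<phi> ^ t + ?R" if "j \<le> k" for j
  proof (cases "j < k")
    case True
    then show ?thesis using Suc.IH Suc.prems by blast
  next
    case False
    then have jk: "j = k" using that by simp
    have "kapply V (nb k) (killed B t) x \<le> w ^ (k * m) * \<phi> ^ t + ?R"
    proof (rule killed_segment_end)
      show "killed B t y \<le> w ^ (k * Suc m') * \<phi> ^ t +
          kapply V (nb k) ((kapply V (nb_restrict B k) ^^ m') (ind B)) y" if "y \<in> V" for m' y
        using Suc.IH[of 0 y m'] k that by (simp add: kapply_nb_0)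
    qed (use Suc.prems in auto)
    then show ?thesis by (simp add: jk)
  qed
  have "kapply V (nb j) (killed B (Suc t)) x \<le> kapply V (nb j) (T (killed B t)) x"
  proof (rule kapply_mono)
    have "0 \<le> T (killed B t) y" for y
      by (auto simp: kapply_def intro!: sum_nonneg mult_nonneg_nonneg P_nonneg killed_nonneg)
    then show "killed B (Suc t) y \<le> T (killed B t) y" for y by simp
  qed (rule nb_nonneg)
  also have "\<dots> \<le> w ^ e * \<phi> ^ Suc t + ?R"
  proof (cases j)
    case 0
    have "kapply V (nb j) (T (killed B t)) x = kapply V (nb (Suc 0)) (killed B t) x"
      using Suc.prems by (simp add: 0 kapply_nb_0 kapply_nb_1)
    also have "\<dots> \<le> w ^ (e - 1) * \<phi> ^ t + ?R"
      using IH[of "Suc 0"] k by (simp add: e_def 0)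
    \<comment> \<open>At level 0 the step is forced upwards. The bound survives because
      \<open>w\<close> \<phi> = (w^2 + d - 1)/d is at least 1.\<close>
    also have "w ^ (e - 1) * \<phi> ^ t \<le> w ^ e * \<phi> ^ Suc t"
    proof -
      have "1 * 1 \<le> w * w" using w by (intro mult_mono) auto
      then have "1 \<le> w * \<phi>" using w d2 by (simp add: \<phi>_def field_simps)
      then have "w ^ (e - 1) * \<phi> ^ t * 1 \<le> w ^ (e - 1) * \<phi> ^ t * (w * \<phi>)"
        using w \<phi>_pos by (intro mult_left_mono) auto
      also have "\<dots> = w ^ e * \<phi> ^ Suc t"
        using e by (cases e) auto
      finally show ?thesis by simp
    qed
    finally show ?thesis by simp
  next
    case (Suc i)
    obtain e' where e': "e = Suc e'" using e by (cases e) auto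
    have e1: "k * Suc m - i = Suc e" "k * Suc m - Suc (Suc i) = e'"
      using e' e Suc by (auto simp: e_def)
    have "kapply V (nb j) (T (killed B t)) x =
        kapply V (nb i) (killed B t) x / d + (real d - 1) / d * kapply V (nb (Suc (Suc i))) (killed B t) x"
      unfolding Suc by (rule kapply_nb_T)
    also have "\<dots> \<le> (w ^ Suc e * \<phi> ^ t + ?R) / d + (real d - 1) / d * (w ^ e' * \<phi> ^ t + ?R)"
      using IH[of i] IH[of "Suc (Suc i)"] Suc Suc.prems(1) d2 unfolding e1
      by (intro add_mono divide_right_mono mult_left_mono) auto
    also have "\<dots> = w ^ e * \<phi> ^ Suc t + ?R"
      using w d2 by (simp add: e' \<phi>_def field_simps)
    finally show ?thesis .
  qed
  finally show ?case by (simp add: e_def)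
qed

lemma killed_le:
  assumes x: "x \<in> V"
    and K: "\<And>y. y \<in> V \<Longrightarrow> (kapply V (nb_restrict B k) ^^ m) (ind B) y \<le> c"
  shows "killed B t x \<le> w ^ (k * Suc m) * \<phi> ^ t + c"
proof -
  have "kapply V (nb k) ((kapply V (nb_restrict B k) ^^ m) (ind B)) x \<le> c"
    by (rule kapply_nb_le) (use K x in auto)
  then show ?thesis using killed_segment[of 0 x t m] k x by (simp add: kapply_nb_0)
qed

end

text \<open>For segments of length 1 the restricted operator is the killed walk itself, so time need
  not be compared with tree distance.\<close>

lemma killed_eq_funpow: "killed B t = (kapply V (nb_restrict B (Suc 0)) ^^ t) (ind B)"
proof (induction t)
  case (Suc t)
  have "(\<lambda>y. ind B y * killed B t y) = killed B t"
    by (auto simp: ind_def killed_outside)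
  then have "kapply V (nb_restrict B (Suc 0)) (killed B t) = killed B (Suc t)"
    unfolding kapply_nb_restrict kapply_nb_1 by (auto simp: ind_def)
  then show ?case by (simp add: Suc del: killed.simps)
qed simp

subsection \<open>The walk rarely goes far\<close>

text \<open>A Chernoff bound for the level, as \<psi> is the mean of \<open>w\<close> to the
  displacement of one step. Level 0 spoils the plain bound w^j, because the level then rises with
  certainty and \<open>w\<close> exceeds \<psi> once w > 1. The corrector (d-1)^(-j) is harmonic at
  positive levels and makes up for the boundary.\<close>

lemma nb_funpow_far:
  fixes w \<psi> :: real
  assumes d3: "3 \<le> d" and w: "1 \<le> w" and \<psi>: "\<psi> = ((real d - 1) * w + 1 / w) / real d"
    and x: "x \<in> V" and f1: "\<And>y. y \<in> V \<Longrightarrow> f y \<le> 1"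
    and near: "\<And>j. j \<le> r \<Longrightarrow> kapply V (nb j) f x = 0"
  shows "w ^ r * kapply V (nb j) ((T ^^ t) f) x \<le> \<psi> ^ t * (w ^ j + 1 / (real d - 1) ^ j)"
proof (induction t arbitrary: j)
  case 0
  have d1: "0 < real d - 1" using d2 by simp
  show ?case
  proof (cases "j \<le> r")
    case True
    then show ?thesis using near d1 w by simp
  next
    case False
    have "w ^ r * kapply V (nb j) f x \<le> w ^ r * 1"
      using w by (intro mult_left_mono kapply_nb_le f1 x) auto
    also have "\<dots> \<le> w ^ j" using False w by (simp add: power_increasing)
    finally show ?thesis using d1 by (simp add: add_increasing2)
  qed
next
  case (Suc t)
  have d1: "0 < real d - 1" using d2 by simp
  have \<psi>1: "1 \<le> \<psi>"
  proof -
    have "0 \<le> (w - 1) * ((real d - 1) * w - 1)"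
      using w d2 by (intro mult_nonneg_nonneg) (auto intro: order_trans[OF _ mult_mono[of 1 "real d - 1" 1 w, simplified]])
    then show ?thesis using w d2 by (simp add: \<psi> field_simps)
  qed
  show ?case
  proof (cases j)
    case 0
    have "w ^ r * kapply V (nb j) ((T ^^ Suc t) f) x = w ^ r * kapply V (nb (Suc 0)) ((T ^^ t) f) x"
      using x by (simp add: 0 kapply_nb_0 kapply_nb_1)
    also have "\<dots> \<le> \<psi> ^ t * (w + 1 / (real d - 1))" using Suc[of "Suc 0"] by simp
    \<comment> \<open>What the corrector has to achieve at level 0: w + 1/(d-1) <= 2 \<psi>. It
      follows from w + 1/w >= 2 and d - 2 >= 1.\<close>
    also have "\<dots> \<le> \<psi> ^ t * (2 * \<psi>)"
    proof (rule mult_left_mono)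
      have "0 \<le> (w - 1)\<^sup>2" by simp
      then have "2 \<le> w + 1 / w" using w by (simp add: field_simps power2_eq_square)
      also have "\<dots> \<le> w + 2 / w" using w by (simp add: divide_right_mono)
      finally have "2 \<le> w + 2 / w" .
      moreover have "real d / (real d - 1) \<le> 2" using d2 by (simp add: field_simps)
      moreover have "1 * w \<le> (real d - 2) * w" using w d3 by (intro mult_right_mono) auto
      ultimately have "real d * w + real d / (real d - 1) \<le> 2 * ((real d - 1) * w + 1 / w)"
        by (simp add: algebra_simps)
      then show "w + 1 / (real d - 1) \<le> 2 * \<psi>" using d2 by (simp add: \<psi> field_simps)
    qed (use \<psi>1 in auto)
    finally show ?thesis by (simp add: 0 mult_ac)
  next
    case (Suc i)
    have "w ^ r * kapply V (nb j) ((T ^^ Suc t) f) x =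
        (w ^ r * kapply V (nb i) ((T ^^ t) f) x) / d
        + (real d - 1) / d * (w ^ r * kapply V (nb (Suc (Suc i))) ((T ^^ t) f) x)"
      using kapply_nb_T[of i "(T ^^ t) f" x] by (simp add: Suc algebra_simps)
    also have "\<dots> \<le> (\<psi> ^ t * (w ^ i + 1 / (real d - 1) ^ i)) / d
        + (real d - 1) / d * (\<psi> ^ t * (w ^ Suc (Suc i) + 1 / (real d - 1) ^ Suc (Suc i)))"
      using Suc.IH[of i] Suc.IH[of "Suc (Suc i)"] d2
      by (intro add_mono divide_right_mono mult_left_mono) auto
    also have "\<dots> = \<psi> ^ t * ((w ^ i / d + (real d - 1) / d * w ^ Suc (Suc i))
        + (1 / (real d - 1) ^ i / d + (real d - 1) / d * (1 / (real d - 1) ^ Suc (Suc i))))"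
      by (simp add: algebra_simps add_divide_distrib del: power_Suc)
    also have "w ^ i / d + (real d - 1) / d * w ^ Suc (Suc i) = \<psi> * w ^ j"
      using w d2 by (simp add: Suc \<psi> field_simps)
    also have "1 / (real d - 1) ^ i / d + (real d - 1) / d * (1 / (real d - 1) ^ Suc (Suc i)) = 1 / (real d - 1) ^ j"
    proof -
      define q where "q = real d - 1"
      have q: "q > 0" "real d = q + 1" using d2 by (auto simp: q_def)
      have "1 / q ^ i / (q + 1) + q / (q + 1) * (1 / q ^ Suc (Suc i)) = 1 / q ^ j"
        using q(1) by (simp add: Suc divide_simps)
      then show ?thesis by (simp add: q(2) del: power_Suc)
    qed
    \<comment> \<open>The corrector is harmonic and gains no factor \<psi> by itself; \<psi> >= 1
      supplies it.\<close>
    also have "\<psi> ^ t * (\<psi> * w ^ j + 1 / (real d - 1) ^ j) \<le>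
        \<psi> ^ t * (\<psi> * w ^ j + \<psi> * (1 / (real d - 1) ^ j))"
      using \<psi>1 d1 by (intro mult_left_mono add_left_mono) (auto intro!: divide_right_mono)
    finally show ?thesis by (simp add: algebra_simps)
  qed
qed

end

subsection \<open>Bounds on the Geronimus polynomials\<close>

text \<open>With z = \<rho> w, the Geronimus polynomials scaled by (d-1)^(k/2) satisfy this
  recurrence for c = 1/d. The values c = 0 and c = 1/2 give the Chebyshev polynomials of the second
  and of the first kind.\<close>

locale chebyshev_recurrence =
  fixes r :: "nat \<Rightarrow> real" and w c :: real
  assumes r_0: "r 0 = 1" and r_1: "r (Suc 0) = 2 * w * (1 - c)"
    and r_SucSuc: "\<And>k. r (Suc (Suc k)) = 2 * w * r (Suc k) - r k"
    and c: "0 \<le> c" "c \<le> 1 / 2"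
begin

lemma pell: "(r (Suc k) - w * r k)\<^sup>2 + (1 - w\<^sup>2) * (r k)\<^sup>2 = 1 - 4 * w\<^sup>2 * (c * (1 - c))"
proof (induction k)
  case 0
  show ?case by (simp add: r_0 r_1 power2_eq_square algebra_simps)
next
  case (Suc k)
  then show ?case by (simp add: r_SucSuc power2_eq_square algebra_simps)
qed

text \<open>By the invariant, r (k+1) differs from w r k by at most 1, so the modulus grows by at
  most 1 per step.\<close>

lemma abs_le_if_abs_le_1:
  assumes "\<bar>w\<bar> \<le> 1"
  shows "\<bar>r k\<bar> \<le> real k + 1"
proof (induction k)
  case (Suc k)
  have "0 \<le> w\<^sup>2 * (c * (1 - c))" using c by simp
  moreover have "w\<^sup>2 \<le> 1" using assms by (simp add: abs_square_le_1)
  then have "0 \<le> (1 - w\<^sup>2) * (r k)\<^sup>2" by simp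
  ultimately have "(r (Suc k) - w * r k)\<^sup>2 \<le> 1" using pell[of k] by linarith
  then have "\<bar>r (Suc k) - w * r k\<bar> \<le> 1" by (simp add: abs_square_le_1)
  moreover have "\<bar>w * r k\<bar> \<le> 1 * \<bar>r k\<bar>" unfolding abs_mult using assms by (intro mult_right_mono) auto
  ultimately show ?case using Suc by simp
qed (simp add: r_0)

text \<open>The characteristic roots are \<open>y\<close> and \<open>1 / y\<close>. Subtracting a
  multiple by one root leaves a geometric sequence in the other: \<open>A\<close> yields the upper
  bound, \<open>B\<close> positivity, where c <= 1/2 keeps r 1 above 1/y.\<close>

lemma bounds_if_ge_1:
  assumes y: "1 \<le> y" and w: "2 * w = y + 1 / y"
  shows "0 \<le> r k" "r k \<le> (real k + 1) * y ^ k"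
proof -
  have yinv: "1 / y \<le> 1" "1 / y \<le> y" "0 < 1 / y" using y by (auto simp: field_simps)
     (metis mult_mono mult_1 zero_le_one order_trans)
  have A: "r (Suc k) - y * r k = (1 / y) ^ k * (r (Suc 0) - y)" for k
  proof (induction k)
    case (Suc k)
    have "r (Suc (Suc k)) - y * r (Suc k) = (1 / y) * (r (Suc k) - y * r k)"
      unfolding r_SucSuc w using y by (simp add: algebra_simps)
    then show ?case using Suc by simp
  qed (simp add: r_0)
  have B: "r (Suc k) - (1 / y) * r k = y ^ k * (r (Suc 0) - 1 / y)" for k
  proof (induction k)
    case (Suc k)
    have "r (Suc (Suc k)) - (1 / y) * r (Suc k) = y * (r (Suc k) - (1 / y) * r k)"
      unfolding r_SucSuc w using y by (simp add: algebra_simps)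
    then show ?case using Suc by simp
  qed (simp add: r_0)
  have r1: "r (Suc 0) = (y + 1 / y) - c * (y + 1 / y)"
    unfolding r_1 w by (simp only: right_diff_distrib mult_1_right mult.commute[of c])
  have c0: "0 \<le> c * (y + 1 / y)" using c y by simp
  have c1: "c * (y + 1 / y) \<le> y"
  proof -
    have "c * (y + 1 / y) \<le> 1 / 2 * (y + y)" using c y yinv by (intro mult_mono) auto
    then show ?thesis by simp
  qed
  have nonneg: "0 \<le> r k" for k
  proof (induction k)
    case (Suc k)
    have "0 \<le> y ^ k * (r (Suc 0) - 1 / y)" using y r1 c1 by simp
    then have "1 / y * r k \<le> r (Suc k)" using B[of k] by linarith
    moreover have "0 \<le> 1 / y * r k" using Suc y by simp
    ultimately show ?case by linarith
  qed (simp add: r_0)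
  show "0 \<le> r k" by (rule nonneg)
  show "r k \<le> (real k + 1) * y ^ k"
  proof (induction k)
    case (Suc k)
    have "(1 / y) ^ k * (r (Suc 0) - y) \<le> (1 / y) ^ k * 1"
    proof (rule mult_left_mono)
      show "r (Suc 0) - y \<le> 1" using r1 c0 yinv(1) by linarith
    qed (use y in auto)
    also have "\<dots> \<le> 1" using y yinv by (simp add: power_le_one)
    finally have "r (Suc k) \<le> y * r k + 1" using A[of k] by linarith
    also have "\<dots> \<le> y * ((real k + 1) * y ^ k) + y ^ Suc k"
      using Suc y by (intro add_mono mult_left_mono one_le_power) auto
    finally show ?case by (simp add: algebra_simps)
  qed (simp add: r_0)
qed

end

lemma geronimus_le:
  assumes d: "2 \<le> d" and k: "odd k" and y: "1 \<le> y"
    and z: "z \<le> ramanujan_rho d * ((y + 1 / y) / 2)"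
  shows "geronimus d k z \<le> (real k + 1) * (y / sqrt (real d - 1)) ^ k"
proof -
  define b where "b = sqrt (real d - 1)"
  have b: "b > 0" "b * b = real d - 1" using d by (auto simp: b_def)
  define w where "w = z * d / (2 * b)"
  define r where "r k = b ^ k * geronimus d k z" for k
  have zw: "z = ramanujan_rho d * w" using d b(1) by (simp add: w_def ramanujan_rho_def b_def[symmetric])
  interpret chebyshev_recurrence r w "1 / d"
  proof
    show "r (Suc 0) = 2 * w * (1 - 1 / real d)"
    proof -
      have "2 * w * (1 - 1 / real d) = z * (real d - 1) / b" using d b(1) by (simp add: w_def field_simps)
      also have "\<dots> = b * z" using b(1) by (simp add: b(2)[symmetric])
      finally show ?thesis by (simp add: r_def)
    qed
    fix k
    have "r (Suc (Suc k)) = b ^ k * (d * z * geronimus d (Suc k) z - geronimus d k z)"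
      using d b by (simp add: r_def mult.assoc[symmetric])
    also have "\<dots> = 2 * w * r (Suc k) - r k"
      using b(1) by (simp add: r_def w_def field_simps)
    finally show "r (Suc (Suc k)) = 2 * w * r (Suc k) - r k" .
  qed (use d in \<open>auto simp: r_def field_simps\<close>)
  have "r k \<le> (real k + 1) * y ^ k"
  proof -
    consider "\<bar>w\<bar> \<le> 1" | "w > 1" | "w < -1" by linarith
    then show ?thesis
    proof cases
      case 1
      then have "r k \<le> (real k + 1) * 1" using abs_le_if_abs_le_1[of k] by simp
      also have "\<dots> \<le> (real k + 1) * y ^ k" using y by (intro mult_left_mono) auto
      finally show ?thesis .
    next
      case 2
      define u where "u = w + sqrt (w\<^sup>2 - 1)"
      have s: "sqrt (w\<^sup>2 - 1) ^ 2 = w\<^sup>2 - 1" "0 \<le> sqrt (w\<^sup>2 - 1)" using 2 by auto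
      have u1: "u \<ge> 1" using 2 s(2) unfolding u_def by linarith
      have "u * (w - sqrt (w\<^sup>2 - 1)) = 1" using s(1) by (simp add: u_def algebra_simps power2_eq_square)
      then have "1 / u = w - sqrt (w\<^sup>2 - 1)" using u1 by (simp add: field_simps)
      then have wu: "2 * w = u + 1 / u" by (simp add: u_def)
      have "ramanujan_rho d > 0" using d by (simp add: ramanujan_rho_def)
      then have "2 * w \<le> y + 1 / y" using z unfolding zw by simp
      \<comment> \<open>x + 1/x is strictly increasing for x >= 1.\<close>
      have "u \<le> y"
      proof (rule ccontr)
        assume "\<not> u \<le> y"
        then have "0 < (u - y) * (u * y - 1)" using u1 y
          by (intro mult_pos_pos) (auto simp: less_1_mult' intro: less_le_trans[of 1 u "u * y"])
        then have "y + 1 / y < u + 1 / u" using u1 y by (simp add: field_simps)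
        then show False using wu \<open>2 * w \<le> y + 1 / y\<close> by linarith
      qed
      have "r k \<le> (real k + 1) * u ^ k" by (rule bounds_if_ge_1(2)[OF u1 wu])
      also have "\<dots> \<le> (real k + 1) * y ^ k" using \<open>u \<le> y\<close> u1 by (intro mult_left_mono power_mono) auto
      finally show ?thesis .
    next
      case 3
      \<comment> \<open>Replacing \<open>w\<close> by its negative multiplies \<open>r k\<close> by
        the sign (-1)^k, which reduces this case to positivity beyond 1.\<close>
      define r' where "r' k = (-1) ^ k * r k" for k
      interpret neg: chebyshev_recurrence r' "-w" "1 / d"
        by unfold_locales (use c in \<open>auto simp: r'_def r_0 r_1 r_SucSuc algebra_simps\<close>)
      define u where "u = - w + sqrt (w\<^sup>2 - 1)"
      have "1 \<le> w\<^sup>2" using 3 by (simp add: abs_le_square_iff[of 1 w, simplified, symmetric])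
      then have s: "sqrt (w\<^sup>2 - 1) ^ 2 = w\<^sup>2 - 1" "0 \<le> sqrt (w\<^sup>2 - 1)" by auto
      have u1: "u \<ge> 1" using 3 s(2) unfolding u_def by linarith
      have "u * (- w - sqrt (w\<^sup>2 - 1)) = 1" using s(1) by (simp add: u_def algebra_simps power2_eq_square)
      then have "1 / u = - w - sqrt (w\<^sup>2 - 1)" using u1 by (simp add: field_simps)
      then have wu: "2 * (- w) = u + 1 / u" by (simp add: u_def)
      have "0 \<le> r' k" by (rule neg.bounds_if_ge_1(1)[OF u1 wu])
      then have "r k \<le> 0" using k by (simp add: r'_def)
      also have "0 \<le> (real k + 1) * y ^ k" using y by simp
      finally show ?thesis .
    qed
  qed
  then show ?thesis using b(1) by (simp add: r_def b_def[symmetric] power_divide field_simps)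
qed

section \<open>Upper bound from the spectral gap\<close>

text \<open>Connectedness enters as \<open>harmonic_const\<close>, and the rest of the spectrum as
  an interval from \<open>lo\<close> to \<open>hi\<close>. Both are phrased through eigenfunctions,
  independently of matrices.\<close>

locale gapped_walk = regular_walk +
  fixes lo hi :: real
  assumes harmonic_const: "P.eigenfun 1 g \<Longrightarrow> x \<in> V \<Longrightarrow> y \<in> V \<Longrightarrow> g x = g y"
    and gap: "P.eigenfun z g \<Longrightarrow> kinner V g g > 0 \<Longrightarrow> z \<noteq> 1 \<Longrightarrow> lo \<le> z \<and> z \<le> hi"
begin

abbreviation "N \<equiv> real (card V)"

lemma N_pos: "N > 0"
  using finV V_ne by (simp add: card_gt_0_iff)

text \<open>An eigenfunction for 1 is constant and thus orthogonal to \<open>f\<close>, so as a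
  component of \<open>f\<close> it would have norm 0.\<close>

lemma mean_zero_component:
  assumes g: "P.eigenfun z g" "kinner V g g > 0" "kinner V g f = kinner V g g" and f: "(\<Sum>x\<in>V. f x) = 0"
  shows "lo \<le> z \<and> z \<le> hi"
proof (cases "z = 1")
  case True
  obtain a where a: "a \<in> V" using V_ne by auto
  have "kinner V g f = (\<Sum>x\<in>V. g a * f x)"
    unfolding kinner_def using harmonic_const[OF g(1)[unfolded True] _ a] by (intro sum.cong) auto
  then have "kinner V g f = 0" using f by (simp add: sum_distrib_left[symmetric])
  then show ?thesis using g by simp
qed (use gap g in auto)

lemma l2_decay:
  assumes l: "- l \<le> lo" "hi \<le> l" and f: "supp_in V f" "(\<Sum>x\<in>V. f x) = 0"
  shows "kinner V ((T ^^ t) f) ((T ^^ t) f) \<le> (l\<^sup>2) ^ t * kinner V f f"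
proof -
  have "kinner V ((T ^^ (2 * t)) f) f \<le> (l\<^sup>2) ^ t * kinner V f f"
  proof (rule P.quadratic_form_le[OF f(1), where q = "\<lambda>z. z ^ (2 * t)"])
    fix z g assume "P.eigenfun z g" "kinner V g g > 0" "kinner V g f = kinner V g g"
    then have "\<bar>z\<bar> \<le> l" using mean_zero_component f(2) l by fastforce
    then have "\<bar>z\<bar> ^ (2 * t) \<le> l ^ (2 * t)" by (intro power_mono) auto
    then show "z ^ (2 * t) \<le> (l\<^sup>2) ^ t" by (simp add: power_even_abs power_mult)
  qed (auto simp: funpow_kapply_sum P.eigenfun_def funpow_kapply_eigen)
  then show ?thesis by (simp add: mult_2 funpow_add P.kinner_funpow_kapply[of t "(T ^^ t) f"])
qed

text \<open>Chebyshev's inequality for the sum of squares over the window. The squared l2 norms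
  decay geometrically, so the bound is uniform in the window length \<open>t\<close>.\<close>

lemma card_large_le:
  assumes l: "- l \<le> lo" "hi \<le> l" "0 \<le> l" "l < 1"
    and f: "supp_in V f" "(\<Sum>x\<in>V. f x) = 0" "\<And>x. x \<in> V \<Longrightarrow> \<bar>f x\<bar> \<le> 1" and \<eta>: "0 < \<eta>"
  shows "card {y\<in>V. \<exists>j\<le>t. \<eta> < \<bar>(T ^^ (s + j)) f y\<bar>} \<le> (l\<^sup>2) ^ s / (\<eta>\<^sup>2 * (1 - l\<^sup>2)) * N"
proof -
  define B where "B = {y\<in>V. \<exists>j\<le>t. \<eta> < \<bar>(T ^^ (s + j)) f y\<bar>}"
  have l2: "0 \<le> l\<^sup>2" "l\<^sup>2 < 1" using l by (auto simp: abs_square_less_1)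
  have ff: "kinner V f f \<le> N"
  proof -
    have "f x * f x \<le> 1" if "x \<in> V" for x
      using f(3)[OF that] by (metis abs_square_le_1 power2_eq_square)
    then have "kinner V f f \<le> (\<Sum>x\<in>V. 1)" unfolding kinner_def by (intro sum_mono) auto
    then show ?thesis by simp
  qed
  have "\<eta>\<^sup>2 * card B = (\<Sum>y\<in>B. \<eta>\<^sup>2)" by simp
  also have "\<dots> \<le> (\<Sum>y\<in>B. \<Sum>j\<le>t. ((T ^^ (s + j)) f y)\<^sup>2)"
  proof (rule sum_mono)
    fix y assume "y \<in> B"
    then obtain j where j: "j \<le> t" "\<eta> < \<bar>(T ^^ (s + j)) f y\<bar>" by (auto simp: B_def)
    have "\<eta>\<^sup>2 \<le> \<bar>(T ^^ (s + j)) f y\<bar>\<^sup>2" using j \<eta> by (intro power_mono) auto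
    also have "\<dots> = ((T ^^ (s + j)) f y)\<^sup>2" by simp
    also have "\<dots> \<le> (\<Sum>j\<le>t. ((T ^^ (s + j)) f y)\<^sup>2)"
      using j by (intro member_le_sum) auto
    finally show "\<eta>\<^sup>2 \<le> (\<Sum>j\<le>t. ((T ^^ (s + j)) f y)\<^sup>2)" .
  qed
  also have "\<dots> \<le> (\<Sum>y\<in>V. \<Sum>j\<le>t. ((T ^^ (s + j)) f y)\<^sup>2)"
    by (intro sum_mono2 finV sum_nonneg) (auto simp: B_def)
  also have "\<dots> = (\<Sum>j\<le>t. kinner V ((T ^^ (s + j)) f) ((T ^^ (s + j)) f))"
    by (subst sum.swap) (simp add: kinner_def power2_eq_square)
  also have "\<dots> \<le> (\<Sum>j\<le>t. (l\<^sup>2) ^ (s + j) * N)"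
    using l2_decay[OF l(1,2) f(1,2)] ff l2
    by (intro sum_mono) (meson mult_left_mono order_trans zero_le_power)
  also have "\<dots> = (l\<^sup>2) ^ s * N * (\<Sum>j\<le>t. (l\<^sup>2) ^ j)"
    by (simp add: sum_distrib_left power_add mult_ac)
  also have "\<dots> \<le> (l\<^sup>2) ^ s * N * (1 / (1 - l\<^sup>2))"
  proof (rule mult_left_mono)
    have "(\<Sum>j\<le>t. (l\<^sup>2) ^ j) = (1 - (l\<^sup>2) ^ Suc t) / (1 - l\<^sup>2)"
      using l2 by (simp add: sum_gp0)
    also have "\<dots> \<le> 1 / (1 - l\<^sup>2)" using l2 by (intro divide_right_mono) auto
    finally show "(\<Sum>j\<le>t. (l\<^sup>2) ^ j) \<le> 1 / (1 - l\<^sup>2)" .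
  qed (use l2 in auto)
  finally show ?thesis using \<eta> l2 unfolding B_def[symmetric] by (simp add: field_simps)
qed

text \<open>Split off the mean of \<open>g\<close>: the constant part is fixed by the kernel and
  contributes exactly the second term, the rest sees only the nontrivial spectrum, and the cross
  terms vanish.\<close>

lemma kinner_nb_le:
  assumes M: "\<And>z. lo \<le> z \<Longrightarrow> z \<le> hi \<Longrightarrow> geronimus d k z \<le> M" "0 \<le> M" and g: "supp_in V g"
  shows "kinner V (kapply V (nb k) g) g \<le> M * kinner V g g + (\<Sum>x\<in>V. g x)\<^sup>2 / N"
proof -
  interpret nb: sym_kernel V "nb k" by (rule sym_kernel_nb)
  define c where "c = (\<Sum>x\<in>V. g x) / N"
  define h where "h = (\<lambda>x. g x - c * ind V x)"
  have ii: "kinner V f (ind V) = (\<Sum>x\<in>V. f x)" for f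
    by (simp add: kinner_def ind_def)
  have nbi: "kapply V (nb k) (ind V) = ind V"
    using kapply_nb_eigen[OF eigenfun_ind, of k] by (simp add: geronimus_1)
  have cN: "c * N = (\<Sum>x\<in>V. g x)" using N_pos by (simp add: c_def)
  have h0: "(\<Sum>x\<in>V. h x) = 0"
    using cN by (simp add: h_def sum_subtractf ind_def mult.commute)
  have h: "supp_in V h" using g by (auto simp: h_def supp_in_def ind_def)
  have gh: "g = (\<lambda>x. h x + c * ind V x)" by (simp add: h_def)
  have "kinner V (kapply V (nb k) h) h \<le> M * kinner V h h"
  proof (rule P.quadratic_form_le[OF h, where q = "geronimus d k"])
    fix z g assume "P.eigenfun z g" "kinner V g g > 0" "kinner V g h = kinner V g g"
    then show "geronimus d k z \<le> M" using mean_zero_component h0 M(1) by blast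
  qed (auto simp: kapply_sum kapply_nb_eigen)
  moreover have "kinner V (kapply V (nb k) h) (ind V) = 0"
    using h0 nb.kinner_kapply[of h "ind V"] unfolding nbi ii by simp
  moreover have "kinner V (ind V) h = 0" using h0 ii[of h] by (simp add: kinner_commute)
  moreover have "kinner V (ind V) (ind V) = N" by (simp add: ii) (simp add: ind_def)
  moreover have "kinner V h (ind V) = 0" using h0 ii by simp
  ultimately have "kinner V (kapply V (nb k) g) g \<le> M * kinner V h h + c * c * N"
    and hh: "kinner V g g = kinner V h h + c * c * N"
    unfolding gh kapply_add kapply_scale nbi
    by (simp_all add: kinner_add_left kinner_commute[of V _ "\<lambda>x. h x + c * ind V x"] kinner_scale_left kinner_commute[of V h "kapply V (nb k) h"] kinner_commute[of V "ind V" "kapply V (nb k) h"])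
  moreover have "M * kinner V h h \<le> M * kinner V g g"
    using M(2) N_pos by (intro mult_left_mono) (auto simp: hh)
  moreover have "c * c * N = (\<Sum>x\<in>V. g x)\<^sup>2 / N"
    using N_pos by (simp add: c_def power2_eq_square)
  ultimately show ?thesis by linarith
qed

text \<open>For a function living on \<open>B\<close>, Cauchy-Schwarz bounds the mean term of the
  quadratic form by the density of \<open>B\<close> times the squared norm.\<close>

lemma funpow_nb_restrict_le:
  assumes M: "\<And>z. lo \<le> z \<Longrightarrow> z \<le> hi \<Longrightarrow> geronimus d k z \<le> M" "0 \<le> M"
    and B: "B \<subseteq> V" "card B \<le> \<beta> * N" and y: "y \<in> V"
  shows "(kapply V (nb_restrict B k) ^^ m) (ind B) y \<le> (M + \<beta>) ^ m * sqrt N"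
proof -
  interpret K: sym_kernel V "nb_restrict B k" by (rule sym_kernel_nb_restrict)
  have finB: "finite B" using B finV finite_subset by auto
  have \<beta>: "0 \<le> \<beta>" using B(2) N_pos by (smt (verit) of_nat_0_le_iff zero_le_mult_iff)
  have "\<bar>(kapply V (nb_restrict B k) ^^ m) (ind B) y\<bar> \<le> (M + \<beta>) ^ m * sqrt (kinner V (ind B) (ind B))"
  proof (rule K.abs_funpow_le)
    fix g assume g: "supp_in V g"
    define h where "h = (\<lambda>x. ind B x * g x)"
    have h: "supp_in V h" using g by (auto simp: h_def supp_in_def)
    have hB: "(\<Sum>x\<in>V. F (h x)) = (\<Sum>x\<in>B. F (h x))" if "F 0 = 0" for F :: "real \<Rightarrow> real"
      by (rule sum.mono_neutral_right) (use finV B that in \<open>auto simp: h_def ind_def\<close>)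
    have hh: "kinner V h h = (\<Sum>x\<in>B. h x * h x)"
      using hB[of "\<lambda>u. u * u"] by (simp add: kinner_def)
    have "kinner V (kapply V (nb_restrict B k) g) g = kinner V (kapply V (nb k) h) h"
      by (simp add: kapply_nb_restrict kinner_def h_def mult_ac)
    also have "\<dots> \<le> M * kinner V h h + (\<Sum>x\<in>V. h x)\<^sup>2 / N"
      by (rule kinner_nb_le[OF M h])
    also have "(\<Sum>x\<in>V. h x)\<^sup>2 \<le> card B * kinner V h h"
      unfolding hB[of "\<lambda>u. u", simplified] hh by (rule sum_squared_le_card_mult[OF finB])
    also have "card B * kinner V h h \<le> \<beta> * N * kinner V h h"
      by (rule mult_right_mono[OF B(2) kinner_nonneg])
    finally have "kinner V (kapply V (nb_restrict B k) g) g \<le> M * kinner V h h + \<beta> * kinner V h h"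
      using N_pos V_ne by (simp add: divide_right_mono)
    also have "\<dots> = (M + \<beta>) * kinner V h h" by (simp add: algebra_simps)
    also have "\<dots> \<le> (M + \<beta>) * kinner V g g"
      using M(2) \<beta> unfolding kinner_def
      by (intro mult_left_mono sum_mono) (auto simp: h_def ind_def)
    finally show "kinner V (kapply V (nb_restrict B k) g) g \<le> (M + \<beta>) * kinner V g g" .
  qed (use nb_restrict_nonneg B M(2) \<beta> y in \<open>auto simp: supp_in_def ind_def\<close>)
  also have "\<dots> \<le> (M + \<beta>) ^ m * sqrt N"
  proof (intro mult_left_mono real_sqrt_le_mono)
    have "kinner V (ind B) (ind B) \<le> (\<Sum>x\<in>V. 1)" unfolding kinner_def
      by (intro sum_mono) (auto simp: ind_def)
    then show "kinner V (ind B) (ind B) \<le> N" by simp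
  qed (use M(2) \<beta> in auto)
  finally show ?thesis by simp
qed

context
  fixes l \<eta> \<beta> :: real and s :: nat and f :: "'a \<Rightarrow> real"
  assumes l: "- l \<le> lo" "hi \<le> l" "0 \<le> l" "l < 1" and \<eta>: "0 < \<eta>"
    and \<beta>: "(l\<^sup>2) ^ s / (\<eta>\<^sup>2 * (1 - l\<^sup>2)) \<le> \<beta>"
    and f: "supp_in V f" "(\<Sum>x\<in>V. f x) = 0" "\<And>x. x \<in> V \<Longrightarrow> \<bar>f x\<bar> \<le> 1"
begin

text \<open>\<open>B\<close> depends on \<open>f\<close> and on \<open>t\<close>, but its density
  bound \<beta> does not.\<close>

lemma exists_rare_set:
  obtains B where "B \<subseteq> V" "card B \<le> \<beta> * N"
    "\<And>x. x \<in> V \<Longrightarrow> \<bar>(T ^^ (s + t)) f x\<bar> \<le> \<eta> + killed B t x"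
proof
  define B where "B = {y\<in>V. \<exists>j\<le>t. \<eta> < \<bar>(T ^^ (s + j)) f y\<bar>}"
  show "B \<subseteq> V" by (auto simp: B_def)
  have "card B \<le> (l\<^sup>2) ^ s / (\<eta>\<^sup>2 * (1 - l\<^sup>2)) * N"
    unfolding B_def by (rule card_large_le[OF l f \<eta>])
  also have "\<dots> \<le> \<beta> * N" using \<beta> by (intro mult_right_mono) auto
  finally show "card B \<le> \<beta> * N" .
  show "\<bar>(T ^^ (s + t)) f x\<bar> \<le> \<eta> + killed B t x" if "x \<in> V" for x
    by (rule abs_funpow_le_killed[where t = t])
      (use f \<eta> that in \<open>auto simp: B_def not_less\<close>)
qed

lemma abs_funpow_upper:
  assumes "x \<in> V" "0 < k" "1 \<le> w" "\<phi> = (w + (real d - 1) / w) / real d"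
    and M: "\<And>z. lo \<le> z \<Longrightarrow> z \<le> hi \<Longrightarrow> geronimus d k z \<le> M" "0 \<le> M"
  shows "\<bar>(T ^^ (s + t)) f x\<bar> \<le> \<eta> + (w ^ (k * Suc m) * \<phi> ^ t + (M + \<beta>) ^ m * sqrt N)"
proof -
  obtain B where B: "B \<subseteq> V" "card B \<le> \<beta> * N"
    "\<And>x. x \<in> V \<Longrightarrow> \<bar>(T ^^ (s + t)) f x\<bar> \<le> \<eta> + killed B t x"
    using exists_rare_set[where t = t] by blast
  have "killed B t x \<le> w ^ (k * Suc m) * \<phi> ^ t + (M + \<beta>) ^ m * sqrt N"
    by (rule killed_le) (use assms B funpow_nb_restrict_le[OF M B(1,2)] in auto)
  then show ?thesis using B(3)[OF assms(1)] by linarith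
qed

lemma abs_funpow_upper_direct:
  assumes "x \<in> V" "hi \<le> M" "0 \<le> M"
  shows "\<bar>(T ^^ (s + t)) f x\<bar> \<le> \<eta> + (M + \<beta>) ^ t * sqrt N"
proof -
  obtain B where B: "B \<subseteq> V" "card B \<le> \<beta> * N"
    "\<And>x. x \<in> V \<Longrightarrow> \<bar>(T ^^ (s + t)) f x\<bar> \<le> \<eta> + killed B t x"
    using exists_rare_set[where t = t] by blast
  have "killed B t x \<le> (M + \<beta>) ^ t * sqrt N"
    unfolding killed_eq_funpow by (rule funpow_nb_restrict_le) (use assms B in auto)
  then show ?thesis using B(3)[OF assms(1)] by linarith
qed

end

end

section \<open>Total variation distance\<close>

text \<open>Equal total masses force the positive and negative parts of \<mu> - \<nu> to have equal
  sums, so each carries half of the l1 norm.\<close>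

lemma tv_dist_balanced:
  assumes "finite V" "(\<Sum>y\<in>V. \<mu> y) = (\<Sum>y\<in>V. \<nu> y)"
  shows "C \<subseteq> V \<Longrightarrow> (\<Sum>y\<in>C. \<nu> y - \<mu> y) \<le> tv_dist V \<mu> \<nu>"
    and "tv_dist V \<mu> \<nu> = (\<Sum>y\<in>{y\<in>V. \<nu> y \<le> \<mu> y}. \<mu> y - \<nu> y)"
proof -
  have split: "(\<Sum>y\<in>V. h y) = (\<Sum>y\<in>C. h y) + (\<Sum>y\<in>V - C. h y)" if "C \<subseteq> V" for C and h :: "_ \<Rightarrow> real"
    using sum.subset_diff[OF that assms(1), of h] by simp
  have zero: "(\<Sum>y\<in>V. \<mu> y - \<nu> y) = 0" using assms(2) by (simp add: sum_subtractf)
  show "(\<Sum>y\<in>C. \<nu> y - \<mu> y) \<le> tv_dist V \<mu> \<nu>" if C: "C \<subseteq> V"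
  proof -
    have "(\<Sum>y\<in>C. \<nu> y - \<mu> y) = (\<Sum>y\<in>V - C. \<mu> y - \<nu> y)"
      using zero split[OF C, of "\<lambda>y. \<mu> y - \<nu> y"] by (simp add: sum_subtractf)
    moreover have "(\<Sum>y\<in>C. \<nu> y - \<mu> y) \<le> (\<Sum>y\<in>C. \<bar>\<mu> y - \<nu> y\<bar>)" by (intro sum_mono) auto
    moreover have "(\<Sum>y\<in>V - C. \<mu> y - \<nu> y) \<le> (\<Sum>y\<in>V - C. \<bar>\<mu> y - \<nu> y\<bar>)" by (intro sum_mono) auto
    ultimately show ?thesis using split[OF C, of "\<lambda>y. \<bar>\<mu> y - \<nu> y\<bar>"] by (simp add: tv_dist_def)
  qed
  define A where "A = {y\<in>V. \<nu> y \<le> \<mu> y}"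
  have A: "A \<subseteq> V" by (auto simp: A_def)
  have "(\<Sum>y\<in>A. \<bar>\<mu> y - \<nu> y\<bar>) = (\<Sum>y\<in>A. \<mu> y - \<nu> y)"
    by (intro sum.cong) (auto simp: A_def)
  moreover have "(\<Sum>y\<in>V - A. \<bar>\<mu> y - \<nu> y\<bar>) = - (\<Sum>y\<in>V - A. \<mu> y - \<nu> y)"
    unfolding sum_negf[symmetric] by (intro sum.cong) (auto simp: A_def)
  ultimately show "tv_dist V \<mu> \<nu> = (\<Sum>y\<in>A. \<mu> y - \<nu> y)"
    using zero split[OF A, of "\<lambda>y. \<mu> y - \<nu> y"] split[OF A, of "\<lambda>y. \<bar>\<mu> y - \<nu> y\<bar>"]
    by (simp add: tv_dist_def)
qed

context regular_walk
begin

text \<open>Duality between laws evolving forwards and functions evolving backwards. The induction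
  varies \<open>f\<close> so that it can absorb the last step.\<close>

lemma sum_law: "x \<in> V \<Longrightarrow> (\<Sum>y\<in>V. law V P x t y * f y) = (T ^^ t) f x"
proof (induction t arbitrary: f)
  case 0
  then show ?case using finV by (simp add: if_distrib[of "\<lambda>c. c * _"] cong: if_cong)
next
  case (Suc t)
  have "(\<Sum>y\<in>V. law V P x (Suc t) y * f y) = (\<Sum>y\<in>V. \<Sum>z\<in>V. law V P x t z * (P z y * f y))"
    by (simp add: sum_distrib_right mult.assoc)
  also have "\<dots> = (\<Sum>z\<in>V. \<Sum>y\<in>V. law V P x t z * (P z y * f y))" by (rule sum.swap)
  also have "\<dots> = (\<Sum>z\<in>V. law V P x t z * T f z)"
    by (intro sum.cong) (auto simp: kapply_def sum_distrib_left)
  also have "\<dots> = (T ^^ t) (T f) x" using Suc by simp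
  finally show ?case by (simp add: funpow_swap1)
qed

lemma sum_law_1: "x \<in> V \<Longrightarrow> (\<Sum>y\<in>V. law V P x t y) = 1"
  using sum_law[of x t "ind V"] funpow_kapply_eigen[of V P "ind V" 1 t] eigenfun_ind
  by (simp add: P.eigenfun_def) (simp add: ind_def)

abbreviation unif :: "'a \<Rightarrow> real" where
  "unif \<equiv> (\<lambda>_. 1 / real (card V))"

lemma sum_unif: "(\<Sum>y\<in>V. unif y) = 1"
  using V_ne finV by simp

text \<open>The distance is attained on the set where the law exceeds the uniform one. Its indicator
  minus its density is a test function of mean zero bounded by 1.\<close>

lemma tv_dist_law_upper:
  assumes x: "x \<in> V"
    and bound: "\<And>f. supp_in V f \<Longrightarrow> (\<Sum>y\<in>V. f y) = 0 \<Longrightarrow> (\<And>y. y \<in> V \<Longrightarrow> \<bar>f y\<bar> \<le> 1) \<Longrightarrow> (T ^^ t) f x \<le> c"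
  shows "tv_dist V (law V P x t) unif \<le> c"
proof -
  let ?\<mu> = "law V P x t"
  define A where "A = {y\<in>V. unif y \<le> ?\<mu> y}"
  define p where "p = card A / card V"
  define f where "f = (\<lambda>y. ind A y - p * ind V y)"
  have A: "A \<subseteq> V" by (auto simp: A_def)
  have cV: "card V > 0" using finV V_ne by (simp add: card_gt_0_iff)
  have p: "0 \<le> p" "p \<le> 1" using card_mono[OF finV A] cV by (auto simp: p_def)
  have sumA: "(\<Sum>y\<in>V. g y * ind A y) = (\<Sum>y\<in>A. g y)" for g
    using finV A by (intro sum.mono_neutral_cong_right) (auto simp: ind_def)
  have "(T ^^ t) f x \<le> c"
  proof (rule bound)
    show "supp_in V f" using A by (auto simp: supp_in_def f_def ind_def)
    show "\<bar>f y\<bar> \<le> 1" if "y \<in> V" for y using p by (auto simp: f_def ind_def)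
    have "(\<Sum>y\<in>V. f y) = real (card A) - p * card V"
      using sumA[of "\<lambda>_. 1"] by (simp add: f_def sum_subtractf sum_distrib_left[symmetric]) (simp add: ind_def)
    then show "(\<Sum>y\<in>V. f y) = 0" using cV V_ne by (simp add: p_def)
  qed
  moreover have "(T ^^ t) f x = tv_dist V ?\<mu> unif"
  proof -
    have "(T ^^ t) f x = (\<Sum>y\<in>V. ?\<mu> y * ind A y) - p * (\<Sum>y\<in>V. ?\<mu> y * ind V y)"
      unfolding sum_law[OF x, symmetric] f_def by (simp add: algebra_simps sum_subtractf sum_distrib_left)
    also have "(\<Sum>y\<in>V. ?\<mu> y * ind V y) = 1" using sum_law_1[OF x, of t] by (simp add: ind_def)
    also have "(\<Sum>y\<in>V. ?\<mu> y * ind A y) - p * 1 = (\<Sum>y\<in>A. ?\<mu> y - unif y)"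
      by (simp add: sumA sum_subtractf p_def)
    also have "\<dots> = tv_dist V ?\<mu> unif"
      using tv_dist_balanced(2)[OF finV, of ?\<mu> unif] sum_law_1[OF x, of t] sum_unif by (simp add: A_def)
    finally show ?thesis .
  qed
  ultimately show ?thesis by simp
qed

lemma tv_dist_law_lower:
  assumes x: "x \<in> V" and S: "S \<subseteq> V"
  shows "1 - card S / card V - (T ^^ t) (ind (V - S)) x \<le> tv_dist V (law V P x t) unif"
proof -
  have cV: "card V > 0" using finV V_ne by (simp add: card_gt_0_iff)
  have "(\<Sum>y\<in>V - S. unif y - law V P x t y) \<le> tv_dist V (law V P x t) unif"
    by (rule tv_dist_balanced(1)[OF finV]) (use sum_law_1[OF x, of t] sum_unif in auto)
  moreover have "(\<Sum>y\<in>V - S. unif y) = 1 - card S / card V"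
    using finV V_ne S cV card_mono[OF finV S] by (simp add: card_Diff_subset finite_subset of_nat_diff diff_divide_distrib)
  moreover have "(\<Sum>y\<in>V - S. law V P x t y) = (T ^^ t) (ind (V - S)) x"
    unfolding sum_law[OF x, symmetric] using finV
    by (intro sum.mono_neutral_cong_left) (auto simp: ind_def)
  ultimately show ?thesis by (simp add: sum_subtractf)
qed

lemma law_nonneg: "0 \<le> law V P x t y"
  by (induction t arbitrary: y) (auto intro!: sum_nonneg mult_nonneg_nonneg P_nonneg)

lemma law_0_or_ge: "law V P x t y = 0 \<or> 1 / real d ^ t \<le> law V P x t y"
proof (induction t arbitrary: y)
  case (Suc t)
  have "law V P x t z * P z y = 0 \<or> 1 / real d ^ Suc t \<le> law V P x t z * P z y" for z
  proof -
    have "P z y = 0 \<or> P z y = 1 / real d" by (simp add: P_def)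
    then show ?thesis
      using Suc[of z] mult_right_mono[of "1 / real d ^ t" "law V P x t z" "1 / real d"]
      by (auto simp: mult.commute)
  qed
  then show ?case unfolding law.simps using finV by (intro sum_eq_0_or_ge) auto
qed auto

lemma tv_dist_law_lower_volume:
  assumes x: "x \<in> V"
  shows "1 - real d ^ t / card V \<le> tv_dist V (law V P x t) unif"
proof -
  define S where "S = {y\<in>V. law V P x t y \<noteq> 0}"
  have S: "S \<subseteq> V" by (auto simp: S_def)
  have "card S * (1 / real d ^ t) \<le> (\<Sum>y\<in>S. law V P x t y)"
    by (rule sum_bounded_below) (use law_0_or_ge[of x t] in \<open>auto simp: S_def\<close>)
  also have "\<dots> \<le> (\<Sum>y\<in>V. law V P x t y)" by (rule sum_mono2[OF finV S]) (rule law_nonneg)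
  also have "\<dots> = 1" by (rule sum_law_1[OF x])
  finally have "card S \<le> real d ^ t" using d2 by (simp add: field_simps)
  moreover have "(T ^^ t) (ind (V - S)) x = 0"
    unfolding sum_law[OF x, symmetric] by (rule sum.neutral) (auto simp: ind_def S_def)
  ultimately show ?thesis using tv_dist_law_lower[OF x S, of t]
    by (smt (verit) divide_right_mono of_nat_0_le_iff)
qed

text \<open>The test set consists of the end points of non-backtracking walks of length at most
  \<open>r\<close>. A geometric series of ratio at least 2 bounds its size; the numerator 2 in the
  last term is the value of w^j + (d-1)^(-j) at level 0.\<close>

lemma tv_dist_law_lower_tree:
  assumes x: "x \<in> V" and d3: "3 \<le> d" and w: "1 \<le> w" and \<psi>: "\<psi> = ((real d - 1) * w + 1 / w) / real d"
  shows "1 - 4 * (real d - 1) ^ r / card V - 2 * \<psi> ^ t / w ^ r \<le> tv_dist V (law V P x t) unif"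
proof -
  define S where "S = (\<Union>j\<in>{..r}. {z\<in>V. nb j x z \<noteq> 0})"
  have S: "S \<subseteq> V" by (auto simp: S_def)
  have "real (card S) \<le> (\<Sum>j\<le>r. real (card {z\<in>V. nb j x z \<noteq> 0}))"
    unfolding S_def of_nat_sum[symmetric] of_nat_le_iff by (rule card_UN_le) simp
  also have "\<dots> \<le> (\<Sum>j\<le>r. 2 * (real d - 1) ^ j)"
    by (intro sum_mono card_nb_support x)
  also have "\<dots> \<le> 4 * (real d - 1) ^ r"
  proof (induction r)
    case (Suc r)
    have "2 * (real d - 1) ^ r \<le> (real d - 1) * (real d - 1) ^ r"
      using d3 by (intro mult_right_mono) auto
    then show ?case using Suc by simp
  qed simp
  finally have cS: "card S \<le> 4 * (real d - 1) ^ r" .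
  have "w ^ r * kapply V (nb 0) ((T ^^ t) (ind (V - S))) x \<le> \<psi> ^ t * (w ^ 0 + 1 / (real d - 1) ^ 0)"
  proof (rule nb_funpow_far[OF d3 w \<psi> x])
    show "kapply V (nb j) (ind (V - S)) x = 0" if "j \<le> r" for j
      using that by (auto simp: kapply_def ind_def S_def intro!: sum.neutral)
  qed (simp add: ind_def)
  then have "(T ^^ t) (ind (V - S)) x \<le> 2 * \<psi> ^ t / w ^ r"
    using x w by (simp add: kapply_nb_0 field_simps)
  moreover have "card S / card V \<le> 4 * (real d - 1) ^ r / card V"
    using cS by (rule divide_right_mono) simp
  ultimately show ?thesis using tv_dist_law_lower[OF x S, of t] by linarith
qed

text \<open>The Dirichlet form controls the eigenvalue \<open>1\<close> for \<open>\<sigma> = 1\<close> and \<open>-1\<close> for \<open>\<sigma> = -1\<close>.\<close>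

lemma dirichlet_form:
  assumes "\<sigma>\<^sup>2 = 1"
  shows "(\<Sum>x\<in>V. \<Sum>y\<in>V. P x y * (g x - \<sigma> * g y)\<^sup>2) = 2 * kinner V g g - 2 * \<sigma> * kinner V (T g) g"
proof -
  have eq: "P x y * (g x - \<sigma> * g y)\<^sup>2 = P x y * (g x * g x) + P x y * (g y * g y) - 2 * \<sigma> * (P x y * g y * g x)" for x y
  proof -
    have "(g x - \<sigma> * g y)\<^sup>2 = g x * g x + \<sigma>\<^sup>2 * (g y * g y) - 2 * \<sigma> * (g y * g x)"
      by (simp add: power2_eq_square algebra_simps)
    then show ?thesis by (simp only: assms) (simp add: algebra_simps)
  qed
  have 1: "(\<Sum>x\<in>V. \<Sum>y\<in>V. P x y * (g x * g x)) = kinner V g g"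
    by (simp add: sum_distrib_right[symmetric] P_row kinner_def)
  have "(\<Sum>x\<in>V. \<Sum>y\<in>V. P x y * (g y * g y)) = (\<Sum>y\<in>V. \<Sum>x\<in>V. P x y * (g y * g y))"
    by (rule sum.swap)
  also have "\<dots> = (\<Sum>y\<in>V. \<Sum>x\<in>V. P y x * (g y * g y))"
    by (intro sum.cong) (auto simp: P.K_sym)
  finally have 2: "(\<Sum>x\<in>V. \<Sum>y\<in>V. P x y * (g y * g y)) = kinner V g g" using 1 by simp
  have 3: "(\<Sum>x\<in>V. \<Sum>y\<in>V. P x y * g y * g x) = kinner V (T g) g"
    by (simp add: kinner_def kapply_def sum_distrib_right)
  show ?thesis unfolding eq sum.distrib sum_subtractf 1 2 sum_distrib_left[symmetric] 3 by simp
qed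

lemma eigenvalue_le_1:
  assumes "P.eigenfun z g" "kinner V g g > 0"
  shows "z \<le> 1"
proof -
  have "0 \<le> (\<Sum>x\<in>V. \<Sum>y\<in>V. P x y * (g x - 1 * g y)\<^sup>2)"
    by (intro sum_nonneg mult_nonneg_nonneg P_nonneg) auto
  then have "0 \<le> 2 * (1 - z) * kinner V g g"
    using assms by (subst (asm) dirichlet_form) (auto simp: P.eigenfun_def kinner_scale_left algebra_simps)
  then show ?thesis using assms(2) by (simp add: zero_le_mult_iff)
qed

text \<open>The Dirichlet form of such a function is 0, and so is its contribution from every single
  edge.\<close>

lemma extremal_eigenfun:
  assumes g: "P.eigenfun \<sigma> g" and \<sigma>: "\<sigma>\<^sup>2 = 1" and E: "E x y"
  shows "g x = \<sigma> * g y"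
proof -
  have nn: "0 \<le> P x y * (g x - \<sigma> * g y)\<^sup>2" for x y by (simp add: P_nonneg)
  have "(\<Sum>x\<in>V. \<Sum>y\<in>V. P x y * (g x - \<sigma> * g y)\<^sup>2) = 2 * kinner V g g - 2 * \<sigma>\<^sup>2 * kinner V g g"
    using g by (subst dirichlet_form[OF \<sigma>]) (simp add: P.eigenfun_def kinner_scale_left power2_eq_square)
  then have "(\<Sum>x\<in>V. \<Sum>y\<in>V. P x y * (g x - \<sigma> * g y)\<^sup>2) = 0" by (simp add: \<sigma>)
  then have "\<forall>x\<in>V. \<forall>y\<in>V. P x y * (g x - \<sigma> * g y)\<^sup>2 = 0"
    using finV nn by (simp add: sum_nonneg_eq_0_iff sum_nonneg)
  then have "P x y * (g x - \<sigma> * g y)\<^sup>2 = 0" using E_V[OF E] by blast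
  then show ?thesis using E d2 by (simp add: P_def)
qed

end

section \<open>Simple random walk on a graph\<close>

text \<open>The bridge from functions to characteristic polynomials: it carries bounds on the listed
  eigenvalues over to every eigenfunction.\<close>

lemma (in sym_kernel) eigenfun_imp_mem_eigenvalues:
  assumes g: "eigenfun z g" "kinner V g g > 0"
  shows "z \<in> set (eigenvalues V K)"
proof -
  define xs where "xs = (SOME xs. distinct xs \<and> set xs = V)"
  have xs: "distinct xs" "set xs = V"
    using someI_ex[of "\<lambda>xs. distinct xs \<and> set xs = V"] finite_distinct_list[OF finite_V]
    by (auto simp: xs_def)
  define n where "n = length xs"
  define A where "A = transition_mat V K"
  have A_def': "A = mat n n (\<lambda>(i, j). K (xs ! i) (xs ! j))"
    by (simp add: A_def transition_mat_def xs_def[symmetric] n_def Let_def)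
  then have A: "A \<in> carrier_mat n n" by simp
  define v where "v = vec n (\<lambda>i. g (xs ! i))"
  have xsV: "xs ! i \<in> V" if "i < n" for i using that xs(2) by (auto simp: n_def)
  have sumV: "(\<Sum>j=0..<n. h (xs ! j)) = (\<Sum>y\<in>V. h y)" for h :: "'a \<Rightarrow> real"
    using sum.reindex_bij_betw[OF bij_betw_nth[OF xs(1) refl refl], of h] xs(2)
    by (simp add: n_def atLeast0LessThan)
  have "eigenvector A v z"
    unfolding eigenvector_def
  proof (intro conjI)
    show "v \<in> carrier_vec (dim_row A)" using A by (simp add: v_def)
    show "A *\<^sub>v v = z \<cdot>\<^sub>v v"
    proof (rule eq_vecI)
      fix i assume "i < dim_vec (z \<cdot>\<^sub>v v)"
      then have i: "i < n" by (simp add: v_def)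
      have "(A *\<^sub>v v) $ i = (\<Sum>j=0..<n. K (xs ! i) (xs ! j) * g (xs ! j))"
        using i by (simp add: A_def' v_def scalar_prod_def)
      also have "\<dots> = kapply V K g (xs ! i)"
        using xsV[OF i] sumV[of "\<lambda>y. K (xs ! i) y * g y"] by (simp add: kapply_def)
      finally show "(A *\<^sub>v v) $ i = (z \<cdot>\<^sub>v v) $ i"
        using g(1) i by (simp add: eigenfun_def v_def)
    qed (simp add: A_def' v_def)
    show "v \<noteq> 0\<^sub>v (dim_row A)"
    proof
      assume v0: "v = 0\<^sub>v (dim_row A)"
      have "g (xs ! i) = 0" if "i < n" for i
      proof -
        have "v $ i = 0" unfolding v0 using that A by simp
        then show ?thesis using that by (simp add: v_def)
      qed
      then have "kinner V g g = 0"
        unfolding kinner_def sumV[symmetric] by simp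
      then show False using g(2) by simp
    qed
  qed
  then have "eigenvalue A z" unfolding eigenvalue_def by blast
  then have "poly (char_poly A) z = 0" using eigenvalue_root_char_poly[OF A] by simp
  moreover have "char_poly A \<noteq> 0" using degree_monic_char_poly[OF A] by auto
  ultimately show ?thesis by (simp add: eigenvalues_def A_def[symmetric])
qed

text \<open>A member below another member cannot stand at index 0. With 1 as the larger one, every
  eigenvalue below 1 is at most the second in the list.\<close>

lemma le_nth_1_of_sorted:
  fixes xs :: "real list"
  assumes "sorted (rev xs)" "z \<in> set xs" "u \<in> set xs" "z < u"
  shows "z \<le> xs ! 1"
proof -
  obtain i where i: "i < length xs" "xs ! i = z" using assms(2) by (metis in_set_conv_nth)
  have mono: "xs ! b \<le> xs ! a" if "a \<le> b" "b < length xs" for a b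
    using sorted_rev_nth_mono[OF assms(1) that] .
  have "i \<noteq> 0"
  proof
    assume "i = 0"
    then have "u \<le> z" using mono[of 0] assms(3) i by (metis in_set_conv_nth le0)
    then show False using assms(4) by simp
  qed
  then show ?thesis using mono[of 1 i] i by simp
qed

text \<open>The minimum defining the lower end skips -1, so it bounds the spectrum only once -1 is
  excluded. An eigenfunction for -1 changes sign along every edge, which contradicts
  non-bipartiteness.\<close>

lemma srw_gapped_walk:
  assumes G: "regular_graph d G" and d: "3 \<le> d" and conn: "Digraph_Component.connected (with_proj G)"
    and nb: "\<not> bipartite G"
  shows "regular_walk.P (\<lambda>x y. (x, y) \<in> parcs G) d = srw G" (is ?P)
    and "gapped_walk (pverts G) (\<lambda>x y. (x, y) \<in> parcs G) d
      (Min {l \<in> set (srw_eigenvalues G). l \<noteq> -1}) (srw_eigenvalues G ! 1)" (is ?gap)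
proof -
  define V where "V = pverts G"
  define E where "E = (\<lambda>x y. (x, y) \<in> parcs G)"
  interpret G: pair_graph G using G by (simp add: regular_graph_def)
  have outdeg: "out_degree (with_proj G) x = card {y. E x y}" for x
  proof -
    have "out_arcs (with_proj G) x = Pair x ` {y. E x y}"
      by (auto simp: out_arcs_def E_def)
    then show ?thesis by (simp add: out_degree_def card_image inj_on_def)
  qed
  \<comment> \<open>Connectedness speaks of the symmetric closure, so paths may a priori use
    reversed arcs; \<open>propagate\<close> removes these by symmetry.\<close>
  have reach: "x \<rightarrow>\<^sup>*\<^bsub>with_proj (mk_symmetric (with_proj G))\<^esub> y" if "x \<in> V" "y \<in> V" for x y
    using conn that by (auto simp: connected_def strongly_connected_def V_def)
  have sym: "E y x" if "E x y" for x y
    using G.graph_symmetric that by (auto simp: E_def)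
  interpret W: regular_walk V E d
  proof
    show "V \<noteq> {}" using conn by (auto simp: connected_def strongly_connected_def V_def)
    show "card {y. E x y} = d" if "x \<in> V" for x
      using G that by (simp add: regular_graph_def V_def outdeg[symmetric])
    show "x \<in> V \<and> y \<in> V" if "E x y" for x y
      using G.in_arcsD1 G.in_arcsD2 that by (auto simp: V_def E_def)
  qed (use G.pair_finite_verts d sym in \<open>auto simp: V_def\<close>)
  have wf: "wf_digraph (with_proj (mk_symmetric (with_proj G)))"
    using G.wellformed_mk_symmetric by (simp add: wf_digraph_wp_iff)
  have propagate: "Q y" if "x \<in> V" "y \<in> V" "Q x" "\<And>a b. E a b \<Longrightarrow> Q a \<Longrightarrow> Q b" for Q x y
    using reach[OF that(1,2)]
  proof (induction rule: wf_digraph.reachable_induct[OF wf, consumes 1, case_names base step])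
    case (step a b)
    then have "E a b \<or> E b a" by (auto simp: parcs_mk_symmetric E_def)
    then show ?case using sym that(4) step.IH by blast
  qed (rule that(3))
  have PG: "W.P = srw G"
  proof (intro ext)
    fix x y
    have "(x, y) \<in> parcs G \<longleftrightarrow> E x y" by (simp add: E_def)
    then show "W.P x y = srw G x y"
      using W.deg[of x] W.E_V[of x y] by (auto simp: W.P_def srw_def outdeg)
  qed
  then show ?P by (simp add: E_def)
  have ev: "z \<in> set (srw_eigenvalues G)" if "W.P.eigenfun z g" "kinner V g g > 0" for z g
    using W.P.eigenfun_imp_mem_eigenvalues[OF that] by (simp add: srw_eigenvalues_def PG V_def)
  have "kinner V (ind V) (ind V) > 0"
    using W.finV W.V_ne by (simp add: kinner_def ind_def card_gt_0_iff)
  then have ev1: "1 \<in> set (srw_eigenvalues G)" using ev W.eigenfun_ind by blast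
  have "gapped_walk V E d (Min {l \<in> set (srw_eigenvalues G). l \<noteq> -1}) (srw_eigenvalues G ! 1)"
  proof
    show "g x = g y" if "W.P.eigenfun 1 g" "x \<in> V" "y \<in> V" for g x y
      using propagate[of y x "\<lambda>u. g u = g y"] W.extremal_eigenfun[OF that(1)] that by fastforce
    show "Min {l \<in> set (srw_eigenvalues G). l \<noteq> -1} \<le> z \<and> z \<le> srw_eigenvalues G ! 1"
      if g: "W.P.eigenfun z g" "kinner V g g > 0" and z1: "z \<noteq> 1" for z g
    proof
      have "z \<noteq> -1"
      proof
        assume "z = -1"
        then have alt: "g b = - g a" if "E a b" for a b
          using W.extremal_eigenfun[of "-1" g a b] g(1) that by simp
        have "\<exists>x\<in>V. g x \<noteq> 0"
        proof (rule ccontr)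
          assume "\<not> (\<exists>x\<in>V. g x \<noteq> 0)"
          then have "kinner V g g = 0" by (simp add: kinner_def)
          then show False using g(2) by simp
        qed
        then obtain x where x: "x \<in> V" "g x \<noteq> 0" by blast
        have nz: "g y \<noteq> 0" if "y \<in> V" for y
          using propagate[of x y "\<lambda>u. g u \<noteq> 0"] alt x that by auto
        \<comment> \<open>The two sides are the sign classes of \<open>g\<close>, which has no zero
          because its modulus is constant along paths.\<close>
        have "bipartite G"
          unfolding bipartite_def
        proof (intro exI conjI)
          show "{y\<in>V. g y > 0} \<union> {y\<in>V. g y < 0} = pverts G" using nz by (force simp: V_def)
          show "{y\<in>V. g y > 0} \<inter> {y\<in>V. g y < 0} = {}" by auto
          show "\<forall>(x, y)\<in>parcs G. (x \<in> {y\<in>V. g y > 0} \<and> y \<in> {y\<in>V. g y < 0}) \<or>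
              (x \<in> {y\<in>V. g y < 0} \<and> y \<in> {y\<in>V. g y > 0})"
          proof (intro ballI, clarify)
            fix a b assume "(a, b) \<in> parcs G" and n: "\<not> (a \<in> {y\<in>V. g y < 0} \<and> b \<in> {y\<in>V. g y > 0})"
            then have ab: "E a b" by (simp add: E_def)
            have "a \<in> V" "b \<in> V" "g b = - g a" "g a \<noteq> 0"
              using W.E_V[OF ab] alt[OF ab] nz[of a] by auto
            then show "a \<in> {y\<in>V. g y > 0} \<and> b \<in> {y\<in>V. g y < 0}" using n by auto
          qed
        qed
        then show False using nb by simp
      qed
      then show "Min {l \<in> set (srw_eigenvalues G). l \<noteq> -1} \<le> z"
        using ev[OF g] by (intro Min_le) auto
      have "z < 1" using W.eigenvalue_le_1[OF g] z1 by simp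
      then show "z \<le> srw_eigenvalues G ! 1"
        using ev[OF g] ev1 by (intro le_nth_1_of_sorted[of _ _ 1]) (auto simp: srw_eigenvalues_def eigenvalues_def)
    qed
  qed
  then show ?gap by (simp add: V_def E_def)
qed

section \<open>Worst-case distance to stationarity of one graph\<close>

definition srw_tv :: "'a pair_pre_digraph \<Rightarrow> nat \<Rightarrow> real" where
  "srw_tv G t = Max ((\<lambda>x. tv_dist (pverts G) (law (pverts G) (srw G) x t)
     (\<lambda>_. 1 / real (card (pverts G)))) ` pverts G)"

lemma srw_t_mix_eq: "srw_t_mix G \<epsilon> = Inf {t. srw_tv G t \<le> \<epsilon>}"
  by (simp add: srw_t_mix_def t_mix_def srw_tv_def)

locale expander =
  fixes G :: "'a pair_pre_digraph" and d :: nat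
  assumes regular: "regular_graph d G" and d3: "3 \<le> d"
    and connected: "Digraph_Component.connected (with_proj G)"
    and non_bipartite: "\<not> bipartite G"
begin

abbreviation (input) lo where "lo \<equiv> Min {l \<in> set (srw_eigenvalues G). l \<noteq> -1}"
abbreviation (input) hi where "hi \<equiv> srw_eigenvalues G ! 1"

sublocale W: gapped_walk "pverts G" "\<lambda>x y. (x, y) \<in> parcs G" d lo hi
  rewrites P_eq: "regular_walk.P (\<lambda>x y. (x, y) \<in> parcs G) d = srw G"
  by (rule srw_gapped_walk[OF regular d3 connected non_bipartite])+

lemma srw_tv_le:
  assumes "\<And>x f. x \<in> pverts G \<Longrightarrow> supp_in (pverts G) f \<Longrightarrow> (\<Sum>y\<in>pverts G. f y) = 0 \<Longrightarrow>
      (\<And>y. y \<in> pverts G \<Longrightarrow> \<bar>f y\<bar> \<le> 1) \<Longrightarrow> \<bar>(kapply (pverts G) (srw G) ^^ t) f x\<bar> \<le> c"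
  shows "srw_tv G t \<le> c"
  unfolding srw_tv_def
proof (rule Max.boundedI)
  fix u assume "u \<in> (\<lambda>x. tv_dist (pverts G) (law (pverts G) (srw G) x t)
     (\<lambda>_. 1 / real (card (pverts G)))) ` pverts G"
  then obtain x where x: "x \<in> pverts G"
    "u = tv_dist (pverts G) (law (pverts G) (srw G) x t) (\<lambda>_. 1 / real (card (pverts G)))" by auto
  show "u \<le> c" unfolding x(2)
    by (rule W.tv_dist_law_upper[OF x(1)]) (use assms[OF x(1)] in \<open>meson abs_le_D1\<close>)
qed (use W.finV W.V_ne in auto)

lemma srw_tv_ge:
  assumes "\<And>x. x \<in> pverts G \<Longrightarrow> c \<le> tv_dist (pverts G) (law (pverts G) (srw G) x t) (\<lambda>_. 1 / real (card (pverts G)))"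
  shows "c \<le> srw_tv G t"
proof -
  obtain x where x: "x \<in> pverts G" using W.V_ne by auto
  have "tv_dist (pverts G) (law (pverts G) (srw G) x t) (\<lambda>_. 1 / real (card (pverts G))) \<le> srw_tv G t"
    unfolding srw_tv_def by (rule Max_ge) (use W.finV x in auto)
  then show ?thesis using assms[OF x] by simp
qed

lemma srw_tv_le_tree:
  assumes l: "- l \<le> lo" "hi \<le> l" "0 \<le> l" "l < 1" "0 < \<eta>"
    and \<beta>: "(l\<^sup>2) ^ s / (\<eta>\<^sup>2 * (1 - l\<^sup>2)) \<le> \<beta>"
    and k: "odd k" and w: "1 \<le> w" and y: "1 \<le> y"
    and hi: "hi \<le> ramanujan_rho d * ((y + 1 / y) / 2)"
  shows "srw_tv G (s + t) \<le> \<eta> + (w ^ (k * Suc m) * ((w + (real d - 1) / w) / real d) ^ t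
      + ((real k + 1) * (y / sqrt (real d - 1)) ^ k + \<beta>) ^ m * sqrt (card (pverts G)))"
proof (rule srw_tv_le, rule W.abs_funpow_upper[OF l \<beta>])
  show "geronimus d k z \<le> (real k + 1) * (y / sqrt (real d - 1)) ^ k" if "z \<le> hi" for z
    by (rule geronimus_le) (use that hi k y d3 in auto)
  show "0 < k" using k by (rule odd_pos)
qed (use w y d3 in auto)

lemma srw_tv_le_direct:
  assumes l: "- l \<le> lo" "hi \<le> l" "0 \<le> l" "l < 1" "0 < \<eta>"
    and \<beta>: "(l\<^sup>2) ^ s / (\<eta>\<^sup>2 * (1 - l\<^sup>2)) \<le> \<beta>"
    and M: "hi \<le> M" "0 \<le> M"
  shows "srw_tv G (s + t) \<le> \<eta> + (M + \<beta>) ^ t * sqrt (card (pverts G))"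
  by (rule srw_tv_le, rule W.abs_funpow_upper_direct[OF l \<beta>]) (use M in auto)

lemma srw_tv_ge_volume: "1 - real d ^ t / card (pverts G) \<le> srw_tv G t"
  by (rule srw_tv_ge, rule W.tv_dist_law_lower_volume)

lemma srw_tv_ge_tree:
  assumes "1 \<le> w"
  shows "1 - 4 * (real d - 1) ^ r / card (pverts G)
      - 2 * (((real d - 1) * w + 1 / w) / real d) ^ t / w ^ r \<le> srw_tv G t"
  by (rule srw_tv_ge, rule W.tv_dist_law_lower_tree[OF _ d3 assms refl])

end

section \<open>Asymptotics\<close>

text \<open>The lower bound holds at all times up to c \<tau>, and the upper bound at one suitable
  time. This locates the infimum without monotonicity of the distance in time.\<close>

lemma cutoff_around_if_tv_bounds:
  fixes tv :: "nat \<Rightarrow> nat \<Rightarrow> real"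
  assumes \<tau>: "filterlim \<tau> at_top sequentially"
    and upper: "\<And>\<epsilon> c. 0 < \<epsilon> \<Longrightarrow> \<epsilon> < 1 \<Longrightarrow> 1 < c \<Longrightarrow> \<forall>\<^sub>F n in sequentially. \<exists>t. real t \<le> c * \<tau> n \<and> tv n t \<le> \<epsilon>"
    and lower: "\<And>\<epsilon> c. 0 < \<epsilon> \<Longrightarrow> \<epsilon> < 1 \<Longrightarrow> 0 < c \<Longrightarrow> c < 1 \<Longrightarrow>
      \<forall>\<^sub>F n in sequentially. \<forall>t. real t \<le> c * \<tau> n \<longrightarrow> \<epsilon> < tv n t"
  shows "cutoff_around (\<lambda>n \<epsilon>. Inf {t. tv n t \<le> \<epsilon>}) \<tau>"
  unfolding cutoff_around_def
proof
  fix \<epsilon> :: real assume "\<epsilon> \<in> {0<..<1}"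
  then have \<epsilon>: "0 < \<epsilon>" "\<epsilon> < 1" by auto
  show "(\<lambda>n. real (Inf {t. tv n t \<le> \<epsilon>}) / \<tau> n) \<longlonglongrightarrow> 1"
  proof (rule tendstoI)
    fix e :: real assume "0 < e"
    define e' where "e' = min e (1 / 2) / 2"
    have e': "0 < e'" "e' < e" "e' < 1" using \<open>0 < e\<close> by (auto simp: e'_def)
    have "\<forall>\<^sub>F n in sequentially. 0 < \<tau> n" using \<tau> by (simp add: filterlim_at_top_dense)
    moreover have "\<forall>\<^sub>F n in sequentially. \<exists>t. real t \<le> (1 + e') * \<tau> n \<and> tv n t \<le> \<epsilon>"
      using upper[OF \<epsilon>] e' by simp
    moreover have "\<forall>\<^sub>F n in sequentially. \<forall>t. real t \<le> (1 - e') * \<tau> n \<longrightarrow> \<epsilon> < tv n t"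
      using lower[OF \<epsilon>] e' by simp
    ultimately show "\<forall>\<^sub>F n in sequentially. dist (real (Inf {t. tv n t \<le> \<epsilon>}) / \<tau> n) 1 < e"
    proof eventually_elim
      case (elim n)
      define I where "I = Inf {t. tv n t \<le> \<epsilon>}"
      obtain t where t: "real t \<le> (1 + e') * \<tau> n" "tv n t \<le> \<epsilon>" using elim by auto
      \<comment> \<open>\<open>upper\<close> makes the set nonempty, so the infimum is attained and
        is not the default value 0.\<close>
      have "I \<in> {t. tv n t \<le> \<epsilon>}" unfolding I_def by (rule Inf_nat_def1) (use t in auto)
      then have "(1 - e') * \<tau> n < real I" using elim(3) by (metis mem_Collect_eq not_le)
      moreover have "I \<le> t" unfolding I_def by (rule cInf_lower) (use t in auto)
      then have "real I \<le> (1 + e') * \<tau> n" using t(1) by linarith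
      ultimately have "1 - e' < real I / \<tau> n" "real I / \<tau> n \<le> 1 + e'"
        using elim(1) by (auto simp: field_simps)
      then show ?case using e' unfolding I_def by (auto simp: dist_real_def)
    qed
  qed
qed

lemma eventually_exp_linear_le:
  fixes a b e :: real
  assumes "a < 0" "0 < e"
  shows "\<forall>\<^sub>F L in at_top. exp (a * L + b) \<le> e"
  using eventually_ge_at_top[of "(b - ln e) / - a"]
proof eventually_elim
  case (elim L)
  then have "a * L + b \<le> ln e" using assms(1) by (simp add: field_simps)
  then show ?case using assms(2) by (simp add: ln_ge_iff)
qed

lemma eventually_linear_le:
  fixes a b c :: real
  assumes "a < c"
  shows "\<forall>\<^sub>F L in at_top. a * L + b \<le> c * L"
  using eventually_ge_at_top[of "b / (c - a)"]
proof eventually_elim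
  case (elim L)
  then show ?case using assms by (simp add: field_simps)
qed

section \<open>The Ramanujan threshold and exponential moments\<close>

lemma ramanujan_rho_pos: "2 \<le> d \<Longrightarrow> 0 < ramanujan_rho d"
  by (simp add: ramanujan_rho_def)

text \<open>The bound is the value at d = 3, where \<rho> is largest.\<close>

lemma ramanujan_rho_le:
  assumes "3 \<le> d"
  shows "ramanujan_rho d \<le> sqrt (8 / 9)"
proof (rule real_le_rsqrt)
  have "0 \<le> (2 * real d - 3) * (real d - 3)" using assms by simp
  then have "36 * (real d - 1) \<le> 8 * (real d * real d)" by (simp add: algebra_simps)
  then show "(ramanujan_rho d)\<^sup>2 \<le> 8 / 9"
    using assms by (simp add: ramanujan_rho_def power_divide power_mult_distrib field_simps power2_eq_square)
qed

lemma ramanujan_rho_le_inverse_sqrt: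
  assumes "2 \<le> d"
  shows "ramanujan_rho d \<le> 2 * real d powr (- 1 / 2)"
proof -
  have "sqrt (real d - 1) \<le> sqrt (real d)" by simp
  then have "ramanujan_rho d \<le> 2 * sqrt (real d) / real d"
    unfolding ramanujan_rho_def by (intro divide_right_mono) auto
  also have "\<dots> = 2 * real d powr (- 1 / 2)"
    using assms by (simp add: powr_minus powr_half_sqrt[symmetric] field_simps powr_add[symmetric])
  finally show ?thesis .
qed

text \<open>Mean displacement on the tree is \<open>p = (d - 2) / d\<close> per step; both exponential moment
  estimates are first order in \<open>ln w\<close>.\<close>

lemma exists_moment_slow:
  fixes d :: real
  assumes "2 < d" "\<alpha> < 1"
  shows "\<exists>w>1. (w + (d - 1) / w) / d \<le> w powr (- \<alpha> * ((d - 2) / d))"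
proof -
  define p where "p = (d - 2) / d"
  \<comment> \<open>With w = exp \<theta> the claim is g \<theta> <= 1. As g 0 = 1 and the slope at
    0 is -(1 - \<alpha>) p, it holds for small positive \<theta>.\<close>
  define g where "g = (\<lambda>\<theta>::real. (exp \<theta> + (d - 1) * exp (- \<theta>)) / d * exp (\<alpha> * p * \<theta>))"
  have "(g has_real_derivative (- p + \<alpha> * p)) (at 0)"
    unfolding g_def p_def using assms
    by (auto intro!: derivative_eq_intros simp: field_simps)
  moreover have "- p + \<alpha> * p < 0"
  proof -
    have "0 < p" using assms by (simp add: p_def)
    then have "\<alpha> * p < 1 * p" using assms by (intro mult_strict_right_mono)
    then show ?thesis by simp
  qed
  ultimately obtain h where h: "0 < h" "\<And>x. 0 < x \<Longrightarrow> x < h \<Longrightarrow> g (0 + x) < g 0"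
    using DERIV_neg_dec_right by blast
  define \<theta> where "\<theta> = h / 2"
  have "g \<theta> < g 0" using h(2)[of \<theta>] h(1) by (simp add: \<theta>_def)
  then have "g \<theta> \<le> 1" using assms by (simp add: g_def)
  then have "(exp \<theta> + (d - 1) * exp (- \<theta>)) / d \<le> exp (- (\<alpha> * p * \<theta>))"
    by (simp add: g_def exp_minus field_simps)
  then have "(exp \<theta> + (d - 1) / exp \<theta>) / d \<le> exp \<theta> powr (- \<alpha> * p)"
    by (simp add: exp_minus powr_def divide_inverse mult_ac)
  moreover have "exp \<theta> > 1" using h(1) by (simp add: \<theta>_def)
  ultimately show ?thesis unfolding p_def by blast
qed

lemma exists_moment_fast:
  fixes d :: real
  assumes "2 < d" "1 < \<alpha>"
  shows "\<exists>w>1. ((d - 1) * w + 1 / w) / d \<le> w powr (\<alpha> * ((d - 2) / d))"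
proof -
  define p where "p = (d - 2) / d"
  define g where "g = (\<lambda>\<theta>::real. ((d - 1) * exp \<theta> + exp (- \<theta>)) / d * exp (- (\<alpha> * p * \<theta>)))"
  have "(g has_real_derivative (p - \<alpha> * p)) (at 0)"
    unfolding g_def p_def using assms
    by (auto intro!: derivative_eq_intros simp: field_simps)
  moreover have "p - \<alpha> * p < 0"
  proof -
    have "0 < p" using assms by (simp add: p_def)
    then have "1 * p < \<alpha> * p" using assms by (intro mult_strict_right_mono)
    then show ?thesis by simp
  qed
  ultimately obtain h where h: "0 < h" "\<And>x. 0 < x \<Longrightarrow> x < h \<Longrightarrow> g (0 + x) < g 0"
    using DERIV_neg_dec_right by blast
  define \<theta> where "\<theta> = h / 2"
  have "g \<theta> < g 0" using h(2)[of \<theta>] h(1) by (simp add: \<theta>_def)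
  then have "g \<theta> \<le> 1" using assms by (simp add: g_def)
  then have "g \<theta> * exp (\<alpha> * p * \<theta>) \<le> 1 * exp (\<alpha> * p * \<theta>)"
    by (rule mult_right_mono) simp
  then have "((d - 1) * exp \<theta> + exp (- \<theta>)) / d \<le> exp (\<alpha> * p * \<theta>)"
    by (simp only: g_def mult.assoc exp_add[symmetric]) simp
  then have "((d - 1) * exp \<theta> + 1 / exp \<theta>) / d \<le> exp \<theta> powr (\<alpha> * p)"
    by (simp add: exp_minus powr_def divide_inverse mult_ac)
  moreover have "exp \<theta> > 1" using h(1) by (simp add: \<theta>_def)
  ultimately show ?thesis unfolding p_def by blast
qed

text \<open>k + 1 is the polynomial loss in the bound on q_k; the factor 2 leaves room for a density
  of bad vertices as large as that bound.\<close>

lemma exists_odd_exponent: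
  fixes u :: real
  assumes "1 < u"
  shows "\<exists>k. odd k \<and> 2 * (real k + 1) \<le> u ^ k"
proof -
  have "(\<lambda>n. real n * inverse u ^ n) \<longlonglongrightarrow> 0"
    by (rule powser_times_n_limit_0) (use assms in \<open>auto simp: field_simps\<close>)
  then have "\<forall>\<^sub>F n in sequentially. real n * inverse u ^ n < 1 / 4"
    by (rule order_tendstoD) auto
  then obtain N0 where N0: "\<And>n. n \<ge> N0 \<Longrightarrow> real n * inverse u ^ n < 1 / 4"
    unfolding eventually_sequentially by auto
  define k where "k = 2 * N0 + 1"
  have "real k * inverse u ^ k < 1 / 4" by (rule N0) (simp add: k_def)
  then have "4 * real k < u ^ k" using assms by (simp add: field_simps power_inverse)
  moreover have "real k \<ge> 1" by (simp add: k_def)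
  moreover have "odd k" by (simp add: k_def)
  ultimately show ?thesis by (intro exI[of _ k]) auto
qed

lemma nat_ceiling_bounds:
  fixes x :: real
  assumes "0 \<le> x"
  shows "x \<le> real (nat \<lceil>x\<rceil>)" "real (nat \<lceil>x\<rceil>) \<le> x + 1"
  using assms by linarith+

section \<open>Sequences of Ramanujan graphs\<close>

locale ramanujan_sequence =
  fixes G :: "nat \<Rightarrow> 'a pair_pre_digraph" and d :: "nat \<Rightarrow> nat"
  assumes expander: "\<And>n. expander (G n) (d n)"
    and ramanujan: "asymp_one_sided_ramanujan d G"
begin

abbreviation N :: "nat \<Rightarrow> real" where
  "N n \<equiv> real (card (pverts (G n)))"

lemma degree_ge_3: "3 \<le> d n"
  using expander.d3[OF expander] .

lemma N_pos: "0 < N n"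
proof -
  interpret expander "G n" "d n" by (rule expander)
  show ?thesis by (rule W.N_pos)
qed

lemma N_ge_1: "1 \<le> N n"
  using N_pos[of n] unfolding of_nat_0_less_iff by simp

lemma exp_ln_N: "exp (ln (N n)) = N n" and sqrt_N: "sqrt (N n) = exp (ln (N n) / 2)"
proof -
  show "exp (ln (N n)) = N n" using N_pos by simp
  then have "sqrt (N n) = sqrt (exp (ln (N n) / 2) ^ 2)"
    by (simp add: exp_double[symmetric])
  then show "sqrt (N n) = exp (ln (N n) / 2)" by simp
qed

lemma ln_N_at_top: "filterlim (\<lambda>n. ln (N n)) at_top sequentially"
proof -
  have "filterlim (\<lambda>n. card (pverts (G n))) at_top sequentially"
    using ramanujan by (simp add: asymp_one_sided_ramanujan_def)
  then show ?thesis
    by (intro filterlim_compose[OF ln_at_top] filterlim_compose[OF filterlim_real_sequentially])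
qed

lemma delta_exists:
  obtains \<delta> where "\<delta> \<longlonglongrightarrow> 0" "\<And>n. srw_eigenvalues (G n) ! 1 \<le> ramanujan_rho (d n) powr (1 - \<delta> n)"
  using ramanujan by (auto simp: asymp_one_sided_ramanujan_def)

lemma eventually_second_eigenvalue_le:
  assumes "a < 1"
  shows "\<forall>\<^sub>F n in sequentially. srw_eigenvalues (G n) ! 1 \<le> ramanujan_rho (d n) powr a"
proof -
  obtain \<delta> where \<delta>: "\<delta> \<longlonglongrightarrow> 0" "\<And>n. srw_eigenvalues (G n) ! 1 \<le> ramanujan_rho (d n) powr (1 - \<delta> n)"
    by (rule delta_exists) auto
  have "\<forall>\<^sub>F n in sequentially. \<delta> n < 1 - a"
    using \<delta>(1) by (rule order_tendstoD) (use assms in simp)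
  then show ?thesis
  proof eventually_elim
    case (elim n)
    have "ramanujan_rho (d n) \<le> sqrt 1"
      using ramanujan_rho_le[OF degree_ge_3[of n]] by (rule order_trans) simp
    then have "ramanujan_rho (d n) powr (1 - \<delta> n) \<le> ramanujan_rho (d n) powr a"
      using elim ramanujan_rho_pos[of "d n"] degree_ge_3[of n] by (intro powr_mono') auto
    then show ?case using \<delta>(2)[of n] by simp
  qed
qed

text \<open>For d >= 3 the threshold stays away from 1 uniformly in the degree, and the exponent 1 -
  \<delta> is eventually above 1/2. The lower end comes from the liminf condition.\<close>

lemma uniform_gap:
  obtains l where "0 < l" "l < 1"
    "\<forall>\<^sub>F n in sequentially. - l \<le> Min {l \<in> set (srw_eigenvalues (G n)). l \<noteq> -1} \<and> srw_eigenvalues (G n) ! 1 \<le> l"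
proof -
  define h where "h = sqrt (8 / 9) powr (1 / 2)"
  have h: "0 < h" "h < 1"
    using powr_less_mono2[of "1 / 2" "sqrt (8 / 9)" 1] by (auto simp: h_def)
  have hi: "\<forall>\<^sub>F n in sequentially. srw_eigenvalues (G n) ! 1 \<le> h"
    using eventually_second_eigenvalue_le[of "1 / 2", simplified]
  proof eventually_elim
    case (elim n)
    have "ramanujan_rho (d n) powr (1 / 2) \<le> h"
      unfolding h_def using ramanujan_rho_le[OF degree_ge_3[of n]] ramanujan_rho_pos[of "d n"] degree_ge_3[of n]
      by (intro powr_mono2) auto
    then show ?case using elim by simp
  qed
  have "liminf (\<lambda>n. ereal (Min {l \<in> set (srw_eigenvalues (G n)). l \<noteq> -1})) > -1"
    using ramanujan unfolding asymp_one_sided_ramanujan_def by blast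
  then have "ereal (-1) < liminf (\<lambda>n. ereal (Min {l \<in> set (srw_eigenvalues (G n)). l \<noteq> -1}))"
    by (simp add: one_ereal_def)
  then obtain c where c: "ereal (-1) < ereal c" "ereal c < liminf (\<lambda>n. ereal (Min {l \<in> set (srw_eigenvalues (G n)). l \<noteq> -1}))"
    using ereal_dense2 by blast
  have lo: "\<forall>\<^sub>F n in sequentially. ereal c < ereal (Min {l \<in> set (srw_eigenvalues (G n)). l \<noteq> -1})"
    using c(2) by (rule less_LiminfD)
  show ?thesis
  proof (rule that[of "max h (- c)"])
    show "0 < max h (- c)" "max h (- c) < 1" using h c by auto
    show "\<forall>\<^sub>F n in sequentially. - max h (- c) \<le> Min {l \<in> set (srw_eigenvalues (G n)). l \<noteq> -1}
        \<and> srw_eigenvalues (G n) ! 1 \<le> max h (- c)"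
      using hi lo by eventually_elim (auto simp: le_max_iff_disj min_def)
  qed
qed

subsection \<open>Fixed degree\<close>

text \<open>The slack \<open>c\<close> is spent in powers of \<gamma>, where \<gamma>^5 = c and
  \<alpha> = 1/\<gamma>. Put L = ln N and q = D - 1. Total length k m near \<gamma>^2 L / ln q makes
  the contraction beat \<open>sqrt N\<close> by exp (-(\<gamma>-1) L/2). Time t near \<gamma>^4 L /
  (p ln q) covers distance \<gamma>^3 L / ln q up to small probability. The gap between \<gamma>^4
  and c absorbs \<open>s\<close> and rounding.\<close>

lemma fixed_degree_upper:
  assumes D: "\<And>n. d n = D" and \<epsilon>: "0 < \<epsilon>" and c: "1 < c"
  shows "\<forall>\<^sub>F n in sequentially. \<exists>t. real t \<le> c * (real D / (real D - 2) * log (real D - 1) (N n))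
    \<and> srw_tv (G n) t \<le> \<epsilon>"
proof -
  have D3: "3 \<le> D" using degree_ge_3[of 0] D by simp
  define \<gamma> where "\<gamma> = c powr (1 / 5)"
  have \<gamma>: "1 < \<gamma>" using c by (simp add: \<gamma>_def gr_one_powr)
  have \<gamma>4: "\<gamma> ^ 4 < c"
  proof -
    have "\<gamma> ^ 4 = c powr (4 / 5)" using c by (simp add: \<gamma>_def powr_realpow[symmetric] powr_powr)
    also have "\<dots> < c powr 1" using c by (intro powr_less_mono) auto
    finally show ?thesis using c by simp
  qed
  define \<alpha> where "\<alpha> = 1 / \<gamma>"
  have \<alpha>: "0 < \<alpha>" "\<alpha> < 1" using \<gamma> by (auto simp: \<alpha>_def)
  define q where "q = real D - 1"
  define lq where "lq = ln q"
  define p where "p = (real D - 2) / real D"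
  have q: "2 \<le> q" and lq: "0 < lq" and p: "0 < p" using D3 by (auto simp: q_def lq_def p_def)
  define b where "b = sqrt q"
  have b1: "1 < b" using q by (simp add: b_def)
  have lnb: "ln b = lq / 2" using q by (simp add: b_def lq_def ln_sqrt)
  \<comment> \<open>y^2 = b^(1-\<alpha>): one factor y^k pays for 2 (k+1), the other one is already
    in \<open>M\<close>, and b^(-\<alpha> k) is left.\<close>
  define y where "y = b powr ((1 - \<alpha>) / 2)"
  have y1: "1 < y" using b1 \<alpha> by (simp add: y_def gr_one_powr)
  obtain k where k: "odd k" "2 * (real k + 1) \<le> y ^ k" using exists_odd_exponent[OF y1] by auto
  have k0: "0 < real k" using k(1) by (simp add: odd_pos)
  define M where "M = (real k + 1) * (y / b) ^ k"
  have M0: "0 < M" using y1 b1 by (auto simp: M_def intro!: mult_pos_pos add_nonneg_pos)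
  have \<kappa>: "M + M \<le> exp (- \<alpha> * real k * lq / 2)"
  proof -
    have "M + M = 2 * (real k + 1) * (y / b) ^ k" by (simp add: M_def)
    also have "\<dots> \<le> y ^ k * (y / b) ^ k" using k y1 b1 by (intro mult_right_mono) auto
    also have "\<dots> = (y * y / b) ^ k" by (simp add: power_mult_distrib[symmetric])
    also have "y * y = b powr (1 - \<alpha>)" by (simp add: y_def powr_add[symmetric])
    also have "b powr (1 - \<alpha>) / b = exp (- \<alpha> * lq / 2)"
    proof -
      have "b powr (1 - \<alpha>) / b = b powr (1 - \<alpha>) / b powr 1" using b1 by simp
      also have "\<dots> = b powr (- \<alpha>)" unfolding powr_diff[symmetric] by simp
      also have "b powr (- \<alpha>) = exp (- \<alpha> * lq / 2)" using b1 lnb by (simp add: powr_def)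
      finally show ?thesis .
    qed
    also have "exp (- \<alpha> * lq / 2) ^ k = exp (- \<alpha> * real k * lq / 2)"
      by (simp add: exp_of_nat_mult[symmetric] mult_ac)
    finally show ?thesis .
  qed
  obtain w where w: "1 < w" "(w + (real D - 1) / w) / real D \<le> w powr (- \<alpha> * p)"
    using exists_moment_slow[of "real D" \<alpha>] D3 \<alpha> unfolding p_def by auto
  have lw: "0 < ln w" using w by simp
  define \<eta> where "\<eta> = \<epsilon> / 3"
  have \<eta>: "0 < \<eta>" using \<epsilon> by (simp add: \<eta>_def)
  obtain l where l: "0 < l" "l < 1"
    "\<forall>\<^sub>F n in sequentially. - l \<le> Min {l \<in> set (srw_eigenvalues (G n)). l \<noteq> -1} \<and> srw_eigenvalues (G n) ! 1 \<le> l"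
    by (rule uniform_gap)
  have l2: "l\<^sup>2 < 1" using l by (simp add: abs_square_less_1)
  then have "0 < M * (\<eta>\<^sup>2 * (1 - l\<^sup>2))" using M0 \<eta> by simp
  \<comment> \<open>\<open>s\<close> is independent of n and makes the bad set as sparse as the
    spectral bound \<open>M\<close>, hence the sum \<open>M + M\<close>.\<close>
  then obtain s where s: "(l\<^sup>2) ^ s < M * (\<eta>\<^sup>2 * (1 - l\<^sup>2))"
    using real_arch_pow_inv[OF _ l2] by blast
  have \<beta>: "(l\<^sup>2) ^ s / (\<eta>\<^sup>2 * (1 - l\<^sup>2)) \<le> M"
    using s l2 \<eta> by (simp add: divide_le_eq)
  \<comment> \<open>At fixed degree the powers of \<rho> with exponent 1 - \<delta> tend to \<rho>,
    and y > 1 leaves a constant factor above \<rho>.\<close>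
  have hi: "\<forall>\<^sub>F n in sequentially. srw_eigenvalues (G n) ! 1 \<le> ramanujan_rho D * ((y + 1 / y) / 2)"
  proof -
    obtain \<delta> where \<delta>: "\<delta> \<longlonglongrightarrow> 0" "\<And>n. srw_eigenvalues (G n) ! 1 \<le> ramanujan_rho (d n) powr (1 - \<delta> n)"
      by (rule delta_exists) auto
    have \<rho>: "0 < ramanujan_rho D" using D3 by (intro ramanujan_rho_pos) auto
    have "(\<lambda>n. ramanujan_rho D powr (1 - \<delta> n)) \<longlonglongrightarrow> ramanujan_rho D powr (1 - 0)"
      using \<delta>(1) \<rho> by (intro tendsto_intros) auto
    moreover have "ramanujan_rho D powr (1 - 0) < ramanujan_rho D * ((y + 1 / y) / 2)"
    proof -
      have "0 < (y - 1)\<^sup>2" using y1 by simp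
      then have "1 < (y + 1 / y) / 2" using y1 by (simp add: field_simps power2_eq_square)
      then show ?thesis using \<rho> by simp
    qed
    ultimately have "\<forall>\<^sub>F n in sequentially. ramanujan_rho D powr (1 - \<delta> n) < ramanujan_rho D * ((y + 1 / y) / 2)"
      by (rule order_tendstoD(2))
    then show ?thesis
    proof eventually_elim
      case (elim n)
      then show ?case using \<delta>(2)[of n] by (simp add: D)
    qed
  qed
  have "\<forall>\<^sub>F n in sequentially. exp (- ((\<gamma> - 1) / 2) * ln (N n) + 0) \<le> \<epsilon> / 3"
    by (rule eventually_compose_filterlim[OF eventually_exp_linear_le ln_N_at_top]) (use \<gamma> \<epsilon> in auto)
  moreover have "\<forall>\<^sub>F n in sequentially. exp (- (ln w * (\<gamma> ^ 3 - \<gamma>\<^sup>2) / lq) * ln (N n) + ln w * (2 * k)) \<le> \<epsilon> / 3"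
  proof (rule eventually_compose_filterlim[OF eventually_exp_linear_le ln_N_at_top])
    have "\<gamma>\<^sup>2 < \<gamma> ^ 3" using \<gamma> by (intro power_strict_increasing) auto
    then show "- (ln w * (\<gamma> ^ 3 - \<gamma>\<^sup>2) / lq) < 0" using lw lq by simp
  qed (use \<epsilon> in simp)
  moreover have "\<forall>\<^sub>F n in sequentially. \<gamma> ^ 4 / (p * lq) * ln (N n) + (s + 1) \<le> c / (p * lq) * ln (N n)"
    by (rule eventually_compose_filterlim[OF eventually_linear_le ln_N_at_top])
      (use \<gamma>4 p lq in \<open>auto intro: divide_strict_right_mono\<close>)
  ultimately show ?thesis
    using l(3) hi
  proof eventually_elim
    case (elim n)
    interpret expander "G n" "d n" by (rule expander)
    define L where "L = ln (N n)"
    have L0: "0 \<le> L" using N_ge_1[of n] by (simp add: L_def)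
    define m where "m = nat \<lceil>\<gamma>\<^sup>2 * L / (k * lq)\<rceil>"
    define t where "t = nat \<lceil>\<gamma> ^ 4 * L / (p * lq)\<rceil>"
    have m: "\<gamma>\<^sup>2 * L / (k * lq) \<le> m" "m \<le> \<gamma>\<^sup>2 * L / (k * lq) + 1"
      unfolding m_def by (rule nat_ceiling_bounds; use L0 lq in simp)+
    have t: "\<gamma> ^ 4 * L / (p * lq) \<le> t" "t \<le> \<gamma> ^ 4 * L / (p * lq) + 1"
      unfolding t_def by (rule nat_ceiling_bounds; use L0 lq p \<gamma> in simp)+
    have "srw_tv (G n) (s + t) \<le> \<eta> + (w ^ (k * Suc m) * ((w + (real D - 1) / w) / real D) ^ t
      + (M + M) ^ m * sqrt (N n))"
      using srw_tv_le_tree[of l \<eta> s M k w y t m] elim l \<eta> \<beta> k w y1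
      by (simp add: D M_def b_def q_def)
    also have "w ^ (k * Suc m) * ((w + (real D - 1) / w) / real D) ^ t \<le> \<epsilon> / 3"
    proof -
      have "w ^ (k * Suc m) * ((w + (real D - 1) / w) / real D) ^ t \<le> w ^ (k * Suc m) * (w powr (- \<alpha> * p)) ^ t"
        using w D3 by (intro mult_left_mono power_mono) auto
      also have "\<dots> = exp (ln w * (real k * (m + 1) - \<alpha> * p * t))"
      proof -
        have "w ^ (k * Suc m) = exp (real (k * Suc m) * ln w)" using w by (simp only: exp_of_nat_mult) simp
        moreover have "(w powr (- \<alpha> * p)) ^ t = exp (real t * (- \<alpha> * p * ln w))"
          using w by (simp only: exp_of_nat_mult powr_def) simp
        ultimately show ?thesis by (simp add: exp_add[symmetric] algebra_simps)
      qed
      also have "\<dots> \<le> exp (- (ln w * (\<gamma> ^ 3 - \<gamma>\<^sup>2) / lq) * ln (N n) + ln w * (2 * k))"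
      proof -
        have "real k * real m \<le> real k * (\<gamma>\<^sup>2 * L / (k * lq) + 1)" using m(2) by (intro mult_left_mono) auto
        also have "\<dots> = \<gamma>\<^sup>2 * L / lq + k" using k0 lq by (simp add: field_simps)
        finally have 1: "k * m \<le> \<gamma>\<^sup>2 * L / lq + k" by simp
        have "\<alpha> * p * (\<gamma> ^ 4 * L / (p * lq)) \<le> \<alpha> * p * t" using t(1) \<alpha> p by (intro mult_left_mono) auto
        moreover have "\<alpha> * p * (\<gamma> ^ 4 * L / (p * lq)) = \<gamma> ^ 3 * L / lq"
          using \<gamma> p lq by (simp add: \<alpha>_def field_simps power_numeral_reduce)
        ultimately have "real k * (m + 1) - \<alpha> * p * t \<le> \<gamma>\<^sup>2 * L / lq + 2 * k - \<gamma> ^ 3 * L / lq"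
          using 1 by (simp add: algebra_simps)
        then have "ln w * (real k * (m + 1) - \<alpha> * p * t) \<le> ln w * (\<gamma>\<^sup>2 * L / lq + 2 * k - \<gamma> ^ 3 * L / lq)"
          using lw by (intro mult_left_mono) auto
        also have "\<dots> = - (ln w * (\<gamma> ^ 3 - \<gamma>\<^sup>2) / lq) * ln (N n) + ln w * (2 * k)"
          using lq by (simp add: L_def field_simps)
        finally show ?thesis by simp
      qed
      also have "\<dots> \<le> \<epsilon> / 3" using elim by simp
      finally show ?thesis .
    qed
    also have "(M + M) ^ m * sqrt (N n) \<le> \<epsilon> / 3"
    proof -
      have "(M + M) ^ m * sqrt (N n) \<le> exp (- \<alpha> * real k * lq / 2) ^ m * exp (L / 2)"
        unfolding sqrt_N L_def using \<kappa> M0 by (intro mult_right_mono power_mono) auto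
      also have "\<dots> = exp (- \<alpha> * real k * lq / 2 * m + L / 2)"
        by (simp add: exp_of_nat_mult[symmetric] exp_add[symmetric] mult_ac)
      also have "\<dots> \<le> exp (- ((\<gamma> - 1) / 2) * ln (N n) + 0)"
      proof -
        have "\<alpha> * real k * lq / 2 * (\<gamma>\<^sup>2 * L / (k * lq)) \<le> \<alpha> * real k * lq / 2 * m"
          using m(1) \<alpha> lq by (intro mult_left_mono) auto
        moreover have "\<alpha> * real k * lq / 2 * (\<gamma>\<^sup>2 * L / (k * lq)) = \<gamma> * L / 2"
          using \<gamma> k0 lq by (simp add: \<alpha>_def field_simps power2_eq_square)
        ultimately have "- (\<alpha> * real k * lq / 2 * m) + L / 2 \<le> - (\<gamma> * L / 2) + L / 2" by simp
        also have "\<dots> = - ((\<gamma> - 1) / 2) * ln (N n) + 0" by (simp add: L_def field_simps)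
        finally show ?thesis by simp
      qed
      also have "\<dots> \<le> \<epsilon> / 3" using elim by simp
      finally show ?thesis .
    qed
    finally have "srw_tv (G n) (s + t) \<le> \<epsilon>" by (simp add: \<eta>_def)
    moreover have "real (s + t) \<le> c * (real D / (real D - 2) * log (real D - 1) (N n))"
    proof -
      have "real (s + t) \<le> \<gamma> ^ 4 / (p * lq) * L + (s + 1)" using t(2) by simp
      also have "\<dots> \<le> c / (p * lq) * L" using elim by (simp add: L_def)
      also have "\<dots> = c * (real D / (real D - 2) * log (real D - 1) (N n))"
        by (simp add: p_def lq_def q_def L_def log_def)
      finally show ?thesis .
    qed
    ultimately show ?case by blast
  qed
qed

text \<open>Here \<alpha>^3 = c. The radius r is about \<alpha> L / ln q with L = ln N and q = D -
  1, so the test set has at most 4 N^\<alpha> vertices. In the allowed time the mean distance p t is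
  at most \<alpha>^3 L / ln q; the moment estimate loses 1/\<alpha>, and \<alpha>^2 < \<alpha>
  leaves exponential decay.\<close>

lemma fixed_degree_lower:
  assumes D: "\<And>n. d n = D" and \<epsilon>: "\<epsilon> < 1" and c: "0 < c" "c < 1"
  shows "\<forall>\<^sub>F n in sequentially. \<forall>t. real t \<le> c * (real D / (real D - 2) * log (real D - 1) (N n))
    \<longrightarrow> \<epsilon> < srw_tv (G n) t"
proof -
  have D3: "3 \<le> D" using degree_ge_3[of 0] D by simp
  define \<alpha> where "\<alpha> = c powr (1 / 3)"
  have \<alpha>: "0 < \<alpha>" "\<alpha> < 1" using c powr_less_mono2[of "1 / 3" c 1] by (auto simp: \<alpha>_def)
  have \<alpha>3: "\<alpha> ^ 3 = c" using c by (simp add: \<alpha>_def powr_realpow[symmetric] powr_powr)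
  define q where "q = real D - 1"
  define lq where "lq = ln q"
  define p where "p = (real D - 2) / real D"
  have q: "2 \<le> q" and lq: "0 < lq" and p: "0 < p" using D3 by (auto simp: q_def lq_def p_def)
  obtain w where w: "1 < w" "((real D - 1) * w + 1 / w) / real D \<le> w powr (1 / \<alpha> * p)"
    using exists_moment_fast[of "real D" "1 / \<alpha>"] D3 \<alpha> unfolding p_def by auto
  have lw: "0 < ln w" using w by simp
  have "\<forall>\<^sub>F n in sequentially. exp (- (1 - \<alpha>) * ln (N n) + ln 4) \<le> (1 - \<epsilon>) / 3"
    by (rule eventually_compose_filterlim[OF eventually_exp_linear_le ln_N_at_top]) (use \<alpha> \<epsilon> in auto)
  moreover have "\<forall>\<^sub>F n in sequentially. exp (- (ln w * (\<alpha> - \<alpha>\<^sup>2) / lq) * ln (N n) + (ln 2 + ln w)) \<le> (1 - \<epsilon>) / 3"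
  proof (rule eventually_compose_filterlim[OF eventually_exp_linear_le ln_N_at_top])
    have "\<alpha> * \<alpha> < 1 * \<alpha>" using \<alpha> by (intro mult_strict_right_mono) auto
    then show "- (ln w * (\<alpha> - \<alpha>\<^sup>2) / lq) < 0" using lw lq by (simp add: power2_eq_square)
  qed (use \<epsilon> in simp)
  ultimately show ?thesis
  proof eventually_elim
    case (elim n)
    interpret expander "G n" "d n" by (rule expander)
    define L where "L = ln (N n)"
    have L0: "0 \<le> L" using N_ge_1[of n] by (simp add: L_def)
    define r where "r = nat \<lfloor>\<alpha> * L / lq\<rfloor>"
    have r: "r \<le> \<alpha> * L / lq" "\<alpha> * L / lq - 1 \<le> r"
    proof -
      have "0 \<le> \<alpha> * L / lq" using \<alpha> L0 lq by simp
      then show "r \<le> \<alpha> * L / lq" "\<alpha> * L / lq - 1 \<le> r" unfolding r_def by linarith+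
    qed
    show ?case
    proof (intro allI impI)
      fix t assume "real t \<le> c * (real D / (real D - 2) * log (real D - 1) (N n))"
      then have t: "p * t \<le> c * L / lq"
        using D3 lq by (simp add: p_def lq_def q_def L_def log_def field_simps)
      have "4 * (real D - 1) ^ r / N n \<le> (1 - \<epsilon>) / 3"
      proof -
        have "(real D - 1) ^ r = exp (r * lq)" using q by (simp add: exp_of_nat_mult lq_def q_def)
        also have "\<dots> \<le> exp (\<alpha> * L)" using r(1) lq by (simp add: field_simps)
        finally have "4 * (real D - 1) ^ r / N n \<le> 4 * exp (\<alpha> * L) / exp L"
          using N_pos[of n] by (simp add: L_def divide_right_mono)
        also have "\<dots> = exp (- (1 - \<alpha>) * ln (N n) + ln 4)"
          by (simp add: L_def exp_diff exp_add exp_minus field_simps)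
        finally show ?thesis using elim by simp
      qed
      moreover have "2 * (((real D - 1) * w + 1 / w) / real D) ^ t / w ^ r \<le> (1 - \<epsilon>) / 3"
      proof -
        have "(((real D - 1) * w + 1 / w) / real D) ^ t \<le> (w powr (1 / \<alpha> * p)) ^ t"
          using w D3 by (intro power_mono) auto
        also have "\<dots> = exp (real t * (1 / \<alpha> * p * ln w))"
          using w by (simp only: exp_of_nat_mult powr_def) simp
        also have "\<dots> \<le> exp (ln w * (\<alpha>\<^sup>2 * L / lq))"
        proof -
          have "ln w / \<alpha> * (p * t) \<le> ln w / \<alpha> * (c * L / lq)"
            using t lw \<alpha> by (intro mult_left_mono) auto
          also have "\<dots> = ln w * (\<alpha>\<^sup>2 * L / lq)"
            using \<alpha> unfolding \<alpha>3[symmetric] by (simp add: power2_eq_square power3_eq_cube)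
          finally show ?thesis by (simp add: mult_ac)
        qed
        finally have "2 * (((real D - 1) * w + 1 / w) / real D) ^ t / w ^ r \<le> 2 * exp (ln w * (\<alpha>\<^sup>2 * L / lq)) / w ^ r"
          using w by (simp add: divide_right_mono)
        also have "w ^ r = exp (r * ln w)" using w by (simp add: exp_of_nat_mult)
        also have "2 * exp (ln w * (\<alpha>\<^sup>2 * L / lq)) / exp (r * ln w) = exp (ln 2 + ln w * (\<alpha>\<^sup>2 * L / lq) - r * ln w)"
          by (simp add: exp_diff exp_add)
        also have "\<dots> \<le> exp (- (ln w * (\<alpha> - \<alpha>\<^sup>2) / lq) * ln (N n) + (ln 2 + ln w))"
        proof -
          have "ln w * (\<alpha> * L / lq - 1) \<le> ln w * r" using r(2) lw by (intro mult_left_mono) auto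
          moreover have "- (ln w * (\<alpha> - \<alpha>\<^sup>2) / lq) * L = ln w * (\<alpha>\<^sup>2 * L / lq) - ln w * (\<alpha> * L / lq)"
            using lq by (simp add: field_simps)
          ultimately show ?thesis unfolding L_def[symmetric]
            by (simp add: right_diff_distrib mult.commute[of "real r"])
        qed
        also have "\<dots> \<le> (1 - \<epsilon>) / 3" using elim by simp
        finally show ?thesis using w by (simp add: exp_of_nat_mult)
      qed
      moreover have "1 - 4 * (real D - 1) ^ r / N n - 2 * (((real D - 1) * w + 1 / w) / real D) ^ t / w ^ r
          \<le> srw_tv (G n) t"
        using srw_tv_ge_tree[of w r t] w(1) unfolding D by simp
      moreover have "\<epsilon> < v" if "A \<le> (1 - \<epsilon>) / 3" "B \<le> (1 - \<epsilon>) / 3" "1 - A - B \<le> v" for A B v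
      proof -
        have "3 * A \<le> 1 - \<epsilon>" "3 * B \<le> 1 - \<epsilon>" using that by (simp_all add: field_simps)
        then show ?thesis using that(3) \<epsilon> by argo
      qed
      ultimately show "\<epsilon> < srw_tv (G n) t" by blast
    qed
  qed
qed

lemma fixed_degree_cutoff:
  assumes D: "\<And>n. d n = D"
  shows "cutoff_around (\<lambda>n. srw_t_mix (G n)) (\<lambda>n. real D / (real D - 2) * log (real D - 1) (N n))"
proof -
  have D3: "3 \<le> D" using degree_ge_3[of 0] D by simp
  have "filterlim (\<lambda>n. real D / (real D - 2) / ln (real D - 1) * ln (N n)) at_top sequentially"
    by (rule filterlim_tendsto_pos_mult_at_top[OF tendsto_const _ ln_N_at_top]) (use D3 in simp)
  then have "filterlim (\<lambda>n. real D / (real D - 2) * log (real D - 1) (N n)) at_top sequentially"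
    by (simp add: log_def)
  then have "cutoff_around (\<lambda>n \<epsilon>. Inf {t. srw_tv (G n) t \<le> \<epsilon>}) (\<lambda>n. real D / (real D - 2) * log (real D - 1) (N n))"
    by (rule cutoff_around_if_tv_bounds) (use fixed_degree_upper[OF D] fixed_degree_lower[OF D] in auto)
  then show ?thesis by (simp add: srw_t_mix_eq[abs_def])
qed

subsection \<open>Growing degree\<close>

context
  assumes d_at_top: "filterlim d at_top sequentially"
    and ln_d_small: "(\<lambda>n. ln (real (d n))) \<in> o(\<lambda>n. log (real (d n)) (N n))"
begin

lemma ln_d_pos: "0 < ln (real (d n))"
  using degree_ge_3[of n] by simp

lemma log_d_N: "log (real (d n)) (N n) = ln (N n) / ln (real (d n))"
  by (simp add: log_def)

lemma log_d_N_nonneg: "0 \<le> log (real (d n)) (N n)"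
  unfolding log_d_N using ln_d_pos N_ge_1[of n] by (intro divide_nonneg_nonneg) (auto intro: less_imp_le)

lemma ln_d_at_top: "filterlim (\<lambda>n. ln (real (d n))) at_top sequentially"
  by (intro filterlim_compose[OF ln_at_top] filterlim_compose[OF filterlim_real_sequentially] d_at_top)

lemma eventually_ln_d_le:
  assumes "0 < e"
  shows "\<forall>\<^sub>F n in sequentially. ln (real (d n)) \<le> e * log (real (d n)) (N n)"
  using landau_o.smallD[OF ln_d_small assms]
proof eventually_elim
  case (elim n)
  then show ?case using ln_d_pos[of n] log_d_N_nonneg[of n] by simp
qed

text \<open>The little-o hypothesis puts the claimed cutoff time eventually above ln d, which
  diverges.\<close>

lemma log_d_N_at_top: "filterlim (\<lambda>n. log (real (d n)) (N n)) at_top sequentially"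
  by (rule filterlim_at_top_mono[OF ln_d_at_top]) (use eventually_ln_d_le[of 1] in simp)

text \<open>Now \<gamma>^3 = c, \<alpha> = 1/\<gamma>, and \<open>a\<close> lies between \<alpha>
  and 1. The second eigenvalue is at most 2 d^(-a/2) and the density at most d^(-1/2); their sum is
  at most 3 d^(-a/2), which is below d^(-\<alpha>/2) for large d. Then \<gamma>^2 ln N / ln d steps
  beat \<open>sqrt N\<close>.\<close>

lemma growing_degree_upper:
  assumes \<epsilon>: "0 < \<epsilon>" and c: "1 < c"
  shows "\<forall>\<^sub>F n in sequentially. \<exists>t. real t \<le> c * log (real (d n)) (N n) \<and> srw_tv (G n) t \<le> \<epsilon>"
proof -
  define \<gamma> where "\<gamma> = c powr (1 / 3)"
  have \<gamma>: "1 < \<gamma>" using c by (simp add: \<gamma>_def gr_one_powr)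
  have \<gamma>2: "\<gamma>\<^sup>2 < c"
  proof -
    have "\<gamma>\<^sup>2 = c powr (2 / 3)" using c by (simp add: \<gamma>_def powr_realpow[symmetric] powr_powr)
    also have "\<dots> < c powr 1" using c by (intro powr_less_mono) auto
    finally show ?thesis using c by simp
  qed
  define \<alpha> where "\<alpha> = 1 / \<gamma>"
  define a where "a = (1 + \<alpha>) / 2"
  have \<alpha>: "0 < \<alpha>" "\<alpha> < 1" using \<gamma> by (auto simp: \<alpha>_def)
  then have a: "\<alpha> < a" "a < 1" "0 < a" by (auto simp: a_def)
  define \<eta> where "\<eta> = \<epsilon> / 2"
  have \<eta>: "0 < \<eta>" using \<epsilon> by (simp add: \<eta>_def)
  obtain l where l: "0 < l" "l < 1"
    "\<forall>\<^sub>F n in sequentially. - l \<le> Min {l \<in> set (srw_eigenvalues (G n)). l \<noteq> -1} \<and> srw_eigenvalues (G n) ! 1 \<le> l"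
    by (rule uniform_gap)
  have l2: "l\<^sup>2 < 1" using l by (simp add: abs_square_less_1)
  define g where "g = \<eta>\<^sup>2 * (1 - l\<^sup>2)"
  have g: "0 < g" using l2 \<eta> by (simp add: g_def)
  define lam where "lam = - ln l"
  have lam: "0 < lam" using l by (simp add: lam_def)
  have "\<forall>\<^sub>F n in sequentially. exp (- ((\<gamma> - 1) / 2) * ln (N n) + 0) \<le> \<epsilon> / 2"
    by (rule eventually_compose_filterlim[OF eventually_exp_linear_le ln_N_at_top]) (use \<gamma> \<epsilon> in auto)
  moreover have "\<forall>\<^sub>F n in sequentially. exp (- (1 / 2) * ln (real (d n)) + - ln g) \<le> 1"
    by (rule eventually_compose_filterlim[OF eventually_exp_linear_le ln_d_at_top]) auto
  moreover have "\<forall>\<^sub>F n in sequentially. exp (- ((a - \<alpha>) / 2) * ln (real (d n)) + ln 3) \<le> 1"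
    by (rule eventually_compose_filterlim[OF eventually_exp_linear_le ln_d_at_top]) (use a in auto)
  \<comment> \<open>This constant makes ln d / (2 lam), the main part of \<open>s\<close>, at most
    half of the slack c - \<gamma>^2 times the cutoff time.\<close>
  moreover have "\<forall>\<^sub>F n in sequentially. ln (real (d n)) \<le> (lam * (c - \<gamma>\<^sup>2)) * log (real (d n)) (N n)"
    by (rule eventually_ln_d_le) (use lam \<gamma>2 in simp)
  moreover have "\<forall>\<^sub>F n in sequentially. ((c + \<gamma>\<^sup>2) / 2) * log (real (d n)) (N n) + 2 \<le> c * log (real (d n)) (N n)"
    by (rule eventually_compose_filterlim[OF eventually_linear_le log_d_N_at_top]) (use \<gamma>2 in simp)
  ultimately show ?thesis
    using l(3) eventually_second_eigenvalue_le[OF a(2)]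
  proof eventually_elim
    case (elim n)
    interpret expander "G n" "d n" by (rule expander)
    define L where "L = ln (N n)"
    define x where "x = ln (real (d n))"
    have x: "0 < x" using ln_d_pos[of n] by (simp add: x_def)
    have R: "log (real (d n)) (N n) = L / x" by (simp add: log_d_N L_def x_def)
    have L0: "0 \<le> L" using N_ge_1[of n] by (simp add: L_def)
    \<comment> \<open>Then l^(2 s) is at most 1/d. A factor d^(1/2) of it pays for division by the
      constant \<open>g\<close>, and d^(-1/2) remains as density.\<close>
    define s where "s = nat \<lceil>x / (2 * lam)\<rceil>"
    define t where "t = nat \<lceil>\<gamma>\<^sup>2 * (L / x)\<rceil>"
    have s: "x / (2 * lam) \<le> s" "s \<le> x / (2 * lam) + 1"
      unfolding s_def by (rule nat_ceiling_bounds; use x lam in simp)+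
    have t: "\<gamma>\<^sup>2 * (L / x) \<le> t" "t \<le> \<gamma>\<^sup>2 * (L / x) + 1"
      unfolding t_def by (rule nat_ceiling_bounds; use x L0 in simp)+
    define M where "M = 2 * exp (- a * x / 2)"
    have \<beta>: "(l\<^sup>2) ^ s / (\<eta>\<^sup>2 * (1 - l\<^sup>2)) \<le> exp (- x / 2)"
    proof -
      have "(l\<^sup>2) ^ s = exp (real (2 * s) * ln l)"
        using l by (simp add: exp_of_nat_mult power_mult[symmetric] del: of_nat_mult)
      also have "\<dots> \<le> exp (- x)"
        using s(1) lam by (simp add: lam_def field_simps)
      finally have "(l\<^sup>2) ^ s / g \<le> exp (- x) / g" using g by (intro divide_right_mono) auto
      also have "\<dots> = exp (- (1 / 2) * x + - ln g) * exp (- x / 2)"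
      proof -
        have "- (1 / 2) * x + - ln g + - x / 2 = - x - ln g" by simp
        then show ?thesis using g by (simp only: exp_add[symmetric] exp_diff exp_ln)
      qed
      also have "\<dots> \<le> 1 * exp (- x / 2)" using elim(2) unfolding x_def by (intro mult_right_mono) auto
      finally show ?thesis by (simp add: g_def)
    qed
    have hi: "srw_eigenvalues (G n) ! 1 \<le> M"
    proof -
      have "ramanujan_rho (d n) powr a \<le> (2 * real (d n) powr (- 1 / 2)) powr a"
        using ramanujan_rho_le_inverse_sqrt[of "d n"] ramanujan_rho_pos[of "d n"] degree_ge_3[of n] a
        by (intro powr_mono2) auto
      also have "\<dots> = 2 powr a * exp (- a * x / 2)"
      proof -
        have "(2 * real (d n) powr (- 1 / 2)) powr a = 2 powr a * real (d n) powr (- 1 / 2 * a)"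
          using degree_ge_3[of n] by (simp only: powr_mult powr_powr)
        also have "real (d n) powr (- 1 / 2 * a) = exp (- a * x / 2)"
          using degree_ge_3[of n] by (simp add: powr_def x_def)
        finally show ?thesis .
      qed
      also have "\<dots> \<le> 2 powr 1 * exp (- a * x / 2)"
        using a by (intro mult_right_mono powr_mono) auto
      finally show ?thesis using elim by (simp add: M_def)
    qed
    have "srw_tv (G n) (s + t) \<le> \<eta> + (M + exp (- x / 2)) ^ t * sqrt (N n)"
      by (rule srw_tv_le_direct[OF _ _ _ _ \<eta> \<beta> hi]) (use elim l in \<open>auto simp: M_def\<close>)
    also have "(M + exp (- x / 2)) ^ t * sqrt (N n) \<le> \<epsilon> / 2"
    proof -
      have "a * x \<le> 1 * x" using a x by (intro mult_right_mono) auto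
      then have "M + exp (- x / 2) \<le> 3 * exp (- a * x / 2)" by (simp add: M_def)
      also have "\<dots> = exp (- ((a - \<alpha>) / 2) * x + ln 3) * exp (- \<alpha> * x / 2)"
      proof -
        have "exp (- ((a - \<alpha>) / 2) * x + ln 3) * exp (- \<alpha> * x / 2) = exp (ln 3 + (- a * x / 2))"
          unfolding exp_add[symmetric] by (rule arg_cong[where f = exp]) (simp add: field_simps)
        also have "\<dots> = 3 * exp (- a * x / 2)" unfolding exp_add by simp
        finally show ?thesis by simp
      qed
      also have "\<dots> \<le> 1 * exp (- \<alpha> * x / 2)" using elim(3) unfolding x_def by (intro mult_right_mono) auto
      finally have "(M + exp (- x / 2)) ^ t * sqrt (N n) \<le> exp (- \<alpha> * x / 2) ^ t * exp (L / 2)"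
        unfolding sqrt_N L_def by (intro mult_right_mono power_mono) (auto simp: M_def)
      also have "\<dots> = exp (- \<alpha> * x / 2 * t + L / 2)"
        by (simp add: exp_of_nat_mult[symmetric] exp_add[symmetric] mult_ac)
      also have "\<dots> \<le> exp (- ((\<gamma> - 1) / 2) * ln (N n) + 0)"
      proof -
        have "\<alpha> * x / 2 * (\<gamma>\<^sup>2 * (L / x)) \<le> \<alpha> * x / 2 * t"
          using t(1) \<alpha> x by (intro mult_left_mono) auto
        moreover have "\<alpha> * x / 2 * (\<gamma>\<^sup>2 * (L / x)) = \<gamma> * L / 2"
          using \<gamma> x by (simp add: \<alpha>_def field_simps power2_eq_square)
        ultimately have "- (\<alpha> * x / 2 * t) + L / 2 \<le> - (\<gamma> * L / 2) + L / 2" by simp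
        also have "\<dots> = - ((\<gamma> - 1) / 2) * ln (N n) + 0" by (simp add: L_def field_simps)
        finally show ?thesis by simp
      qed
      also have "\<dots> \<le> \<epsilon> / 2" using elim by simp
      finally show ?thesis .
    qed
    finally have "srw_tv (G n) (s + t) \<le> \<epsilon>" by (simp add: \<eta>_def)
    moreover have "real (s + t) \<le> c * log (real (d n)) (N n)"
    proof -
      have "x / (2 * lam) \<le> (c - \<gamma>\<^sup>2) / 2 * (L / x)"
      proof -
        have "x / (2 * lam) \<le> lam * (c - \<gamma>\<^sup>2) * (L / x) / (2 * lam)"
          using elim(4) lam unfolding R x_def[symmetric] by (intro divide_right_mono) auto
        also have "\<dots> = (c - \<gamma>\<^sup>2) / 2 * (L / x)" using lam by simp
        finally show ?thesis .
      qed
      then have "real (s + t) \<le> ((c + \<gamma>\<^sup>2) / 2) * (L / x) + 2"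
        using s(2) t(2) by (simp add: algebra_simps add_divide_distrib diff_divide_distrib)
      also have "\<dots> \<le> c * (L / x)" using elim(5) unfolding R .
      finally show ?thesis unfolding R .
    qed
    ultimately show ?case by blast
  qed
qed

lemma growing_degree_lower:
  assumes \<epsilon>: "\<epsilon> < 1" and c: "c < 1"
  shows "\<forall>\<^sub>F n in sequentially. \<forall>t. real t \<le> c * log (real (d n)) (N n) \<longrightarrow> \<epsilon> < srw_tv (G n) t"
proof -
  have "\<forall>\<^sub>F n in sequentially. exp (- (1 - c) * ln (N n) + 0) \<le> (1 - \<epsilon>) / 2"
    by (rule eventually_compose_filterlim[OF eventually_exp_linear_le ln_N_at_top]) (use c \<epsilon> in auto)
  then show ?thesis
  proof eventually_elim
    case (elim n)
    interpret expander "G n" "d n" by (rule expander)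
    show ?case
    proof (intro allI impI)
      fix t assume t: "real t \<le> c * log (real (d n)) (N n)"
      have "real (d n) ^ t = exp (t * ln (real (d n)))"
        using degree_ge_3[of n] by (simp add: exp_of_nat_mult)
      also have "\<dots> \<le> exp (c * ln (N n))"
        using t ln_d_pos[of n] unfolding log_d_N by (simp add: pos_le_divide_eq)
      finally have "real (d n) ^ t / N n \<le> exp (c * ln (N n)) / exp (ln (N n))"
        unfolding exp_ln_N by (rule divide_right_mono) simp
      also have "\<dots> = exp (- (1 - c) * ln (N n) + 0)"
        unfolding exp_diff[symmetric] by (simp add: algebra_simps)
      also have "\<dots> \<le> (1 - \<epsilon>) / 2" by (rule elim)
      finally have "real (d n) ^ t / N n \<le> (1 - \<epsilon>) / 2" .
      then have "1 - (1 - \<epsilon>) / 2 \<le> srw_tv (G n) t" using srw_tv_ge_volume[of t] by linarith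
      then show "\<epsilon> < srw_tv (G n) t" using \<epsilon> by (simp add: field_simps)
    qed
  qed
qed

lemma growing_degree_cutoff:
  "cutoff_around (\<lambda>n. srw_t_mix (G n)) (\<lambda>n. log (real (d n)) (N n))"
proof -
  have "cutoff_around (\<lambda>n \<epsilon>. Inf {t. srw_tv (G n) t \<le> \<epsilon>}) (\<lambda>n. log (real (d n)) (N n))"
    by (rule cutoff_around_if_tv_bounds[OF log_d_N_at_top])
      (use growing_degree_upper growing_degree_lower in auto)
  then show ?thesis by (simp add: srw_t_mix_eq[abs_def])
qed

end

end

theorem theorem1p3:
  fixes G :: "nat \<Rightarrow> 'a pair_pre_digraph" and d :: "nat \<Rightarrow> nat"
  assumes regular: "\<And>n. regular_graph (d n) (G n)"
    and degree: "\<And>n. d n \<ge> 3"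
    and connected: "\<And>n. Digraph_Component.connected (with_proj (G n))"
    and non_bipartite: "\<And>n. \<not> bipartite (G n)"
    and ramanujan: "asymp_one_sided_ramanujan d G"
  shows "(\<forall>k. (\<forall>n. d n = k) \<and>
             (\<exists>r :: nat \<Rightarrow> real. filterlim r at_top sequentially \<and>
                (\<exists>C :: nat. \<forall>n. \<forall>v\<in>pverts (G n). card (simple_cycles (graph_ball (G n) v (r n))) \<le> C))
           \<longrightarrow> cutoff_around (\<lambda>n. srw_t_mix (G n))
                 (\<lambda>n. real k / (real k - 2) * log (real k - 1) (real (card (pverts (G n))))))
       \<and> (filterlim d at_top sequentially \<and>
          (\<lambda>n. ln (real (d n))) \<in> o(\<lambda>n. log (real (d n)) (real (card (pverts (G n)))))
           \<longrightarrow> cutoff_around (\<lambda>n. srw_t_mix (G n))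
                 (\<lambda>n. log (real (d n)) (real (card (pverts (G n))))))"
proof -
  have seq: "ramanujan_sequence G d"
    using assms by (simp add: ramanujan_sequence_def expander_def)
  have i: "cutoff_around (\<lambda>n. srw_t_mix (G n))
      (\<lambda>n. real k / (real k - 2) * log (real k - 1) (real (card (pverts (G n)))))"
    if "\<forall>n. d n = k" for k
    using ramanujan_sequence.fixed_degree_cutoff[OF seq] that by blast
  have ii: "cutoff_around (\<lambda>n. srw_t_mix (G n)) (\<lambda>n. log (real (d n)) (real (card (pverts (G n)))))"
    if "filterlim d at_top sequentially"
      "(\<lambda>n. ln (real (d n))) \<in> o(\<lambda>n. log (real (d n)) (real (card (pverts (G n)))))"
    using ramanujan_sequence.growing_degree_cutoff[OF seq that] .
  from i ii show ?thesis by blast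
qed

end
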